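(* Let $M$ be a smooth manifold, let $F$ be a smooth vector field on $M$ tangent to $\partial M$, and let $\mathbf{F}$ be its local flow. (1) Let $z\in M$, let $\alpha:(M,z)\to\mathbb{R}$ be a germ of a smooth function at $z$, and let $f:M\to M$ be the germ at $z$ of the smooth map defined by $f(x)=\mathbf{F}(x,\alpha(x))$. Suppose that $f$ is a germ of a diffeomorphism at $z$. Then $$f_*F=(1+F(\alpha))\cdot F,$$ where $f_*F=Tf\circ F\circ f^{-1}$ is the vector field induced by $f$, and $F(\alpha)$ is the derivative of $\alpha$ along $F$. Thus $f_*F$ is just a reparametrization of $F$. (2) If $\alpha:M\to\mathbb{R}$ is defined on all of $M$ and $f=\varphi(\alpha)$ is a diffeomorphism of $M$, where $\varphi$ is the shift map of $F$, then $$Sh(f_*F)=Sh(F).$$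
   Context: For a smooth vector field $F$ on $M$ tangent to $\partial M$ and $x\in M$, let $o_x:(a_x,b_x)\to M$ be the maximal integral trajectory of $F$ with $o_x(0)=x$. Put $\mathsf{dom}(\mathbf{F})=\bigcup_{x\in M}\{x\}\times(a_x,b_x)\subset M\times\mathbb{R}$, an open neighbourhood of $M\times\{0\}$. The local flow of $F$ is the map $\mathbf{F}:\mathsf{dom}(\mathbf{F})\to M$, $\mathbf{F}(x,t)=o_x(t)$. $\mathsf{func}(F)\subset C^\infty(M,\mathbb{R})$ is the set of smooth functions $\alpha:M\to\mathbb{R}$ whose graph $\{(x,\alpha(x)):x\in M\}$ is contained in $\mathsf{dom}(\mathbf{F})$. The shift map of $F$ is $$\varphi:\mathsf{func}(F)\to C^\infty(M,M),\qquad \varphi(\alpha)(x)=\mathbf{F}(x,\alpha(x)),$$ and its image is denoted $Sh(F)\subset C^\infty(M,M)$; the same notation is used for any other vector field on $M$. A reparametrization of $F$ is a vector field of the form $\mu F$, the product of $F$ with a smooth function $\mu$.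
   Formalization: In (1) the factor is taken at the preimage: f_*F = (1 + F(α)∘f⁻¹)·F near f(z); read literally, with F(α) at the same point, the formula fails, e.g. for M = ℝ, F = d/dx, α(x) = x², z = 0. *)

theory Defs
  imports "HOL-Analysis.Analysis"
begin

section \<open>Smooth maps between subsets of Euclidean spaces\<close>

primrec C_k_on :: "nat \<Rightarrow> 'a::euclidean_space set \<Rightarrow> ('a \<Rightarrow> 'b::real_normed_vector) \<Rightarrow> bool" where
  "C_k_on 0 S f \<longleftrightarrow> continuous_on S f"
| "C_k_on (Suc k) S f \<longleftrightarrow>
     (\<forall>x\<in>S. f differentiable (at x)) \<and>
     (\<forall>v. C_k_on k S (\<lambda>x. frechet_derivative f (at x) v))"

text \<open>\<^const>\<open>C_k_on\<close> is meaningful for open sets. On an arbitrary set, such as a relatively open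
  subset of a half-space, smooth means: locally the restriction of a smooth map on an open set.\<close>

definition smooth_on :: "'a::euclidean_space set \<Rightarrow> ('a \<Rightarrow> 'b::real_normed_vector) \<Rightarrow> bool" where
  "smooth_on S f \<longleftrightarrow>
     (\<forall>x\<in>S. \<exists>W g. open W \<and> x \<in> W \<and> (\<forall>k. C_k_on k W g) \<and> (\<forall>y\<in>S \<inter> W. g y = f y))"


section \<open>Smooth manifolds with boundary\<close>

text \<open>The manifold is a whole type. A chart is a domain together with a coordinate map, whose values
  outside the domain are irrelevant. The model is the set of all \<open>v\<close> in a subspace \<open>V\<close> with
  \<open>0 \<le> v \<bullet> e\<close>, where \<open>e \<in> V\<close>: a half-space of \<open>V\<close> if \<open>e \<noteq> 0\<close>, and \<open>V\<close> itself if \<open>e = 0\<close>. The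
  dimension of the manifold is \<open>dim V\<close>; the subspace is there because a type of class
  \<^class>\<open>euclidean_space\<close> is never of dimension zero.\<close>

type_synonym ('a, 'e) chart = "'a set \<times> ('a \<Rightarrow> 'e)"

definition half_space :: "'e::euclidean_space set \<Rightarrow> 'e \<Rightarrow> 'e set" where
  "half_space V e = {v \<in> V. 0 \<le> v \<bullet> e}"

abbreviation chart_image :: "('a, 'e) chart \<Rightarrow> 'e set" where
  "chart_image c \<equiv> snd c ` fst c"

abbreviation chart_inv :: "('a, 'e) chart \<Rightarrow> 'e \<Rightarrow> 'a" where
  "chart_inv c \<equiv> inv_into (fst c) (snd c)"

definition is_chart ::
    "'e::euclidean_space set \<Rightarrow> 'e \<Rightarrow> ('a::topological_space, 'e) chart \<Rightarrow> bool" where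
  "is_chart V e c \<longleftrightarrow>
     open (fst c) \<and> openin (top_of_set (half_space V e)) (chart_image c) \<and>
     homeomorphism (fst c) (chart_image c) (snd c) (chart_inv c)"

text \<open>The atlas need not be maximal: the notions below depend only on the smooth structure that
  it generates.\<close>

definition smooth_manifold ::
    "'e::euclidean_space set \<Rightarrow> 'e \<Rightarrow>
     ('a::{t2_space, second_countable_topology}, 'e) chart set \<Rightarrow> bool" where
  "smooth_manifold V e A \<longleftrightarrow>
     subspace V \<and> e \<in> V \<and>
     (\<forall>c\<in>A. is_chart V e c) \<and> (\<Union>c\<in>A. fst c) = UNIV \<and>
     (\<forall>c\<in>A. \<forall>d\<in>A. smooth_on (snd c ` (fst c \<inter> fst d)) (snd d \<circ> chart_inv c))"

definition manifold_boundary :: "'e::euclidean_space \<Rightarrow> ('a, 'e) chart set \<Rightarrow> 'a set" where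
  "manifold_boundary e A = {p. e \<noteq> 0 \<and> (\<exists>c\<in>A. p \<in> fst c \<and> snd c p \<bullet> e = 0)}"

definition smooth_function_on ::
    "('a, 'e::euclidean_space) chart set \<Rightarrow> 'a set \<Rightarrow> ('a \<Rightarrow> real) \<Rightarrow> bool" where
  "smooth_function_on A W \<alpha> \<longleftrightarrow> (\<forall>c\<in>A. smooth_on (snd c ` (fst c \<inter> W)) (\<alpha> \<circ> chart_inv c))"

definition smooth_map_on ::
    "('a::topological_space, 'e::euclidean_space) chart set \<Rightarrow> 'a set \<Rightarrow> ('a \<Rightarrow> 'a) \<Rightarrow> bool" where
  "smooth_map_on A W f \<longleftrightarrow>
     continuous_on W f \<and>
     (\<forall>c\<in>A. \<forall>d\<in>A. smooth_on (snd c ` (fst c \<inter> W \<inter> f -` fst d)) (snd d \<circ> f \<circ> chart_inv c))"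

definition diffeomorphism ::
    "('a::topological_space, 'e::euclidean_space) chart set \<Rightarrow> ('a \<Rightarrow> 'a) \<Rightarrow> bool" where
  "diffeomorphism A f \<longleftrightarrow>
     bij f \<and> smooth_map_on A UNIV f \<and> smooth_map_on A UNIV (inv f)"


section \<open>Germs\<close>

text \<open>Germs at \<open>z\<close> are represented by total functions of which only the values near \<open>z\<close> matter.\<close>

definition smooth_function_germ ::
    "('a::topological_space, 'e::euclidean_space) chart set \<Rightarrow> 'a \<Rightarrow> ('a \<Rightarrow> real) \<Rightarrow> bool" where
  "smooth_function_germ A z \<alpha> \<longleftrightarrow> (\<exists>W. open W \<and> z \<in> W \<and> smooth_function_on A W \<alpha>)"

text \<open>The germ of \<open>f\<close> at \<open>z\<close> is a germ of a diffeomorphism, with the germ of \<open>g\<close> at \<open>f z\<close> as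
  its inverse.\<close>

definition diffeomorphism_germ ::
    "('a::topological_space, 'e::euclidean_space) chart set \<Rightarrow> 'a \<Rightarrow>
     ('a \<Rightarrow> 'a) \<Rightarrow> ('a \<Rightarrow> 'a) \<Rightarrow> bool" where
  "diffeomorphism_germ A z f g \<longleftrightarrow>
     (\<exists>W. open W \<and> z \<in> W \<and> open (f ` W) \<and> (\<forall>x\<in>W. g (f x) = x) \<and>
          smooth_map_on A W f \<and> smooth_map_on A (f ` W) g)"


section \<open>Tangent vectors and vector fields\<close>

text \<open>A tangent vector at \<open>p\<close> is the family of its coordinate vectors in the charts around \<open>p\<close>,
  related by the derivatives of the coordinate changes; it is set to zero on all other arguments, so
  that equality of tangent vectors is equality of functions. Derivatives are taken within the
  chart image, where only their values on \<open>V\<close> are determined.\<close>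

type_synonym ('a, 'e) tangent_vector = "('a, 'e) chart \<Rightarrow> 'e"
type_synonym ('a, 'e) vector_field = "'a \<Rightarrow> ('a, 'e) tangent_vector"

abbreviation charts_at :: "('a, 'e) chart set \<Rightarrow> 'a \<Rightarrow> ('a, 'e) chart set" where
  "charts_at A p \<equiv> {c \<in> A. p \<in> fst c}"

definition tangent_space ::
    "'e::euclidean_space set \<Rightarrow> ('a, 'e) chart set \<Rightarrow> 'a \<Rightarrow> ('a, 'e) tangent_vector set" where
  "tangent_space V A p =
     {w. (\<forall>c\<in>charts_at A p. w c \<in> V) \<and>
         (\<forall>c\<in>charts_at A p. \<forall>d\<in>charts_at A p.
            w d = frechet_derivative (snd d \<circ> chart_inv c) (at (snd c p) within chart_image c) (w c)) \<and>
         (\<forall>c. c \<notin> charts_at A p \<longrightarrow> w c = 0)}"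

definition smooth_vector_field ::
    "'e::euclidean_space set \<Rightarrow> ('a, 'e) chart set \<Rightarrow> ('a, 'e) vector_field \<Rightarrow> bool" where
  "smooth_vector_field V A F \<longleftrightarrow>
     (\<forall>p. F p \<in> tangent_space V A p) \<and>
     (\<forall>c\<in>A. smooth_on (chart_image c) (\<lambda>u. F (chart_inv c u) c))"

definition tangent_to_boundary ::
    "'e::euclidean_space \<Rightarrow> ('a, 'e) chart set \<Rightarrow> ('a, 'e) vector_field \<Rightarrow> bool" where
  "tangent_to_boundary e A F \<longleftrightarrow>
     (\<forall>p\<in>manifold_boundary e A. \<forall>c\<in>charts_at A p. F p c \<bullet> e = 0)"

definition scale_field ::
    "('a \<Rightarrow> real) \<Rightarrow> ('a, 'e::real_vector) vector_field \<Rightarrow> ('a, 'e) vector_field" where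
  "scale_field \<mu> F = (\<lambda>p c. \<mu> p *\<^sub>R F p c)"

definition reparametrization_germ ::
    "('a::topological_space, 'e::euclidean_space) chart set \<Rightarrow> 'a \<Rightarrow>
     ('a, 'e) vector_field \<Rightarrow> ('a, 'e) vector_field \<Rightarrow> bool" where
  "reparametrization_germ A y F G \<longleftrightarrow>
     (\<exists>\<mu>. smooth_function_germ A y \<mu> \<and> (\<forall>\<^sub>F x in nhds y. G x = scale_field \<mu> F x))"

text \<open>On tangent vectors, the next two definitions do not depend on the chosen chart \<open>c\<close>.\<close>

definition tangent_map ::
    "('a, 'e::euclidean_space) chart set \<Rightarrow> ('a \<Rightarrow> 'a) \<Rightarrow> 'a \<Rightarrow>
     ('a, 'e) tangent_vector \<Rightarrow> ('a, 'e) tangent_vector" where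
  "tangent_map A f p w =
     (let c = (SOME c. c \<in> charts_at A p) in
      (\<lambda>d. if d \<in> charts_at A (f p)
           then frechet_derivative (snd d \<circ> f \<circ> chart_inv c)
                  (at (snd c p) within chart_image c) (w c)
           else 0))"

definition derivative_along ::
    "('a, 'e::euclidean_space) chart set \<Rightarrow> ('a, 'e) vector_field \<Rightarrow> ('a \<Rightarrow> real) \<Rightarrow> 'a \<Rightarrow> real" where
  "derivative_along A F \<alpha> p =
     (let c = (SOME c. c \<in> charts_at A p) in
      frechet_derivative (\<alpha> \<circ> chart_inv c) (at (snd c p) within chart_image c) (F p c))"

text \<open>The vector field induced by \<open>f\<close>, where \<open>g\<close> is the inverse of \<open>f\<close>.\<close>

definition pushforward ::
    "('a, 'e::euclidean_space) chart set \<Rightarrow> ('a \<Rightarrow> 'a) \<Rightarrow> ('a \<Rightarrow> 'a) \<Rightarrow>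
     ('a, 'e) vector_field \<Rightarrow> ('a, 'e) vector_field" where
  "pushforward A f g F = (\<lambda>y. tangent_map A f (g y) (F (g y)))"


section \<open>Local flows and shift maps\<close>

definition integral_trajectory ::
    "('a::topological_space, 'e::euclidean_space) chart set \<Rightarrow> ('a, 'e) vector_field \<Rightarrow> 'a \<Rightarrow>
     real set \<Rightarrow> (real \<Rightarrow> 'a) \<Rightarrow> bool" where
  "integral_trajectory A F x I \<gamma> \<longleftrightarrow>
     open I \<and> is_interval I \<and> 0 \<in> I \<and> \<gamma> 0 = x \<and> continuous_on I \<gamma> \<and>
     (\<forall>t\<in>I. \<forall>c\<in>charts_at A (\<gamma> t). ((snd c \<circ> \<gamma>) has_vector_derivative F (\<gamma> t) c) (at t))"

definition maximal_trajectory ::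
    "('a::topological_space, 'e::euclidean_space) chart set \<Rightarrow> ('a, 'e) vector_field \<Rightarrow> 'a \<Rightarrow>
     real set \<Rightarrow> (real \<Rightarrow> 'a) \<Rightarrow> bool" where
  "maximal_trajectory A F x I \<gamma> \<longleftrightarrow>
     integral_trajectory A F x I \<gamma> \<and>
     (\<forall>J \<delta>. integral_trajectory A F x J \<delta> \<and> I \<subseteq> J \<and> (\<forall>t\<in>I. \<delta> t = \<gamma> t) \<longrightarrow> J = I)"

definition trajectory_interval ::
    "('a::topological_space, 'e::euclidean_space) chart set \<Rightarrow> ('a, 'e) vector_field \<Rightarrow> 'a \<Rightarrow>
     real set" where
  "trajectory_interval A F x = (THE I. \<exists>\<gamma>. maximal_trajectory A F x I \<gamma>)"

definition flow_domain ::
    "('a::topological_space, 'e::euclidean_space) chart set \<Rightarrow> ('a, 'e) vector_field \<Rightarrow>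
     ('a \<times> real) set" where
  "flow_domain A F = (SIGMA x:UNIV. trajectory_interval A F x)"

text \<open>\<^const>\<open>maximal_trajectory\<close> determines \<open>\<gamma>\<close> only on its interval, so the values of the local flow
  outside \<^const>\<open>flow_domain\<close> are meaningless.\<close>

definition local_flow ::
    "('a::topological_space, 'e::euclidean_space) chart set \<Rightarrow> ('a, 'e) vector_field \<Rightarrow>
     'a \<Rightarrow> real \<Rightarrow> 'a" where
  "local_flow A F x = (SOME \<gamma>. maximal_trajectory A F x (trajectory_interval A F x) \<gamma>)"

definition func ::
    "('a::topological_space, 'e::euclidean_space) chart set \<Rightarrow> ('a, 'e) vector_field \<Rightarrow>
     ('a \<Rightarrow> real) set" where
  "func A F = {\<alpha>. smooth_function_on A UNIV \<alpha> \<and> (\<forall>x. (x, \<alpha> x) \<in> flow_domain A F)}"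

definition shift_map ::
    "('a::topological_space, 'e::euclidean_space) chart set \<Rightarrow> ('a, 'e) vector_field \<Rightarrow>
     ('a \<Rightarrow> real) \<Rightarrow> 'a \<Rightarrow> 'a" where
  "shift_map A F \<alpha> = (\<lambda>x. local_flow A F x (\<alpha> x))"

definition Sh ::
    "('a::topological_space, 'e::euclidean_space) chart set \<Rightarrow> ('a, 'e) vector_field \<Rightarrow>
     ('a \<Rightarrow> 'a) set" where
  "Sh A F = shift_map A F ` func A F"

end

(* Along the trajectory o of a point x one has f (o s) = o (s + \<alpha> (o s)). Differentiating at s = 0
   gives Tf F = (1 + F \<alpha>) F at f x, so this part needs existence and uniqueness of trajectories only.
   For the second part, f conjugates the flow of F to the flow of f_* F. Hence, with g the inverse
   of f, a shift by \<beta> along f_* F is the shift along F by \<beta> + \<alpha> (F (g, \<beta>)) - \<alpha> g, and a shift h by \<beta>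
   along F is the shift along f_* F by \<alpha> g + \<beta> - \<alpha> (g h). These functions are smooth because shift
   maps are smooth, that is, because the flow depends smoothly on time and initial value. *)

theory Submission
  imports Defs
begin


section \<open>Maps of class \<open>C\<^sup>k\<close> in a parameter\<close>

text \<open>Smooth dependence on time and initial value rests on rescaling: the flow at (u, t) is
  the value at time 1 of the solution of y' = t G(y), y(0) = u. Thus t joins u as a parameter, and
  for small t every equation lives on the fixed interval [-1, 1] with Lipschitz constant 1/2. The
  class C^k is reached by induction, differentiating the equation in its parameters. The linearized
  equation depends on time even where the original does not, which is why maps carry a passive time.
  The boundary is the main obstacle. A chart shows the field only on a relatively open piece of a
  half-space in a subspace, so a smooth extension to the ambient space is integrated, and a
  nearest-point argument shows that solutions starting in the half-space stay there. Derivatives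
  within such a piece are not unique in all directions; they are therefore evaluated only on
  velocities of curves, where the value is forced. Large times are reached by a connectedness
  argument along one trajectory, and the trajectories of the induced field are obtained from those
  of F by conjugation.\<close>

definition unit_time :: "real set" where "unit_time = {-1..1}"

lemma unit_time_simps [simp]:
  "0 \<in> unit_time" "1 \<in> unit_time" "compact unit_time" "convex unit_time" "unit_time \<noteq> {}"
  by (auto simp: unit_time_def)

lemma abs_unit_time: "s \<in> unit_time \<longleftrightarrow> \<bar>s\<bar> \<le> 1"
  by (auto simp: unit_time_def)

text \<open>Derivatives are taken in \<open>p\<close> only; the time \<open>s\<close> is passive, but all derivatives are jointly
  continuous in \<open>(p, s)\<close>.\<close>

primrec C_k_param ::
    "nat \<Rightarrow> 'p::euclidean_space set \<Rightarrow> ('p \<Rightarrow> real \<Rightarrow> 'b::real_normed_vector) \<Rightarrow> bool" where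
  "C_k_param 0 U f \<longleftrightarrow> continuous_on (U \<times> unit_time) (\<lambda>(p, s). f p s)"
| "C_k_param (Suc k) U f \<longleftrightarrow>
     continuous_on (U \<times> unit_time) (\<lambda>(p, s). f p s) \<and>
     (\<forall>p\<in>U. \<forall>s\<in>unit_time. (\<lambda>p. f p s) differentiable (at p)) \<and>
     (\<forall>v. C_k_param k U (\<lambda>p s. frechet_derivative (\<lambda>p. f p s) (at p) v))"

lemma C_k_param_continuous_on:
  "C_k_param k U f \<Longrightarrow> continuous_on (U \<times> unit_time) (\<lambda>(p, s). f p s)"
  by (cases k) auto

lemma C_k_param_derivative:
  assumes "C_k_param (Suc k) U f" "p \<in> U" "s \<in> unit_time"
  shows "((\<lambda>p. f p s) has_derivative frechet_derivative (\<lambda>p. f p s) (at p)) (at p)"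
  using assms by (auto simp: frechet_derivative_works)

lemma C_k_param_cong:
  assumes "open U" "\<And>p s. p \<in> U \<Longrightarrow> s \<in> unit_time \<Longrightarrow> f p s = g p s" "C_k_param k U f"
  shows "C_k_param k U g"
  using assms(2,3)
proof (induction k arbitrary: f g)
  case 0
  show ?case unfolding C_k_param.simps
    by (rule continuous_on_eq[OF C_k_param_continuous_on[OF 0(2)]]) (use 0(1) in auto)
next
  case (Suc k)
  have c: "continuous_on (U \<times> unit_time) (\<lambda>(p, s). g p s)"
    by (rule continuous_on_eq[OF C_k_param_continuous_on[OF Suc.prems(2)]])
      (use Suc.prems(1) in auto)
  have d: "((\<lambda>p. g p s) has_derivative frechet_derivative (\<lambda>p. f p s) (at p)) (at p)"
    if "p \<in> U" "s \<in> unit_time" for p s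
    using C_k_param_derivative[OF Suc.prems(2) that]
    by (rule has_derivative_transform_within_open[OF _ assms(1) that(1)])
      (use Suc.prems(1) that(2) in blast)
  have "C_k_param k U (\<lambda>p s. frechet_derivative (\<lambda>p. g p s) (at p) v)" for v
    by (rule Suc.IH[of "\<lambda>p s. frechet_derivative (\<lambda>p. f p s) (at p) v"])
      (use Suc.prems(2) frechet_derivative_at[OF d] in auto)
  moreover have "(\<lambda>p. g p s) differentiable (at p)" if "p \<in> U" "s \<in> unit_time" for p s
    using d[OF that] by (rule differentiableI)
  ultimately show ?case using c unfolding C_k_param.simps(2) by blast
qed

text \<open>Lets a closure rule name the derivative by an explicit formula \<open>f'\<close>; on an
  open set it agrees with the chosen \<open>frechet_derivative\<close> by uniqueness.\<close>

lemma C_k_param_SucI: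
  assumes "open U" "continuous_on (U \<times> unit_time) (\<lambda>(p, s). f p s)"
    and "\<And>p s. p \<in> U \<Longrightarrow> s \<in> unit_time \<Longrightarrow> ((\<lambda>p. f p s) has_derivative f' p s) (at p)"
    and "\<And>v. C_k_param k U (\<lambda>p s. f' p s v)"
  shows "C_k_param (Suc k) U f"
proof -
  have "C_k_param k U (\<lambda>p s. frechet_derivative (\<lambda>p. f p s) (at p) v)" for v
    by (rule C_k_param_cong[OF assms(1) _ assms(4)[of v]])
      (use frechet_derivative_at[OF assms(3)] in auto)
  moreover have "(\<lambda>p. f p s) differentiable (at p)" if "p \<in> U" "s \<in> unit_time" for p s
    using assms(3)[OF that] by (rule differentiableI)
  ultimately show ?thesis using assms(2) unfolding C_k_param.simps(2) by blast
qed

lemma C_k_param_pred: "C_k_param (Suc k) U f \<Longrightarrow> C_k_param k U f"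
proof (induction k arbitrary: f)
  case (Suc k)
  show ?case unfolding C_k_param.simps(2)[of k]
    using Suc.prems Suc.IH unfolding C_k_param.simps(2)[of "Suc k"] by blast
qed simp

lemma C_k_param_subset: "C_k_param k U f \<Longrightarrow> S \<subseteq> U \<Longrightarrow> C_k_param k S f"
proof (induction k arbitrary: f)
  case 0
  then show ?case by (auto intro: continuous_on_subset)
next
  case (Suc k)
  have "continuous_on (S \<times> unit_time) (\<lambda>(p, s). f p s)"
    by (rule continuous_on_subset[of "U \<times> unit_time"]) (use Suc.prems in auto)
  then show ?case using Suc by auto
qed

lemma C_k_param_const:
  assumes "open U" shows "C_k_param k U (\<lambda>p s. c)"
proof (induction k arbitrary: c)
  case (Suc k)
  show ?case
    by (rule C_k_param_SucI[OF assms, where f'="\<lambda>p s v. 0"])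
      (auto intro!: Suc derivative_eq_intros simp: case_prod_unfold)
qed (simp add: case_prod_unfold)

lemma C_k_param_bounded_linear:
  assumes "bounded_linear h" "open U" "C_k_param k U f"
  shows "C_k_param k U (\<lambda>p s. h (f p s))"
  using assms(3)
proof (induction k arbitrary: f)
  case 0
  then show ?case
    by (auto simp: case_prod_unfold intro!: bounded_linear.continuous_on[OF assms(1)])
next
  case (Suc k)
  show ?case
  proof (rule C_k_param_SucI[OF assms(2), where f'="\<lambda>p s v. h (frechet_derivative (\<lambda>p. f p s) (at p) v)"])
    show "continuous_on (U \<times> unit_time) (\<lambda>(p, s). h (f p s))"
      using C_k_param_continuous_on[OF Suc.prems]
      by (auto simp: case_prod_unfold intro!: bounded_linear.continuous_on[OF assms(1)])
    show "((\<lambda>p. h (f p s)) has_derivative (\<lambda>v. h (frechet_derivative (\<lambda>p. f p s) (at p) v))) (at p)"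
      if "p \<in> U" "s \<in> unit_time" for p s
      by (rule bounded_linear.has_derivative[OF assms(1) C_k_param_derivative[OF Suc.prems that]])
    show "C_k_param k U (\<lambda>p s. h (frechet_derivative (\<lambda>p. f p s) (at p) v))" for v
      using Suc by simp
  qed
qed

lemma C_k_param_add:
  assumes "open U" "C_k_param k U f" "C_k_param k U g"
  shows "C_k_param k U (\<lambda>p s. f p s + g p s)"
  using assms(2,3)
proof (induction k arbitrary: f g)
  case 0
  then show ?case by (auto simp: case_prod_unfold intro!: continuous_intros)
next
  case (Suc k)
  show ?case
  proof (rule C_k_param_SucI[OF assms(1), where f'="\<lambda>p s v. frechet_derivative (\<lambda>p. f p s) (at p) v
        + frechet_derivative (\<lambda>p. g p s) (at p) v"])
    show "continuous_on (U \<times> unit_time) (\<lambda>(p, s). f p s + g p s)"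
      using Suc.prems[THEN C_k_param_continuous_on]
      by (auto simp: case_prod_unfold intro!: continuous_intros)
  qed (use Suc in \<open>auto intro!: has_derivative_add simp: frechet_derivative_works\<close>)
qed

lemma C_k_param_sum:
  assumes "open U" "\<And>i. i \<in> I \<Longrightarrow> C_k_param k U (f i)"
  shows "C_k_param k U (\<lambda>p s. \<Sum>i\<in>I. f i p s)"
  using assms(2)
proof (induction I rule: infinite_finite_induct)
  case (insert i I)
  then show ?case using C_k_param_add[OF assms(1), of k "f i"] by simp
qed (simp_all add: C_k_param_const assms(1))

text \<open>The product rule multiplies each derivative by an undifferentiated factor, so the
  induction also has to treat the factors themselves as maps of the lower class, by
  \<open>C_k_param_pred\<close>.\<close>

lemma C_k_param_scaleR:
  fixes f :: "'p::euclidean_space \<Rightarrow> real \<Rightarrow> real"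
  assumes "open U" "C_k_param k U f" "C_k_param k U g"
  shows "C_k_param k U (\<lambda>p s. f p s *\<^sub>R g p s)"
  using assms(2,3)
proof (induction k arbitrary: f g)
  case 0
  then show ?case by (auto simp: case_prod_unfold intro!: continuous_intros)
next
  case (Suc k)
  show ?case
  proof (rule C_k_param_SucI[OF assms(1), where f'="\<lambda>p s v. f p s *\<^sub>R frechet_derivative (\<lambda>p. g p s) (at p) v
        + frechet_derivative (\<lambda>p. f p s) (at p) v *\<^sub>R g p s"])
    show "continuous_on (U \<times> unit_time) (\<lambda>(p, s). f p s *\<^sub>R g p s)"
      using Suc.prems[THEN C_k_param_continuous_on]
      by (auto simp: case_prod_unfold intro!: continuous_intros)
    show "C_k_param k U (\<lambda>p s. f p s *\<^sub>R frechet_derivative (\<lambda>p. g p s) (at p) v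
        + frechet_derivative (\<lambda>p. f p s) (at p) v *\<^sub>R g p s)" for v
      by (intro C_k_param_add assms(1) Suc.IH Suc.prems[THEN C_k_param_pred])
        (use Suc.prems in auto)
  qed (use Suc.prems in \<open>auto intro!: has_derivative_scaleR simp: frechet_derivative_works\<close>)
qed

lemma C_k_param_linear:
  assumes "open U" "bounded_linear l"
  shows "C_k_param k U (\<lambda>p s. l p)"
proof (cases k)
  case 0
  have "continuous_on (U \<times> unit_time) (\<lambda>p. l (fst p))"
    by (intro bounded_linear.continuous_on[OF assms(2)] continuous_intros)
  then show ?thesis by (simp add: 0 case_prod_unfold)
next
  case (Suc j)
  have "continuous_on (U \<times> unit_time) (\<lambda>p. l (fst p))"
    by (intro bounded_linear.continuous_on[OF assms(2)] continuous_intros)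
  then show ?thesis unfolding Suc
    by (intro C_k_param_SucI[OF assms(1), where f'="\<lambda>p s. l"] C_k_param_const)
      (auto simp: case_prod_unfold bounded_linear_imp_has_derivative assms)
qed

lemma C_k_param_Pair:
  assumes "open U" "C_k_param k U f" "C_k_param k U g"
  shows "C_k_param k U (\<lambda>p s. (f p s, g p s))"
proof -
  have "C_k_param k U (\<lambda>p s. (f p s, 0) + (0, g p s))"
    by (intro C_k_param_add C_k_param_bounded_linear[where h="\<lambda>x. (x, 0)"]
        C_k_param_bounded_linear[where h="\<lambda>x. (0, x)"] assms bounded_linear_intros)
  then show ?thesis by simp
qed

text \<open>\<open>C_k_param\<close> speaks of derivatives in a fixed direction only. When the
  direction varies with the point, as in the chain rule or a linearized equation, this expansion
  writes the derivative through the finitely many fixed directions of the basis.\<close>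

lemma has_derivative_Basis_sum:
  assumes "(f has_derivative f') (at (x::'a::euclidean_space))"
  shows "f' v = (\<Sum>b\<in>Basis. (v \<bullet> b) *\<^sub>R f' b)"
proof -
  interpret linear f' using assms by (rule has_derivative_linear)
  have "f' v = f' (\<Sum>b\<in>Basis. (v \<bullet> b) *\<^sub>R b)" by (simp add: euclidean_representation)
  then show ?thesis by (simp add: sum scaleR)
qed

text \<open>In the chain rule the derivative of \<open>K\<close> is taken in the moving direction
  \<open>?g' p s v\<close>. Expanding that direction in the basis turns the derivative into a sum of
  products to which the induction hypothesis for \<open>K\<close> applies. The same passive time
  \<open>s\<close> is fed to both maps.\<close>

lemma C_k_param_compose:
  fixes g :: "'p::euclidean_space \<Rightarrow> real \<Rightarrow> 'q::euclidean_space"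
    and K :: "'q \<Rightarrow> real \<Rightarrow> 'b::real_normed_vector"
  assumes "open U" "C_k_param k Q K" "C_k_param k U g"
    and "\<And>p s. p \<in> U \<Longrightarrow> s \<in> unit_time \<Longrightarrow> g p s \<in> Q"
  shows "C_k_param k U (\<lambda>p s. K (g p s) s)"
proof -
  have cont: "continuous_on (U \<times> unit_time) (\<lambda>(p, s). K (g p s) s)"
    if "C_k_param k Q K" for k and K :: "'q \<Rightarrow> real \<Rightarrow> 'b"
  proof -
    have "continuous_on (U \<times> unit_time) (\<lambda>x. (g (fst x) (snd x), snd x))"
      using C_k_param_continuous_on[OF assms(3)]
      by (auto simp: case_prod_unfold intro!: continuous_intros)
    moreover have "(\<lambda>x. (g (fst x) (snd x), snd x)) ` (U \<times> unit_time) \<subseteq> Q \<times> unit_time"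
      using assms(4) by auto
    ultimately show ?thesis
      using continuous_on_compose2[OF C_k_param_continuous_on[OF that]]
      by (fastforce simp: case_prod_unfold)
  qed
  show ?thesis using assms(2,3)
  proof (induction k arbitrary: K)
    case 0
    then show ?case using cont[OF 0(1)] by simp
  next
    case (Suc k)
    let ?K' = "\<lambda>q s. frechet_derivative (\<lambda>q. K q s) (at q)"
    let ?g' = "\<lambda>p s. frechet_derivative (\<lambda>p. g p s) (at p)"
    show ?case
    proof (rule C_k_param_SucI[OF assms(1) cont[OF Suc.prems(1)],
          where f'="\<lambda>p s v. \<Sum>b\<in>Basis. (?g' p s v \<bullet> b) *\<^sub>R ?K' (g p s) s b"])
      fix p s assume ps: "p \<in> U" "s \<in> unit_time"
      have K: "((\<lambda>q. K q s) has_derivative ?K' (g p s) s) (at (g p s))"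
        using C_k_param_derivative[OF Suc.prems(1)] assms(4) ps by blast
      have "((\<lambda>p. K (g p s) s) has_derivative (\<lambda>v. ?K' (g p s) s (?g' p s v))) (at p)"
        using has_derivative_compose[OF C_k_param_derivative[OF Suc.prems(2) ps] K] .
      then show "((\<lambda>p. K (g p s) s) has_derivative
            (\<lambda>v. \<Sum>b\<in>Basis. (?g' p s v \<bullet> b) *\<^sub>R ?K' (g p s) s b)) (at p)"
        by (simp add: has_derivative_Basis_sum[OF K, symmetric])
    next
      fix v
      show "C_k_param k U (\<lambda>p s. \<Sum>b\<in>Basis. (?g' p s v \<bullet> b) *\<^sub>R ?K' (g p s) s b)"
      proof (intro C_k_param_sum C_k_param_scaleR assms(1))
        fix b
        show "C_k_param k U (\<lambda>p s. ?g' p s v \<bullet> b)"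
          by (rule C_k_param_bounded_linear[OF _ assms(1)]) (use Suc.prems in \<open>auto intro: bounded_linear_intros\<close>)
        show "C_k_param k U (\<lambda>p s. ?K' (g p s) s b)"
          by (rule Suc.IH) (use Suc.prems C_k_param_pred in auto)
      qed
    qed
  qed
qed

section \<open>Comparison with maps without time\<close>

lemma C_k_on_param:
  assumes "s \<in> unit_time" "C_k_param k U f"
  shows "C_k_on k U (\<lambda>p. f p s)"
  using assms(2)
proof (induction k arbitrary: f)
  case 0
  then have "continuous_on U (\<lambda>p. (\<lambda>(p, s). f p s) (p, s))"
    by (intro continuous_on_compose2[OF 0[unfolded C_k_param.simps]] continuous_intros)
      (use assms(1) in auto)
  then show ?case by simp
next
  case (Suc k)
  then show ?case using assms(1) unfolding C_k_param.simps(2) C_k_on.simps(2) by blast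
qed

lemma C_k_on_imp_continuous_on: "C_k_on k U f \<Longrightarrow> continuous_on U f"
  by (cases k) (auto intro!: continuous_at_imp_continuous_on differentiable_imp_continuous_within)

lemma C_k_param_passive:
  assumes "C_k_on k U f"
  shows "C_k_param k U (\<lambda>p s. f p)"
proof -
  have "continuous_on (U \<times> unit_time) (\<lambda>(p, s). f p)" if "C_k_on k U f"
    for f :: "'a \<Rightarrow> 'b" and k
    unfolding case_prod_unfold
    by (rule continuous_on_compose2[OF C_k_on_imp_continuous_on[OF that]]) (auto intro: continuous_intros)
  note cont = this
  show ?thesis using assms
  proof (induction k arbitrary: f)
    case 0
    then show ?case using cont[of 0 f] by simp
  next
    case (Suc k)
    then show ?case using cont[OF Suc.prems] by simp
  qed
qed

text \<open>With an idle time the two classes coincide, so the closure rules proved for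
  \<open>C_k_param\<close> serve \<open>C_k_on\<close> as well.\<close>

lemma C_k_on_iff_param: "C_k_on k U f \<longleftrightarrow> C_k_param k U (\<lambda>p s. f p)"
  using C_k_param_passive[of k U f] C_k_on_param[of 0 k U "\<lambda>p s. f p"] by auto


section \<open>Ordinary differential equations\<close>

lemma vector_derivative_bound:
  fixes f :: "real \<Rightarrow> 'b::real_normed_vector"
  assumes "convex S" "\<And>x. x \<in> S \<Longrightarrow> (f has_vector_derivative f' x) (at x within S)"
    and "\<And>x. x \<in> S \<Longrightarrow> norm (f' x) \<le> B" "x \<in> S" "y \<in> S"
  shows "norm (f x - f y) \<le> B * \<bar>x - y\<bar>"
proof -
  have "norm (f x - f y) \<le> B * norm (x - y)"
  proof (rule differentiable_bound[OF assms(1) _ _ assms(4,5)])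
    fix x assume "x \<in> S"
    then show "(f has_derivative (\<lambda>h. h *\<^sub>R f' x)) (at x within S)"
      using assms(2) by (simp add: has_vector_derivative_def)
    show "onorm (\<lambda>h. h *\<^sub>R f' x) \<le> B"
      using assms(3)[OF \<open>x \<in> S\<close>]
      by (intro onorm_le) (simp add: mult.commute[of B] mult_left_mono)
  qed
  then show ?thesis by simp
qed

text \<open>On an interval of length two and with a Lipschitz constant below \<open>1\<close>, the mean value
  inequality at a maximum of the norm replaces Gronwall's inequality.\<close>

lemma ode_estimate:
  fixes y :: "real \<Rightarrow> 'e::real_normed_vector"
  assumes d: "\<And>s. s \<in> unit_time \<Longrightarrow> (y has_vector_derivative y' s) (at s within unit_time)"
    and b: "\<And>s. s \<in> unit_time \<Longrightarrow> norm (y' s) \<le> K * norm (y s) + c"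
    and K: "0 \<le> K" "K < 1" and s: "s \<in> unit_time"
  shows "norm (y s) \<le> (norm (y 0) + c) / (1 - K)"
proof -
  have "continuous_on unit_time y"
    using d by (rule continuous_on_vector_derivative)
  then have "continuous_on unit_time (\<lambda>s. norm (y s))" by (intro continuous_intros)
  then obtain m where m: "m \<in> unit_time" "\<And>s. s \<in> unit_time \<Longrightarrow> norm (y s) \<le> norm (y m)"
    using continuous_attains_sup[of unit_time "\<lambda>s. norm (y s)"] by auto
  let ?B = "K * norm (y m) + c"
  have B: "norm (y' s) \<le> ?B" if "s \<in> unit_time" for s
    using b[OF that] mult_left_mono[OF m(2)[OF that] K(1)] by linarith
  have "norm (y m - y 0) \<le> ?B * \<bar>m - 0\<bar>"
    by (rule vector_derivative_bound[OF _ d B]) (use m in auto)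
  also have "\<dots> \<le> ?B * 1"
  proof (rule mult_left_mono)
    show "0 \<le> ?B" using B[OF m(1)] norm_ge_zero order_trans by blast
  qed (use m(1) in \<open>simp add: abs_unit_time\<close>)
  finally have "norm (y m - y 0) \<le> ?B" by simp
  then have "norm (y m) \<le> norm (y 0) + ?B"
    by (intro order_trans[OF norm_triangle_sub[of "y m" "y 0"]] add_left_mono)
  then have "norm (y m) * (1 - K) \<le> norm (y 0) + c" by (simp add: algebra_simps)
  then show ?thesis using m(2)[OF s] K by (simp add: pos_le_divide_eq mult_right_mono order_trans)
qed

text \<open>The difference of the curves satisfies \<open>ode_estimate\<close> with K = 1/2 and c =
  0. The Lipschitz bound is asked only along the two curves, so it may come from a field defined
  merely on a piece of space that contains both.\<close>

lemma ode_unique: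
  fixes y z :: "real \<Rightarrow> 'e::real_normed_vector"
  assumes "\<And>s. s \<in> unit_time \<Longrightarrow> (y has_vector_derivative y' s) (at s within unit_time)"
    and "\<And>s. s \<in> unit_time \<Longrightarrow> (z has_vector_derivative z' s) (at s within unit_time)"
    and "\<And>s. s \<in> unit_time \<Longrightarrow> norm (y' s - z' s) \<le> 1/2 * norm (y s - z s)"
    and "y 0 = z 0" "s \<in> unit_time"
  shows "y s = z s"
proof -
  have "norm (y s - z s) \<le> (norm (y 0 - z 0) + 0) / (1 - 1/2)"
    by (rule ode_estimate[where y'="\<lambda>s. y' s - z' s"])
      (use assms in \<open>auto intro!: derivative_intros\<close>)
  then show ?thesis using assms(4) by simp
qed

text \<open>Picard iteration: every time in \<open>unit_time\<close> has distance at most 1 from 0,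
  so the integral operator contracts by the factor 1/2. The Lipschitz bound is global in y, hence
  the solution exists on the whole interval.\<close>

lemma ode_exists:
  fixes h :: "real \<Rightarrow> 'e::euclidean_space \<Rightarrow> 'e"
  assumes cont: "continuous_on (unit_time \<times> UNIV) (\<lambda>(s, y). h s y)"
    and lip: "\<And>s y z. s \<in> unit_time \<Longrightarrow> norm (h s y - h s z) \<le> 1/2 * norm (y - z)"
  obtains y where "y 0 = u"
    and "\<And>s. s \<in> unit_time \<Longrightarrow> (y has_vector_derivative h s (y s)) (at s within unit_time)"
proof -
  \<comment> \<open>Retracts the line onto \<open>unit_time\<close>. The operator can then act on
    bounded continuous functions on all of the reals, a complete space to which Banach's fixed point
    theorem applies.\<close>
  define clip :: "real \<Rightarrow> real" where "clip t = max (-1) (min 1 t)" for t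
  have clip: "clip t \<in> unit_time" "t \<in> unit_time \<Longrightarrow> clip t = t" for t
    by (auto simp: clip_def unit_time_def)
  have clip_cont: "continuous_on UNIV clip"
    unfolding clip_def by (intro continuous_intros)
  \<comment> \<open>The integral starts at -1, the left end, because an integral over {0..t} is zero
    for negative t; subtracting \<open>P y 0\<close> in \<open>T\<close> moves the initial time back
    to 0.\<close>
  define P where "P y t = integral {-1..t} (\<lambda>s. h s (y s))" for y t
  define T where "T y t = u + P y (clip t) - P y 0" for y t
  have P: "(P y has_vector_derivative h t (y t)) (at t within unit_time)"
    if "t \<in> unit_time" "continuous_on unit_time y" for y t
  proof -
    have "continuous_on unit_time (\<lambda>s. (\<lambda>(s, y). h s y) (s, y s))"
      by (rule continuous_on_compose2[OF cont]) (auto intro: continuous_intros that)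
    then show ?thesis using that(1) unfolding P_def unit_time_def
      by (intro integral_has_vector_derivative) auto
  qed
  have Pc: "continuous_on unit_time (P y)" if "continuous_on unit_time y" for y
    using P[OF _ that] by (rule continuous_on_vector_derivative)
  have T_bcont: "T y \<in> bcontfun" if y: "continuous_on unit_time y" for y
  proof -
    have "continuous_on UNIV (\<lambda>t. P y (clip t))"
      by (rule continuous_on_compose2[OF Pc[OF y] clip_cont]) (use clip in auto)
    moreover have "bounded (P y ` unit_time)"
      by (intro compact_imp_bounded compact_continuous_image Pc y) simp
    then obtain B where B: "\<And>t. t \<in> unit_time \<Longrightarrow> norm (P y t) \<le> B"
      unfolding bounded_iff by auto
    have "norm (T y t) \<le> norm u + B + B" for t
      unfolding T_def using B[OF clip(1)[of t]] B[of 0]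
        norm_triangle_ineq4[of "u + P y (clip t)" "P y 0"] norm_triangle_ineq[of u "P y (clip t)"]
      by simp
    then have "bounded (range (T y))" unfolding bounded_iff by auto
    ultimately show ?thesis
      unfolding bcontfun_def T_def by (auto intro!: continuous_intros)
  qed
  define T' where "T' y = Bcontfun (T (apply_bcontfun y))" for y :: "real \<Rightarrow>\<^sub>C 'e"
  have T': "apply_bcontfun (T' y) t = T (apply_bcontfun y) t" for y t
    unfolding T'_def by (simp add: Bcontfun_inverse T_bcont)
  have "dist (T' y) (T' z) \<le> 1/2 * dist y z" for y z
  proof (rule dist_bound)
    fix t
    let ?D = "\<lambda>t. P y t - P z t"
    have nb: "norm (h s (y s) - h s (z s)) \<le> 1/2 * dist y z" if "s \<in> unit_time" for s
      using lip[OF that, of "y s" "z s"] dist_bounded[of y s z] by (simp add: dist_norm)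
    have "norm (?D (clip t) - ?D 0) \<le> 1/2 * dist y z * \<bar>clip t - 0\<bar>"
      by (rule vector_derivative_bound[where f'="\<lambda>s. h s (y s) - h s (z s)" and S=unit_time])
        (use clip nb in \<open>auto intro!: derivative_intros P\<close>)
    also have "\<dots> \<le> 1/2 * dist y z * 1"
      by (rule mult_left_mono) (use clip(1)[of t] in \<open>auto simp: abs_unit_time\<close>)
    finally show "dist (T' y t) (T' z t) \<le> 1/2 * dist y z"
      by (simp add: T' T_def dist_norm algebra_simps)
  qed
  then obtain y where y: "T' y = y"
    using banach_fix_type[of "1/2" T'] by auto
  have y0: "y t = T y t" for t using T'[of y t] y by simp
  show ?thesis
  proof
    show "apply_bcontfun y 0 = u" using y0[of 0] clip(2)[of 0] by (simp add: T_def)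
    fix s :: real assume s: "s \<in> unit_time"
    have "((\<lambda>t. u + P y t - P y 0) has_vector_derivative h s (y s)) (at s within unit_time)"
      by (auto intro!: derivative_eq_intros P s)
    then show "(apply_bcontfun y has_vector_derivative h s (y s)) (at s within unit_time)"
      by (rule has_vector_derivative_transform[OF s, rotated]) (simp add: y0[of s] y0 T_def clip)
  qed
qed

text \<open>Compactness of \<open>unit_time\<close> makes the continuity of each basis derivative at
  q = 0 uniform in s. The tolerance e is split into e / N over the N basis directions, so that the
  derivative varies by at most e in operator norm, and the mean value inequality bounds the
  remainder.\<close>

lemma uniform_linearization:
  fixes K :: "'q::euclidean_space \<Rightarrow> real \<Rightarrow> 'e::real_normed_vector"
  assumes r: "0 < r"
    and der: "\<And>q s. q \<in> ball 0 r \<Longrightarrow> s \<in> unit_time \<Longrightarrow> ((\<lambda>q. K q s) has_derivative K' q s) (at q)"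
    and cont: "\<And>v. continuous_on (ball 0 r \<times> unit_time) (\<lambda>(q, s). K' q s v)"
    and e: "0 < e"
  obtains d where "0 < d"
    and "\<And>q s. norm q < d \<Longrightarrow> s \<in> unit_time \<Longrightarrow> norm (K q s - K 0 s - K' 0 s q) \<le> e * norm q"
proof -
  define N where "N = real DIM('q)"
  have N: "0 < N" by (simp add: N_def)
  have "\<exists>X. open X \<and> 0 \<in> X \<and> (\<forall>q\<in>X \<inter> ball 0 r. \<forall>s\<in>unit_time. norm (K' q s b - K' 0 s b) \<le> e / N)" for b
    by (rule continuous_on_prod_compactE[OF cont[of b], of 0 "e / N"])
      (use r e N in \<open>auto simp: dist_norm\<close>)
  then obtain X where X: "\<And>b. open (X b)" "\<And>b. 0 \<in> X b"
    "\<And>b q s. q \<in> X b \<inter> ball 0 r \<Longrightarrow> s \<in> unit_time \<Longrightarrow> norm (K' q s b - K' 0 s b) \<le> e / N"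
    by metis
  have "open ((\<Inter>b\<in>Basis. X b) \<inter> ball 0 r)"
    using X(1) by (intro open_Int open_INT) auto
  moreover have "0 \<in> (\<Inter>b\<in>Basis. X b) \<inter> ball 0 r" using X(2) r by auto
  ultimately obtain d where d: "0 < d" "ball 0 d \<subseteq> (\<Inter>b\<in>Basis. X b) \<inter> ball 0 r"
    by (rule openE)
  show ?thesis
  proof (rule that[OF d(1)])
    fix q :: 'q and s :: real assume q: "norm q < d" and s: "s \<in> unit_time"
    have bound: "norm ((K' x s - K' 0 s) v) \<le> e * norm v" if x: "x \<in> ball 0 d" for x v
    proof -
      have x0: "x \<in> ball 0 r" "0 \<in> ball 0 r" using d x r by auto
      have "(K' x s - K' 0 s) v = (\<Sum>b\<in>Basis. (v \<bullet> b) *\<^sub>R (K' x s b - K' 0 s b))"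
        using has_derivative_Basis_sum[OF der[OF x0(1) s], of v]
          has_derivative_Basis_sum[OF der[OF x0(2) s], of v]
        by (simp add: scaleR_diff_right sum_subtractf)
      also have "norm \<dots> \<le> (\<Sum>b\<in>(Basis::'q set). norm v * (e / N))"
      proof (rule sum_norm_le)
        fix b :: 'q assume b: "b \<in> Basis"
        have "norm (K' x s b - K' 0 s b) \<le> e / N" using X(3)[OF _ s] d(2) x b by blast
        then show "norm ((v \<bullet> b) *\<^sub>R (K' x s b - K' 0 s b)) \<le> norm v * (e / N)"
          unfolding norm_scaleR real_norm_def using Basis_le_norm[OF b, of v] by (intro mult_mono) auto
      qed
      also have "\<dots> = e * norm v" using N by (simp add: N_def)
      finally show ?thesis .
    qed
    have "norm (K q s - K 0 s - K' 0 s (q - 0)) \<le> norm (q - 0) * e"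
    proof (rule differentiable_bound_linearization[where S="ball 0 d" and f'="\<lambda>x. K' x s"])
      show "0 + t *\<^sub>R (q - 0) \<in> ball 0 d" if "t \<in> {0..1}" for t
        using that q mult_left_le_one_le[of "norm q" t] by auto
      show "((\<lambda>q. K q s) has_derivative K' x s) (at x within ball 0 d)" if "x \<in> ball 0 d" for x
        using has_derivative_at_withinI[OF der[OF _ s]] d(2) that by blast
      show "onorm (K' x s - K' 0 s) \<le> e" if "x \<in> ball 0 d" for x
        by (rule onorm_le[OF bound[OF that]])
    qed (use d in auto)
    then show "norm (K q s - K 0 s - K' 0 s q) \<le> e * norm q" by (simp add: mult.commute)
  qed
qed

text \<open>The derivative at v is compared with the increment of f along a multiple t v so short
  that it stays in S and the linearization error is at most c times its length. This hands the
  Lipschitz constant of an equation on to its linearization.\<close>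

lemma has_derivative_norm_le_Lipschitz:
  fixes f :: "'a::real_normed_vector \<Rightarrow> 'b::real_normed_vector"
  assumes f: "(f has_derivative f') (at x)" and S: "open S" "x \<in> S"
    and lip: "\<And>y. y \<in> S \<Longrightarrow> norm (f y - f x) \<le> B * norm (y - x)"
  shows "norm (f' v) \<le> B * norm v"
proof (rule field_le_epsilon, cases "v = 0")
  case True
  fix e :: real assume "0 < e"
  then show "norm (f' v) \<le> B * norm v + e"
    using True linear_0[OF has_derivative_linear[OF f]] by simp
next
  case False
  fix e :: real assume e: "0 < e"
  define c where "c = e / norm v"
  have c: "0 < c" using e False by (simp add: c_def)
  obtain d1 where d1: "0 < d1" "\<And>y. norm (y - x) < d1 \<Longrightarrow> norm (f y - f x - f' (y - x)) \<le> c * norm (y - x)"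
    using f c unfolding has_derivative_at_alt by blast
  obtain d2 where d2: "0 < d2" "ball x d2 \<subseteq> S" using S open_contains_ball by blast
  define t where "t = min d1 d2 / (2 * norm v)"
  have t: "0 < t" "norm (t *\<^sub>R v) < d1" "norm (t *\<^sub>R v) < d2"
    using d1(1) d2(1) False by (auto simp: t_def min_def)
  have "norm (f' (t *\<^sub>R v)) \<le> norm (f (x + t *\<^sub>R v) - f x) + norm (f (x + t *\<^sub>R v) - f x - f' (t *\<^sub>R v))"
    using norm_triangle_ineq4[of "f (x + t *\<^sub>R v) - f x" "f (x + t *\<^sub>R v) - f x - f' (t *\<^sub>R v)"]
    by simp
  also have "\<dots> \<le> B * norm (t *\<^sub>R v) + c * norm (t *\<^sub>R v)"
  proof (rule add_mono)
    have "x + t *\<^sub>R v \<in> S" using d2(2) t(3) by (auto simp: dist_norm)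
    then show "norm (f (x + t *\<^sub>R v) - f x) \<le> B * norm (t *\<^sub>R v)" using lip[of "x + t *\<^sub>R v"] by simp
    show "norm (f (x + t *\<^sub>R v) - f x - f' (t *\<^sub>R v)) \<le> c * norm (t *\<^sub>R v)"
      using d1(2)[of "x + t *\<^sub>R v"] t(2) by simp
  qed
  finally have "t * norm (f' v) \<le> t * (B * norm v + c * norm v)"
    using t(1) by (simp add: linear_cmul[OF has_derivative_linear[OF f]] algebra_simps)
  then show "norm (f' v) \<le> B * norm v + e"
    using t(1) False by (simp add: c_def)
qed


text \<open>A family of initial value problems whose initial value depends affinely on the
  parameter, with linear part \<open>l\<close>. This form is stable under differentiation: the flow
  has p = (u, t) and \<open>l = fst\<close>, and the derivative of a family in a fixed direction is
  a family with constant initial value, so with \<open>l\<close> = 0.\<close>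

locale param_ode =
  fixes U :: "'p::euclidean_space set" and W :: "'e::euclidean_space set"
    and H :: "'p \<times> 'e \<Rightarrow> real \<Rightarrow> 'e" and l :: "'p \<Rightarrow> 'e" and Y :: "'p \<Rightarrow> real \<Rightarrow> 'e"
  assumes U: "open U" and W: "open W"
    and lip: "\<And>p s y z. p \<in> U \<Longrightarrow> s \<in> unit_time \<Longrightarrow> y \<in> W \<Longrightarrow> z \<in> W \<Longrightarrow>
      norm (H (p, y) s - H (p, z) s) \<le> 1/2 * norm (y - z)"
    and l: "bounded_linear l"
    and Y_W: "\<And>p s. p \<in> U \<Longrightarrow> s \<in> unit_time \<Longrightarrow> Y p s \<in> W"
    and Y_0: "\<And>p q. p \<in> U \<Longrightarrow> q \<in> U \<Longrightarrow> Y q 0 - Y p 0 = l (q - p)"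
    and Y_ode: "\<And>p s. p \<in> U \<Longrightarrow> s \<in> unit_time \<Longrightarrow>
      (Y p has_vector_derivative H (p, Y p s) s) (at s within unit_time)"
begin

section \<open>Continuity of solutions in the parameter\<close>

lemma Y_cont: "p \<in> U \<Longrightarrow> continuous_on unit_time (Y p)"
  using Y_ode by (rule continuous_on_vector_derivative)

text \<open>Along the compact curve \<open>Y p0\<close> the fields for p and p0 differ by at most e
  / 8 as soon as p is close to p0, and so do the initial values. \<open>ode_estimate\<close> doubles
  the sum of the two to e / 2; the other half pays for moving \<open>Y p0\<close> from s to
  s0.\<close>

lemma continuous_on_solution:
  assumes "continuous_on ((U \<times> W) \<times> unit_time) (\<lambda>(q, s). H q s)"
  shows "continuous_on (U \<times> unit_time) (\<lambda>(p, s). Y p s)"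
  unfolding continuous_on_def
proof safe
  fix p0 and s0 :: real assume p0: "p0 \<in> U" and s0: "s0 \<in> unit_time"
  let ?F = "at (p0, s0) within U \<times> unit_time"
  show "((\<lambda>(p, s). Y p s) \<longlongrightarrow> Y p0 s0) ?F"
    unfolding case_prod_unfold
  proof (rule tendstoI)
    fix e :: real assume e: "0 < e"
    have cH: "continuous_on (U \<times> unit_time) (\<lambda>x. (\<lambda>(q, s). H q s) ((fst x, Y p0 (snd x)), snd x))"
      by (rule continuous_on_compose2[OF assms])
        (auto intro!: continuous_intros continuous_on_compose2[OF Y_cont[OF p0]] Y_W p0)
    obtain X where X: "p0 \<in> X" "open X"
      "\<forall>p\<in>X \<inter> U. \<forall>s\<in>unit_time. norm (H (p, Y p0 s) s - H (p0, Y p0 s) s) \<le> e / 8"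
      by (rule continuous_on_prod_compactE[OF cH _ p0, of "e / 8"])
        (use e in \<open>simp_all add: dist_norm\<close>)
    have lim: "(fst \<longlongrightarrow> p0) ?F" "(snd \<longlongrightarrow> s0) ?F"
      by (auto intro!: tendsto_eq_intros)
    have "((\<lambda>x. l (fst x - p0)) \<longlongrightarrow> l (p0 - p0)) ?F"
      by (intro bounded_linear.tendsto[OF l] tendsto_intros lim)
    then have ev1: "\<forall>\<^sub>F x in ?F. norm (l (fst x - p0)) < e / 8"
      using tendstoD[of "\<lambda>x. l (fst x - p0)" 0 ?F "e/8"] e linear_0[OF bounded_linear.linear[OF l]]
      by (simp add: dist_norm)
    have "continuous_on (U \<times> unit_time) (\<lambda>x. Y p0 (snd x))"
      by (auto intro!: continuous_intros continuous_on_compose2[OF Y_cont[OF p0]])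
    then have "((\<lambda>x. Y p0 (snd x)) \<longlongrightarrow> Y p0 s0) ?F"
      using p0 s0 by (force simp: continuous_on_def)
    then have ev2: "\<forall>\<^sub>F x in ?F. dist (Y p0 (snd x)) (Y p0 s0) < e / 2"
      using e tendstoD half_gt_zero by blast
    have ev3: "\<forall>\<^sub>F x in ?F. fst x \<in> X" using topological_tendstoD[OF lim(1) X(2,1)] .
    have ev4: "\<forall>\<^sub>F x in ?F. x \<in> U \<times> unit_time" by (simp add: eventually_at_filter)
    show "\<forall>\<^sub>F x in ?F. dist (Y (fst x) (snd x)) (Y p0 s0) < e"
      using ev1 ev2 ev3 ev4
    proof eventually_elim
      case (elim x)
      obtain p s where x: "x = (p, s)" by force
      have p: "p \<in> U" "p \<in> X" and s: "s \<in> unit_time" using elim by (auto simp: x)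
      have "norm (Y p s - Y p0 s) \<le> (norm (Y p 0 - Y p0 0) + e / 8) / (1 - 1/2)"
      proof (rule ode_estimate[where y'="\<lambda>s. H (p, Y p s) s - H (p0, Y p0 s) s"])
        fix s assume s: "s \<in> unit_time"
        show "((\<lambda>s. Y p s - Y p0 s) has_vector_derivative H (p, Y p s) s - H (p0, Y p0 s) s)
            (at s within unit_time)"
          by (intro derivative_intros Y_ode p p0 s)
        show "norm (H (p, Y p s) s - H (p0, Y p0 s) s) \<le> 1/2 * norm (Y p s - Y p0 s) + e / 8"
          using lip[OF p(1) s Y_W[OF p(1) s] Y_W[OF p0 s]] bspec[OF bspec[OF X(3), of p] s] p
            norm_triangle_ineq[of "H (p, Y p s) s - H (p, Y p0 s) s" "H (p, Y p0 s) s - H (p0, Y p0 s) s"]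
          by simp
      qed (use s in auto)
      then have "norm (Y p s - Y p0 s) < e / 2"
        using elim(1) Y_0[OF p0 p(1)] by (simp add: x)
      then show ?case
        using elim(2) dist_triangle[of "Y p s" "Y p0 s0" "Y p0 s"] by (simp add: x dist_norm)
    qed
  qed
qed

end

locale param_ode_C1 = param_ode U W H l Y
  for U :: "'p::euclidean_space set" and W :: "'e::euclidean_space set" and H l Y +
  assumes H: "C_k_param 1 (U \<times> W) H"
begin

section \<open>Differentiability of solutions in the parameter\<close>

abbreviation H' where "H' q s \<equiv> frechet_derivative (\<lambda>q. H q s) (at q)"

lemma UW: "open (U \<times> W)" using U W by (rule open_Times)

lemma H_has_derivative:
  "q \<in> U \<times> W \<Longrightarrow> s \<in> unit_time \<Longrightarrow> ((\<lambda>q. H q s) has_derivative H' q s) (at q)"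
  using C_k_param_derivative[of 0 "U \<times> W" H] H by simp

lemma H'_linear: "q \<in> U \<times> W \<Longrightarrow> s \<in> unit_time \<Longrightarrow> linear (H' q s)"
  using H_has_derivative by (rule has_derivative_linear)

lemma H'_cont: "continuous_on ((U \<times> W) \<times> unit_time) (\<lambda>(q, s). H' q s v)"
  using H unfolding One_nat_def C_k_param.simps by blast

text \<open>The linearized equation inherits the constant 1/2 in its unknown, so the estimates,
  uniqueness and existence results on \<open>unit_time\<close> apply to it unchanged.\<close>

lemma H'_snd_bound:
  assumes "p \<in> U" "s \<in> unit_time" "y \<in> W"
  shows "norm (H' (p, y) s (0, w)) \<le> 1/2 * norm w"
proof (rule has_derivative_norm_le_Lipschitz[where f="\<lambda>y. H (p, y) s" and x=y])
  have d: "((\<lambda>y. (p, y)) has_derivative (\<lambda>w. (0, w))) (at y)"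
    by (auto intro!: derivative_eq_intros)
  show "((\<lambda>y. H (p, y) s) has_derivative (\<lambda>w. H' (p, y) s (0, w))) (at y)"
    using has_derivative_compose[OF d, of "\<lambda>q. H q s"] H_has_derivative assms by simp
qed (use W lip assms in auto)

text \<open>For h = q - p the error R = Y q - Y p - Z h starts at 0. Its derivative is the
  linearization remainder of \<open>H\<close> at the increment (h, Y q - Y p) plus \<open>H'\<close>
  applied to (0, R). The increment has norm at most (1 + C) |h| + |R|, so
  \<open>ode_estimate\<close> makes R small compared with |h|.\<close>

lemma has_derivative_solution:
  assumes p: "p \<in> U" and s: "s \<in> unit_time"
    and Z_0: "\<And>v. Z v 0 = l v"
    and Z_ode: "\<And>v s. s \<in> unit_time \<Longrightarrow>
      (Z v has_vector_derivative H' (p, Y p s) s (v, Z v s)) (at s within unit_time)"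
  shows "((\<lambda>p. Y p s) has_derivative (\<lambda>v. Z v s)) (at p)"
proof -
  have Yp: "(p, Y p s) \<in> U \<times> W" if "s \<in> unit_time" for s using Y_W p that by simp
  have Y_joint: "continuous_on (U \<times> unit_time) (\<lambda>(p, s). Y p s)"
    by (rule continuous_on_solution[OF C_k_param_continuous_on[OF H]])
  have Z_cont: "continuous_on unit_time (Z v)" for v
    using Z_ode by (rule continuous_on_vector_derivative)
  \<comment> \<open>Linear combinations of solutions solve the linearized equation with the combined
    data; uniqueness turns this into linearity in v.\<close>
  have linear_Z: "linear (\<lambda>v. Z v s)" if s: "s \<in> unit_time" for s
  proof (rule linearI)
    fix v w :: 'p and c :: real
    show "Z (v + w) s = Z v s + Z w s"
    proof (rule ode_unique[where y="Z (v + w)" and z="\<lambda>s. Z v s + Z w s"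
          and z'="\<lambda>s. H' (p, Y p s) s (v, Z v s) + H' (p, Y p s) s (w, Z w s)", OF Z_ode])
      show "norm (H' (p, Y p s) s (v + w, Z (v + w) s)
            - (H' (p, Y p s) s (v, Z v s) + H' (p, Y p s) s (w, Z w s)))
          \<le> 1/2 * norm (Z (v + w) s - (Z v s + Z w s))" if s: "s \<in> unit_time" for s
        using H'_snd_bound[OF p s Y_W[OF p s], of "Z (v + w) s - (Z v s + Z w s)"]
        by (simp flip: linear_add[OF H'_linear[OF Yp[OF s] s]] linear_diff[OF H'_linear[OF Yp[OF s] s]])
      show "Z (v + w) 0 = Z v 0 + Z w 0"
        by (simp add: Z_0 linear_add[OF bounded_linear.linear[OF l]])
    qed (auto intro!: derivative_intros Z_ode s)
    show "Z (c *\<^sub>R v) s = c *\<^sub>R Z v s"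
    proof (rule ode_unique[where y="Z (c *\<^sub>R v)" and z="\<lambda>s. c *\<^sub>R Z v s"
          and z'="\<lambda>s. c *\<^sub>R H' (p, Y p s) s (v, Z v s)", OF Z_ode])
      show "norm (H' (p, Y p s) s (c *\<^sub>R v, Z (c *\<^sub>R v) s) - c *\<^sub>R H' (p, Y p s) s (v, Z v s))
          \<le> 1/2 * norm (Z (c *\<^sub>R v) s - c *\<^sub>R Z v s)" if s: "s \<in> unit_time" for s
        using H'_snd_bound[OF p s Y_W[OF p s], of "Z (c *\<^sub>R v) s - c *\<^sub>R Z v s"]
        by (simp flip: linear_cmul[OF H'_linear[OF Yp[OF s] s]] linear_diff[OF H'_linear[OF Yp[OF s] s]])
      show "Z (c *\<^sub>R v) 0 = c *\<^sub>R Z v 0"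
        by (simp add: Z_0 linear_cmul[OF bounded_linear.linear[OF l]])
    qed (auto intro!: derivative_eq_intros Z_ode s)
  qed
  have "\<forall>b. \<exists>C. \<forall>s\<in>unit_time. norm (Z b s) \<le> C"
    using compact_imp_bounded[OF compact_continuous_image[OF Z_cont]]
    by (auto simp: bounded_iff)
  then obtain C' where "\<forall>b. \<forall>s\<in>unit_time. norm (Z b s) \<le> C' b"
    using choice[of "\<lambda>b C. \<forall>s\<in>unit_time. norm (Z b s) \<le> C"] by blast
  then have C': "norm (Z b s) \<le> C' b" if "s \<in> unit_time" for b s
    using that by blast
  define C where "C = (\<Sum>b\<in>(Basis::'p set). C' b)"
  have C: "norm (Z v s) \<le> C * norm v" if "s \<in> unit_time" for v s
  proof -
    interpret L: linear "\<lambda>v. Z v s" by (rule linear_Z[OF that])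
    have "Z v s = Z (\<Sum>b\<in>Basis. (v \<bullet> b) *\<^sub>R b) s" by (simp add: euclidean_representation)
    also have "\<dots> = (\<Sum>b\<in>Basis. (v \<bullet> b) *\<^sub>R Z b s)" by (simp add: L.sum L.scaleR)
    also have "norm \<dots> \<le> (\<Sum>b\<in>(Basis::'p set). norm v * C' b)"
      unfolding norm_scaleR real_norm_def
      using C'[OF that] Basis_le_norm[of _ v] by (intro sum_norm_le) (simp add: mult_mono)
    finally show ?thesis by (simp add: C_def sum_distrib_left mult.commute)
  qed
  have "0 \<le> C' b" for b using order_trans[OF norm_ge_zero C'[OF unit_time_simps(1)]] .
  then have C0: "0 \<le> C" unfolding C_def by (intro sum_nonneg)
  obtain r1 where r1: "0 < r1" "ball p r1 \<subseteq> U" using U p by (rule openE)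
  have "compact (Y p ` unit_time)" by (intro compact_continuous_image Y_cont p) simp
  then obtain r2 where r2: "0 < r2" "(\<Union>x\<in>Y p ` unit_time. ball x r2) \<subseteq> W"
    using compact_subset_open_imp_ball_epsilon_subset[OF _ W] Y_W p by (metis image_subsetI)
  define r where "r = min r1 r2"
  have r: "0 < r" using r1 r2 by (simp add: r_def)
  \<comment> \<open>Recentres \<open>H\<close> at the moving point (p, Y p s), so that the
    linearization takes place at q = 0 for all times at once.\<close>
  define S where "S q s = (p + fst q, Y p s + snd q)" for q and s :: real
  have S: "S q s \<in> U \<times> W" if "q \<in> ball 0 r" "s \<in> unit_time" for q s
  proof -
    have "norm (fst q) < r1" "norm (snd q) < r2"
      using that norm_fst_le[of "fst q" "snd q"] norm_snd_le[of "snd q" "fst q"] by (auto simp: r_def)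
    then have "p + fst q \<in> ball p r1" "Y p s + snd q \<in> ball (Y p s) r2" by (auto simp: dist_norm)
    then have "p + fst q \<in> U" "Y p s + snd q \<in> W" using r1(2) r2(2) that(2) by blast+
    then show ?thesis by (simp add: S_def)
  qed
  have K_der: "((\<lambda>q. H (S q s) s) has_derivative H' (S q s) s) (at q)"
    if "q \<in> ball 0 r" "s \<in> unit_time" for q s
  proof -
    have "((\<lambda>q. S q s) has_derivative (\<lambda>v. v)) (at q)"
      unfolding S_def by (auto intro!: derivative_eq_intros)
    from has_derivative_compose[OF this H_has_derivative[OF S[OF that] that(2)]] show ?thesis .
  qed
  have K_cont: "continuous_on (ball 0 r \<times> unit_time) (\<lambda>(q, s). H' (S q s) s v)" for v
  proof -
    have "continuous_on (ball 0 r \<times> unit_time) (\<lambda>x. (\<lambda>(q, s). H' q s v) (S (fst x) (snd x), snd x))"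
      by (rule continuous_on_compose2[OF H'_cont[of v]])
        (use S in \<open>auto simp: S_def intro!: continuous_intros continuous_on_compose2[OF Y_cont[OF p]]\<close>)
    then show ?thesis by (simp add: case_prod_unfold)
  qed
  show ?thesis
    unfolding has_derivative_at_alt
  proof (intro conjI allI impI)
    show "bounded_linear (\<lambda>v. Z v s)"
      using linear_Z[OF s] by (simp add: linear_conv_bounded_linear)
    fix e :: real assume e: "0 < e"
    \<comment> \<open>The bound 1/4 leaves the Lipschitz constant 1/2 + 1/4 = 3/4 for R, and the
      other bound cancels the resulting factor 1 / (1 - 3/4) = 4 together with 1 + C.\<close>
    define \<eta> where "\<eta> = min (1/4) (e / (4 * (1 + C)))"
    have \<eta>: "0 < \<eta>" "\<eta> \<le> 1/4" "\<eta> \<le> e / (4 * (1 + C))"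
      unfolding \<eta>_def using e C0 by (simp_all only: min.cobounded1 min.cobounded2) simp
    have "\<eta> * (4 * (1 + C)) \<le> e"
      using \<eta>(3) C0 by (subst (asm) pos_le_divide_eq) auto
    then have \<eta>C: "4 * (\<eta> * (1 + C)) \<le> e" by (simp add: algebra_simps)
    obtain d where d: "0 < d" "\<And>q s. norm q < d \<Longrightarrow> s \<in> unit_time \<Longrightarrow>
        norm (H (S q s) s - H (S 0 s) s - H' (S 0 s) s q) \<le> \<eta> * norm q"
      by (rule uniform_linearization[OF r K_der K_cont \<eta>(1)]) auto
    obtain X where X: "p \<in> X" "open X"
      "\<forall>q\<in>X \<inter> U. \<forall>s\<in>unit_time. norm (Y q s - Y p s) \<le> d / 4"
      by (rule continuous_on_prod_compactE[OF Y_joint _ p, of "d / 4"])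
        (use d(1) in \<open>simp_all add: dist_norm\<close>)
    have "open (X \<inter> U)" "p \<in> X \<inter> U" using X U p by auto
    then obtain d2 where d2: "0 < d2" "ball p d2 \<subseteq> X \<inter> U" by (rule openE)
    show "\<exists>d>0. \<forall>q. norm (q - p) < d \<longrightarrow> norm (Y q s - Y p s - Z (q - p) s) \<le> e * norm (q - p)"
    proof (intro exI[of _ "min d2 (d / 2)"] conjI allI impI)
      fix q assume q: "norm (q - p) < min d2 (d / 2)"
      then have qX: "q \<in> X \<inter> U" using d2(2) by (force simp: dist_norm norm_minus_commute)
      define h where "h = q - p"
      define R where "R s = Y q s - Y p s - Z h s" for s
      define w where "w s = (h, Y q s - Y p s)" for s
      have "norm (R s) \<le> (norm (R 0) + \<eta> * (1 + C) * norm h) / (1 - 3/4)"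
      proof (rule ode_estimate[where y'="\<lambda>s. H (q, Y q s) s - H (p, Y p s) s - H' (p, Y p s) s (h, Z h s)"])
        fix s assume s: "s \<in> unit_time"
        show "(R has_vector_derivative H (q, Y q s) s - H (p, Y p s) s - H' (p, Y p s) s (h, Z h s))
            (at s within unit_time)"
          unfolding R_def by (intro derivative_intros Y_ode Z_ode s p) (use qX in auto)
        have w_d: "norm (w s) < d"
          using norm_Pair_le[of h "Y q s - Y p s"] bspec[OF bspec[OF X(3) qX] s] q d(1) by (simp add: w_def h_def)
        have Sw: "S (w s) s = (q, Y q s)" "S 0 s = (p, Y p s)" by (auto simp: S_def w_def h_def)
        have "w s = (h, Z h s) + (0, R s)" by (simp add: w_def R_def)
        then have "H' (p, Y p s) s (w s) = H' (p, Y p s) s (h, Z h s) + H' (p, Y p s) s (0, R s)"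
          by (simp only: linear_add[OF H'_linear[OF Yp[OF s] s]])
        then have "H (q, Y q s) s - H (p, Y p s) s - H' (p, Y p s) s (h, Z h s)
            = (H (S (w s) s) s - H (S 0 s) s - H' (S 0 s) s (w s)) + H' (p, Y p s) s (0, R s)"
          unfolding Sw by simp
        also have "norm \<dots> \<le> \<eta> * norm (w s) + 1/2 * norm (R s)"
          by (intro order_trans[OF norm_triangle_ineq] add_mono d(2) w_d s H'_snd_bound p Y_W)
        also have "\<eta> * norm (w s) \<le> \<eta> * (norm h + C * norm h + norm (R s))"
        proof (rule mult_left_mono)
          have "norm (w s) \<le> norm h + norm (Z h s + R s)"
            unfolding w_def by (rule order_trans[OF norm_Pair_le]) (simp add: R_def)
          then show "norm (w s) \<le> norm h + C * norm h + norm (R s)"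
            using norm_triangle_ineq[of "Z h s" "R s"] C[OF s, of h] by linarith
        qed (use \<eta> in auto)
        also have "\<eta> * (norm h + C * norm h + norm (R s)) \<le> \<eta> * (1 + C) * norm h + 1/4 * norm (R s)"
          using mult_right_mono[OF \<eta>(2), of "norm (R s)"] by (simp add: algebra_simps)
        finally show "norm (H (q, Y q s) s - H (p, Y p s) s - H' (p, Y p s) s (h, Z h s))
            \<le> 3/4 * norm (R s) + \<eta> * (1 + C) * norm h" by simp
      qed (use s in auto)
      moreover have "R 0 = 0" using Y_0[OF p] qX Z_0[of h] by (simp add: R_def h_def)
      ultimately have "norm (R s) \<le> 4 * (\<eta> * (1 + C)) * norm h" by simp
      also have "\<dots> \<le> e * norm h" using \<eta>C by (intro mult_right_mono) auto
      finally show "norm (Y q s - Y p s - Z (q - p) s) \<le> e * norm (q - p)"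
        by (simp add: R_def h_def)
    qed (use d d2 in auto)
  qed
qed

text \<open>The linearized right-hand side has the global constant 1/2 in the unknown, so
  \<open>ode_exists\<close> reaches all of \<open>unit_time\<close>. Its joint continuity needs the
  basis expansion, because the unknown enters through the direction of the derivative.\<close>

lemma variation_exists:
  assumes p: "p \<in> U"
  obtains z where "z 0 = l v"
    and "\<And>s. s \<in> unit_time \<Longrightarrow> (z has_vector_derivative H' (p, Y p s) s (v, z s)) (at s within unit_time)"
proof (rule ode_exists[where h="\<lambda>s y. H' (p, Y p s) s (v, y)" and u="l v"])
  have "continuous_on (unit_time \<times> (UNIV :: 'e set)) (\<lambda>x. (\<lambda>(q, s). H' q s w) ((p, Y p (fst x)), fst x))" for w
    by (rule continuous_on_compose2[OF H'_cont])
      (auto intro!: continuous_intros continuous_on_compose2[OF Y_cont[OF p]] p Y_W)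
  then have "continuous_on (unit_time \<times> (UNIV :: 'e set))
      (\<lambda>x. \<Sum>b\<in>Basis. ((v, snd x) \<bullet> b) *\<^sub>R H' (p, Y p (fst x)) (fst x) b)"
    by (intro continuous_intros) auto
  then show "continuous_on (unit_time \<times> UNIV) (\<lambda>(s, y). H' (p, Y p s) s (v, y))"
    by (rule continuous_on_eq)
      (auto simp: has_derivative_Basis_sum[OF H_has_derivative, symmetric] p Y_W)
  show "norm (H' (p, Y p s) s (v, y) - H' (p, Y p s) s (v, z)) \<le> 1/2 * norm (y - z)"
    if "s \<in> unit_time" for s y z
    using H'_snd_bound[OF p that Y_W[OF p that], of "y - z"] p that Y_W[OF p that]
    by (simp flip: linear_diff[OF H'_linear])
qed (use that in blast)

end

text \<open>The derivative of the solution in the direction \<open>v\<close> solves an equation of the same kind, whose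
  right-hand side is affine in the unknown.\<close>

theorem C_k_param_solution:
  fixes U :: "'p::euclidean_space set" and W :: "'e::euclidean_space set"
  assumes "param_ode U W H l Y" "C_k_param k (U \<times> W) H"
  shows "C_k_param k U Y"
  using assms
proof (induction k arbitrary: W H l Y)
  case 0
  then show ?case using param_ode.continuous_on_solution[OF 0(1)] by simp
next
  case (Suc k)
  interpret param_ode U W H l Y by (rule Suc.prems)
  have "C_k_param 1 (U \<times> W) H"
    unfolding One_nat_def C_k_param.simps(2)[of 0] unfolding C_k_param.simps(1)
    using Suc.prems(2) C_k_param_continuous_on unfolding C_k_param.simps(2) by blast
  then interpret param_ode_C1 U W H l Y by unfold_locales
  \<comment> \<open>The induction is used twice. Here it gives class k for Y itself, which makes the
    coefficients \<open>H' (p, Y p s) s\<close> of the linearized equation of class k; below it is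
    applied to that equation.\<close>
  have Yk: "C_k_param k U Y" using Suc.IH[OF Suc.prems(1) C_k_param_pred[OF Suc.prems(2)]] .
  have "\<exists>z. p \<in> U \<longrightarrow> z 0 = l v \<and> (\<forall>s\<in>unit_time.
      (z has_vector_derivative H' (p, Y p s) s (v, z s)) (at s within unit_time))" for p v
    using variation_exists[of p v] by metis
  then obtain Z where Z: "\<And>p v. p \<in> U \<Longrightarrow> Z p v 0 = l v"
    "\<And>p v s. p \<in> U \<Longrightarrow> s \<in> unit_time \<Longrightarrow>
      (Z p v has_vector_derivative H' (p, Y p s) s (v, Z p v s)) (at s within unit_time)"
    by metis
  show ?case
  proof (rule C_k_param_SucI[OF U C_k_param_continuous_on[OF Yk], where f'="\<lambda>p s v. Z p v s"])
    show "((\<lambda>p. Y p s) has_derivative (\<lambda>v. Z p v s)) (at p)" if "p \<in> U" "s \<in> unit_time" for p s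
      by (rule has_derivative_solution) (use Z that in auto)
    fix v
    let ?G = "\<lambda>q s. H' (fst q, Y (fst q) s) s (v, snd q)"
    have O: "open (U \<times> (UNIV :: 'e set))" using U by (intro open_Times) auto
    have Hw: "C_k_param k (U \<times> (UNIV :: 'e set)) (\<lambda>q s. H' (fst q, Y (fst q) s) s w)" for w
    proof (rule C_k_param_compose[OF O, where K="\<lambda>q s. H' q s w"
          and g="\<lambda>q s. (fst q, Y (fst q) s)" and Q="U \<times> W"])
      show "C_k_param k (U \<times> W) (\<lambda>q s. H' q s w)"
        using Suc.prems(2) unfolding C_k_param.simps by blast
      have "C_k_param k (U \<times> (UNIV :: 'e set)) (\<lambda>q s. Y (fst q) s)"
        by (rule C_k_param_compose[OF O Yk C_k_param_linear[OF O bounded_linear_fst]]) auto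
      then show "C_k_param k (U \<times> (UNIV :: 'e set)) (\<lambda>q s. (fst q, Y (fst q) s))"
        by (rule C_k_param_Pair[OF O C_k_param_linear[OF O bounded_linear_fst]])
    qed (auto intro: Y_W)
    have "C_k_param k (U \<times> UNIV) (\<lambda>q s. \<Sum>b\<in>Basis.
        (((v, 0) + (0, snd q)) \<bullet> b) *\<^sub>R H' (fst q, Y (fst q) s) s b)"
      by (intro C_k_param_sum C_k_param_scaleR O Hw C_k_param_bounded_linear[OF bounded_linear_inner_left]
          C_k_param_add C_k_param_const C_k_param_linear[where l="\<lambda>q. (0, snd q)"] bounded_linear_intros)
    then have Gk: "C_k_param k (U \<times> UNIV) ?G"
      by (rule C_k_param_cong[OF O, rotated])
        (auto simp: has_derivative_Basis_sum[OF H_has_derivative, symmetric] Y_W)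
    \<comment> \<open>For fixed v the initial value \<open>l v\<close> is the same for all p, whence
      the linear part 0. The equation is affine in its unknown, so the unknown may range over the
      whole space.\<close>
    have "param_ode U UNIV ?G (\<lambda>v. 0) (\<lambda>p s. Z p v s)"
    proof (rule param_ode.intro)
      show "bounded_linear (\<lambda>v::'p. 0::'e)" by (rule bounded_linear_zero)
      fix p s y z assume ps: "p \<in> U" "s \<in> unit_time"
      show "norm (?G (p, y) s - ?G (p, z) s) \<le> 1/2 * norm (y - z)"
        using H'_snd_bound[OF ps Y_W[OF ps], of "y - z"] Y_W[OF ps] ps
        by (simp flip: linear_diff[OF H'_linear])
    qed (use U Z in auto)
    then show "C_k_param k U (\<lambda>p s. Z p v s)" by (rule Suc.IH[OF _ Gk])
  qed
qed


section \<open>Local flows in Euclidean space\<close>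

lemma C_k_on_subset: "C_k_on k U f \<Longrightarrow> S \<subseteq> U \<Longrightarrow> C_k_on k S f"
  using C_k_param_subset by (auto simp: C_k_on_iff_param)

text \<open>Continuous basis derivatives are bounded on a compact ball, and the mean value
  inequality applies there by convexity. Both constants are raised to at least 1, since their
  reciprocals later serve as time steps.\<close>

lemma C1_Lipschitz_bounded:
  fixes G :: "'e::euclidean_space \<Rightarrow> 'b::real_normed_vector"
  assumes "open W" "u \<in> W" "C_k_on 1 W G"
  obtains R L B where "0 < R" "0 < L" "0 < B" "cball u R \<subseteq> W"
    and "\<And>x y. x \<in> cball u R \<Longrightarrow> y \<in> cball u R \<Longrightarrow> norm (G x - G y) \<le> L * norm (x - y)"
    and "\<And>x. x \<in> cball u R \<Longrightarrow> norm (G x) \<le> B"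
proof -
  obtain R where R: "0 < R" "cball u R \<subseteq> W"
    using assms(1,2) open_contains_cball by blast
  have bdd: "\<exists>C. \<forall>x\<in>cball u R. norm (f x) \<le> C" if "continuous_on W f" for f :: "'e \<Rightarrow> 'b"
    using compact_imp_bounded[OF compact_continuous_image[OF continuous_on_subset[OF that R(2)]]]
    by (auto simp: bounded_iff)
  have G': "(G has_derivative frechet_derivative G (at x)) (at x)" if "x \<in> W" for x
    using assms(3) that by (simp add: frechet_derivative_works)
  have "\<forall>b. \<exists>C. \<forall>x\<in>cball u R. norm (frechet_derivative G (at x) b) \<le> C"
    using assms(3) bdd by simp
  then obtain C where C: "\<forall>b. \<forall>x\<in>cball u R. norm (frechet_derivative G (at x) b) \<le> C b"
    using choice[of "\<lambda>b C. \<forall>x\<in>cball u R. norm (frechet_derivative G (at x) b) \<le> C"] by blast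
  define L where "L = (\<Sum>b\<in>(Basis::'e set). C b)"
  have L: "norm (frechet_derivative G (at x) v) \<le> L * norm v" if "x \<in> cball u R" for x v
  proof -
    have "frechet_derivative G (at x) v = (\<Sum>b\<in>Basis. (v \<bullet> b) *\<^sub>R frechet_derivative G (at x) b)"
      using that R(2) by (intro has_derivative_Basis_sum[OF G']) auto
    also have "norm \<dots> \<le> (\<Sum>b\<in>(Basis::'e set). norm v * C b)"
      unfolding norm_scaleR real_norm_def
      using C that Basis_le_norm[of _ v] by (intro sum_norm_le) (simp add: mult_mono)
    finally show ?thesis by (simp add: L_def sum_distrib_left mult.commute)
  qed
  have lip: "norm (G x - G y) \<le> max 1 L * norm (x - y)" if "x \<in> cball u R" "y \<in> cball u R" for x y
  proof (rule differentiable_bound[OF convex_cball _ _ that])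
    fix x assume x: "x \<in> cball u R"
    show "(G has_derivative frechet_derivative G (at x)) (at x within cball u R)"
      using has_derivative_at_withinI[OF G'] x R(2) by blast
    have "norm (frechet_derivative G (at x) v) \<le> max 1 L * norm v" for v
      using L[OF x, of v] mult_right_mono[of L "max 1 L" "norm v"] by simp
    then show "onorm (frechet_derivative G (at x)) \<le> max 1 L" by (rule onorm_le)
  qed
  obtain B where B: "\<forall>x\<in>cball u R. norm (G x) \<le> B"
    using bdd[OF C_k_on_imp_continuous_on[OF assms(3)]] by blast
  show ?thesis
    by (rule that[of R "max 1 L" "max 1 B", OF R(1) _ _ R(2) lip])
      (use B in \<open>auto intro: order_trans[OF _ max.cobounded2]\<close>)
qed

text \<open>The nearest-point projection onto K is 1-Lipschitz, so composing \<open>G\<close> with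
  it gives a globally Lipschitz field, to which \<open>ode_exists\<close> applies. The speed is at
  most |t| B, at most r, and therefore the solution moves by at most r. Wherever it lies in K it
  solves the original equation.\<close>

lemma confined_solution:
  fixes G :: "'e::euclidean_space \<Rightarrow> 'e"
  assumes K: "convex K" "closed K" "K \<noteq> {}"
    and lip: "\<And>x y. x \<in> K \<Longrightarrow> y \<in> K \<Longrightarrow> norm (G x - G y) \<le> L * norm (x - y)"
    and bound: "\<And>x. x \<in> K \<Longrightarrow> norm (G x) \<le> B"
    and t: "\<bar>t\<bar> * L \<le> 1/2" "\<bar>t\<bar> * B \<le> r" and L: "0 \<le> L"
  obtains y where "y 0 = u" "\<And>s. s \<in> unit_time \<Longrightarrow> norm (y s - u) \<le> r"
    and "\<And>s. s \<in> unit_time \<Longrightarrow>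
      (y has_vector_derivative t *\<^sub>R G (closest_point K (y s))) (at s within unit_time)"
proof -
  let ?h = "\<lambda>y. t *\<^sub>R G (closest_point K y)"
  have K_mem: "closest_point K y \<in> K" for y using closest_point_in_set K by blast
  have h_lip: "norm (?h y - ?h z) \<le> 1/2 * norm (y - z)" for y z
  proof -
    have "norm (?h y - ?h z) = \<bar>t\<bar> * norm (G (closest_point K y) - G (closest_point K z))"
      by (simp flip: scaleR_diff_right)
    also have "\<dots> \<le> \<bar>t\<bar> * (L * norm (y - z))"
      using closest_point_lipschitz[OF K, of y z]
      by (intro mult_left_mono order_trans[OF lip[OF K_mem K_mem]]) (auto simp: L dist_norm)
    also have "\<dots> \<le> 1/2 * norm (y - z)"
      using mult_right_mono[OF t(1), of "norm (y - z)"] by (simp add: mult.assoc)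
    finally show ?thesis .
  qed
  have "continuous_on UNIV ?h"
    by (rule lipschitz_on_continuous_on[of "1/2"])
      (use h_lip in \<open>auto simp: lipschitz_on_def dist_norm\<close>)
  then have "continuous_on (unit_time \<times> UNIV) (\<lambda>x. ?h (snd x))"
    by (rule continuous_on_compose2) (auto intro: continuous_intros)
  then obtain y where y: "y 0 = u"
    "\<And>s. s \<in> unit_time \<Longrightarrow> (y has_vector_derivative ?h (y s)) (at s within unit_time)"
    using ode_exists[of "\<lambda>s. ?h" u] h_lip by (auto simp: case_prod_unfold)
  have "norm (y s - u) \<le> r" if s: "s \<in> unit_time" for s
  proof -
    have r: "norm (?h (y s)) \<le> r" for s
      using mult_left_mono[OF bound[OF K_mem], of "\<bar>t\<bar>" "y s"] t(2) by simp
    have "norm (y s - y 0) \<le> r * \<bar>s - 0\<bar>"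
      by (rule vector_derivative_bound[OF _ y(2) r s]) auto
    also have "\<dots> \<le> r * 1"
      using order_trans[OF norm_ge_zero r] s by (intro mult_left_mono) (auto simp: abs_unit_time)
    finally show ?thesis by (simp add: y(1))
  qed
  with y that show ?thesis by blast
qed

text \<open>\<open>\<Phi> (u, t)\<close> is the value at time 1 of the solution of y' = t G(y) with
  y(0) = u. The second conclusion ties it to every solution that stays in the ball, in particular to
  one that is confined to a half-space although \<open>G\<close> itself ignores the
  half-space.\<close>

theorem smooth_local_flow:
  fixes G :: "'e::euclidean_space \<Rightarrow> 'e"
  assumes G: "\<And>k. C_k_on k (ball u0 R) G" and R: "0 < R"
    and lip: "\<And>x y. x \<in> cball u0 R \<Longrightarrow> y \<in> cball u0 R \<Longrightarrow> norm (G x - G y) \<le> L * norm (x - y)"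
    and bound: "\<And>x. x \<in> cball u0 R \<Longrightarrow> norm (G x) \<le> B"
    and \<epsilon>: "\<epsilon> * L \<le> 1/2" "\<epsilon> * B \<le> R/2" and LB: "0 \<le> L" "0 \<le> B"
  obtains \<Phi> where "\<And>k. C_k_on k (ball u0 (R/2) \<times> ball 0 \<epsilon>) \<Phi>"
    and "\<And>u t y. u \<in> ball u0 (R/2) \<Longrightarrow> t \<in> ball 0 \<epsilon> \<Longrightarrow> y 0 = u \<Longrightarrow>
      (\<And>s. s \<in> unit_time \<Longrightarrow> y s \<in> cball u0 R) \<Longrightarrow>
      (\<And>s. s \<in> unit_time \<Longrightarrow> (y has_vector_derivative t *\<^sub>R G (y s)) (at s within unit_time)) \<Longrightarrow>
      \<Phi> (u, t) = y 1"
proof -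
  let ?K = "cball u0 R" and ?U = "ball u0 (R/2) \<times> ball (0::real) \<epsilon>"
  have small: "\<bar>t\<bar> * L \<le> 1/2" "\<bar>t\<bar> * B \<le> R/2" if "t \<in> ball 0 \<epsilon>" for t :: real
    using that \<epsilon> LB mult_right_mono[of "\<bar>t\<bar>" \<epsilon> L] mult_right_mono[of "\<bar>t\<bar>" \<epsilon> B]
    by (auto intro: order_trans)
  have "\<exists>y. p \<in> ?U \<longrightarrow> y 0 = fst p \<and> (\<forall>s\<in>unit_time. norm (y s - fst p) \<le> R/2 \<and>
      (y has_vector_derivative snd p *\<^sub>R G (closest_point ?K (y s))) (at s within unit_time))" for p
  proof (cases "p \<in> ?U")
    case True
    then have "snd p \<in> ball 0 \<epsilon>" by auto
    show ?thesis
      by (rule confined_solution[of ?K G L B "snd p" "R/2" "fst p"])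
        (use lip bound R LB small[OF \<open>snd p \<in> ball 0 \<epsilon>\<close>] in auto)
  qed auto
  then have "\<forall>p. \<exists>y. p \<in> ?U \<longrightarrow> y 0 = fst p \<and> (\<forall>s\<in>unit_time. norm (y s - fst p) \<le> R/2 \<and>
      (y has_vector_derivative snd p *\<^sub>R G (closest_point ?K (y s))) (at s within unit_time))" by blast
  from choice[OF this] obtain Y where Y: "\<And>p. p \<in> ?U \<Longrightarrow> Y p 0 = fst p"
    "\<And>p s. p \<in> ?U \<Longrightarrow> s \<in> unit_time \<Longrightarrow> norm (Y p s - fst p) \<le> R/2"
    "\<And>p s. p \<in> ?U \<Longrightarrow> s \<in> unit_time \<Longrightarrow>
      (Y p has_vector_derivative snd p *\<^sub>R G (closest_point ?K (Y p s))) (at s within unit_time)"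
    by blast
  \<comment> \<open>The initial point is within R/2 of the centre and the solution moves by at most
    R/2, so it never reaches a point where the projection acts.\<close>
  have Y_ball: "Y p s \<in> ball u0 R" if "p \<in> ?U" "s \<in> unit_time" for p s
  proof -
    have "dist u0 (fst p) < R/2" using that by auto
    moreover have "dist (fst p) (Y p s) \<le> R/2"
      using Y(2)[OF that] by (simp add: dist_norm norm_minus_commute)
    ultimately show ?thesis using dist_triangle[of u0 "Y p s" "fst p"] by simp
  qed
  have Y_ode: "(Y p has_vector_derivative snd p *\<^sub>R G (Y p s)) (at s within unit_time)"
    if "p \<in> ?U" "s \<in> unit_time" for p s
    using Y(3)[OF that] Y_ball[OF that] by (simp add: closest_point_self)
  have t_lip: "norm (t *\<^sub>R G y - t *\<^sub>R G z) \<le> 1/2 * norm (y - z)"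
    if t: "t \<in> ball 0 \<epsilon>" and yz: "y \<in> cball u0 R" "z \<in> cball u0 R" for t :: real and y z
  proof -
    have "norm (t *\<^sub>R G y - t *\<^sub>R G z) \<le> \<bar>t\<bar> * (L * norm (y - z))"
      using mult_left_mono[OF lip[OF yz], of "\<bar>t\<bar>"] by (simp flip: scaleR_diff_right)
    also have "\<dots> \<le> 1/2 * norm (y - z)"
      using mult_right_mono[OF small(1)[OF t], of "norm (y - z)"] by (simp add: mult.assoc)
    finally show ?thesis .
  qed
  define H where "H q (s::real) = snd (fst q) *\<^sub>R G (snd q)" for q :: "('e \<times> real) \<times> 'e" and s
  have U: "open ?U" by (intro open_Times) auto
  then have UW: "open (?U \<times> ball u0 R)" by (intro open_Times) auto
  have ode: "param_ode ?U (ball u0 R) H fst Y"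
  proof (rule param_ode.intro[OF U open_ball _ bounded_linear_fst Y_ball])
    fix p s y z assume "p \<in> ?U" "y \<in> ball u0 R" "z \<in> ball u0 R"
    then show "norm (H (p, y) s - H (p, z) s) \<le> 1/2 * norm (y - z)"
      using t_lip[of "snd p" y z] by (auto simp: H_def)
  qed (use Y(1) Y_ode in \<open>auto simp: H_def\<close>)
  have H_k: "C_k_param k (?U \<times> ball u0 R) H" for k
    unfolding H_def
  proof (intro C_k_param_scaleR UW)
    show "C_k_param k (?U \<times> ball u0 R) (\<lambda>q s. snd (fst q))"
      by (intro C_k_param_linear[OF UW] bounded_linear_intros)
    show "C_k_param k (?U \<times> ball u0 R) (\<lambda>q s. G (snd q))"
      by (rule C_k_param_compose[OF UW C_k_param_passive[OF G] C_k_param_linear[OF UW bounded_linear_snd]])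
        auto
  qed
  show ?thesis
  proof (rule that[of "\<lambda>p. Y p 1"])
    show "C_k_on k ?U (\<lambda>p. Y p 1)" for k
      by (rule C_k_on_param[OF _ C_k_param_solution[OF ode H_k]]) simp
    fix u t and y :: "real \<Rightarrow> 'e"
    assume ut: "u \<in> ball u0 (R/2)" "t \<in> ball 0 \<epsilon>" and y: "y 0 = u"
      "\<And>s. s \<in> unit_time \<Longrightarrow> y s \<in> cball u0 R"
      "\<And>s. s \<in> unit_time \<Longrightarrow> (y has_vector_derivative t *\<^sub>R G (y s)) (at s within unit_time)"
    have p: "(u, t) \<in> ?U" using ut by simp
    show "Y (u, t) 1 = y 1"
    proof (rule ode_unique[OF Y_ode[OF p] y(3)])
      show "norm (snd (u, t) *\<^sub>R G (Y (u, t) s) - t *\<^sub>R G (y s)) \<le> 1/2 * norm (Y (u, t) s - y s)"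
        if "s \<in> unit_time" for s
        using t_lip[OF ut(2) _ y(2)[OF that]] Y_ball[OF p that] by simp
    qed (use Y(1)[OF p] y(1) in auto)
  qed
qed

subsection \<open>Half-spaces\<close>

text \<open>The square of the negative part is differentiable even at 0, with derivative zero on the
  whole nonnegative half-line. Applied to y s \<bullet> e it measures how far a curve has sunk below
  the wall.\<close>

lemma DERIV_min_0_square: "((\<lambda>x::real. (min x 0)\<^sup>2) has_real_derivative 2 * min x 0) (at x)"
proof (cases x "0::real" rule: linorder_cases)
  case less
  have "((\<lambda>x. x\<^sup>2) has_real_derivative 2 * min x 0) (at x)"
    using less by (auto intro!: derivative_eq_intros)
  then show ?thesis
    by (rule has_field_derivative_transform_within_open[of _ _ _ "{..<0}"]) (use less in auto)
next
  case equal
  have "(\<lambda>h. (min h 0)\<^sup>2 / h) \<midarrow>0\<rightarrow> (0::real)"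
  proof (rule Lim_null_comparison)
    show "\<forall>\<^sub>F h in at (0::real). norm ((min h 0)\<^sup>2 / h) \<le> \<bar>h\<bar>"
      by (auto simp: eventually_at_filter min_def power2_eq_square)
  qed (auto intro!: tendsto_eq_intros)
  then show ?thesis by (simp add: equal DERIV_def)
next
  case greater
  have "((\<lambda>x. 0) has_real_derivative 2 * min x 0) (at x)"
    using greater by (auto intro!: derivative_eq_intros)
  then show ?thesis
    by (rule has_field_derivative_transform_within_open[of _ _ _ "{0<..}"]) (use greater in auto)
qed

lemma half_space_convex_closed:
  assumes "subspace V"
  shows "convex (half_space V e)" "closed (half_space V e)"
proof -
  have "half_space V e = V \<inter> {v. e \<bullet> v \<ge> 0}" by (auto simp: half_space_def inner_commute)
  then show "convex (half_space V e)" "closed (half_space V e)"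
    using assms by (auto intro: convex_Int closed_Int subspace_imp_convex closed_subspace
        convex_halfspace_ge closed_halfspace_ge)
qed

text \<open>Below the half-space the confined field is parallel to the wall, so that no solution
  which starts in the half-space leaves it.\<close>

lemma half_space_solution:
  fixes G :: "'e::euclidean_space \<Rightarrow> 'e"
  assumes V: "subspace V" "e \<in> V"
    and u0: "u0 \<in> half_space V e" and u: "u \<in> half_space V e" "u \<in> ball u0 (R/2)"
    and K: "K = half_space V e \<inter> cball u0 R"
    and G_V: "\<And>v. v \<in> K \<Longrightarrow> G v \<in> V"
    and G_e: "\<And>v. v \<in> K \<Longrightarrow> e \<noteq> 0 \<Longrightarrow> v \<bullet> e = 0 \<Longrightarrow> G v \<bullet> e = 0"
    and lip: "\<And>x y. x \<in> K \<Longrightarrow> y \<in> K \<Longrightarrow> norm (G x - G y) \<le> L * norm (x - y)"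
    and bound: "\<And>x. x \<in> K \<Longrightarrow> norm (G x) \<le> B"
    and t: "\<bar>t\<bar> * L \<le> 1/2" "\<bar>t\<bar> * B \<le> R/2" and L: "0 \<le> L"
  obtains y where "y 0 = u" "\<And>s. s \<in> unit_time \<Longrightarrow> y s \<in> K"
    and "\<And>s. s \<in> unit_time \<Longrightarrow> (y has_vector_derivative t *\<^sub>R G (y s)) (at s within unit_time)"
proof -
  have "0 < R / 2" using u(2) by (metis ball_eq_empty empty_iff not_less)
  then have R: "0 < R" by simp
  have KK: "convex K" "closed K" "K \<noteq> {}"
    using half_space_convex_closed[OF V(1)] u0 R unfolding K
    by (auto intro!: convex_Int closed_Int)
  obtain y where y: "y 0 = u" "\<And>s. s \<in> unit_time \<Longrightarrow> norm (y s - u) \<le> R/2"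
    "\<And>s. s \<in> unit_time \<Longrightarrow>
      (y has_vector_derivative t *\<^sub>R G (closest_point K (y s))) (at s within unit_time)"
    by (rule confined_solution[OF KK lip bound t L, of u]) auto
  have K_mem: "closest_point K v \<in> K" for v using closest_point_in_set KK by blast
  have y_ball: "y s \<in> ball u0 R" if "s \<in> unit_time" for s
    using y(2)[OF that] u(2) dist_triangle[of u0 "y s" u]
    by (simp add: dist_norm norm_minus_commute)
  have y_V: "y s \<in> V" if s: "s \<in> unit_time" for s
  proof -
    \<comment> \<open>Here b is the part of the displacement orthogonal to V. The field has values
      in V, so y s \<bullet> b has derivative 0 and stays constant, which forces b = 0.\<close>
    obtain a b where ab: "a \<in> span V" "\<And>w. w \<in> span V \<Longrightarrow> orthogonal b w" "y s - u = a + b"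
      using orthogonal_subspace_decomp_exists[of V "y s - u"] by metis
    have span: "span V = V" using V(1) by (simp add: span_eq_iff[THEN iffD2])
    have "norm (y s \<bullet> b - y 0 \<bullet> b) \<le> 0 * \<bar>s - 0\<bar>"
    proof (rule vector_derivative_bound[where f'="\<lambda>s. 0"])
      fix s assume "s \<in> unit_time"
      have "t *\<^sub>R G (closest_point K (y s)) \<bullet> b = 0"
        using ab(2)[of "G (closest_point K (y s))"] G_V[OF K_mem] span
        by (simp add: orthogonal_def inner_commute)
      then show "((\<lambda>s. y s \<bullet> b) has_vector_derivative 0) (at s within unit_time)"
        using bounded_linear.has_vector_derivative[OF bounded_linear_inner_left y(3)[OF \<open>s \<in> unit_time\<close>], of b]
        by (simp only:)
    qed (use s in auto)
    then have "(y s - u) \<bullet> b = 0" by (simp add: y(1) inner_diff_left)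
    moreover have "a \<bullet> b = 0" using ab(2)[OF ab(1)] by (simp add: orthogonal_def inner_commute)
    ultimately have "b = 0" by (simp add: ab(3) inner_add_left)
    then have "y s = u + a" using ab(3) by (simp add: algebra_simps)
    then show ?thesis using u(1) ab(1) V(1) span by (auto simp: half_space_def subspace_add)
  qed
  have wall: "G (closest_point K (y s)) \<bullet> e = 0" if s: "s \<in> unit_time" and neg: "y s \<bullet> e < 0" for s
  proof -
    let ?q = "closest_point K (y s)"
    have "?q \<bullet> e = 0"
    proof (rule ccontr)
      assume "?q \<bullet> e \<noteq> 0"
      then have pos: "0 < ?q \<bullet> e" using K_mem[of "y s"] by (auto simp: K half_space_def)
      \<comment> \<open>The segment from the nearest point to y s crosses the wall at parameter
        \<tau>. If the nearest point were off the wall, the crossing point would still lie in K,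
        strictly on the way to y s, against the obtuse angle property of nearest points.\<close>
      define \<tau> where "\<tau> = (?q \<bullet> e) / (?q \<bullet> e - y s \<bullet> e)"
      have \<tau>: "0 < \<tau>" "\<tau> \<le> 1" using pos neg by (auto simp: \<tau>_def)
      let ?k = "?q + \<tau> *\<^sub>R (y s - ?q)"
      have k: "?k = (1 - \<tau>) *\<^sub>R ?q + \<tau> *\<^sub>R y s" by (simp add: algebra_simps)
      have "?k \<bullet> e = ?q \<bullet> e - \<tau> * (?q \<bullet> e - y s \<bullet> e)"
        by (simp add: inner_add_left inner_diff_left algebra_simps)
      also have "\<dots> = 0" using pos neg by (simp add: \<tau>_def)
      finally have "?k \<bullet> e = 0" .
      moreover have "?k \<in> V" unfolding k
        using K_mem[of "y s"] y_V[OF s] V(1) by (auto simp: K half_space_def subspace_add subspace_scale)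
      moreover have "?k \<in> cball u0 R" unfolding k
      proof (rule convexD[OF convex_cball])
        show "?q \<in> cball u0 R" using K_mem[of "y s"] unfolding K by blast
        show "y s \<in> cball u0 R" using y_ball[OF s] by simp
      qed (use \<tau> in auto)
      ultimately have "?k \<in> K" by (simp add: K half_space_def)
      then have "(y s - ?q) \<bullet> (?k - ?q) \<le> 0" using closest_point_dot[OF KK(1,2)] by blast
      then have "\<tau> * ((y s - ?q) \<bullet> (y s - ?q)) \<le> 0" by simp
      then have "y s = ?q" using \<tau>(1) by (simp add: mult_le_0_iff dot_square_norm)
      then show False using pos neg by simp
    qed
    moreover have "e \<noteq> 0" using neg by auto
    ultimately show ?thesis using G_e[OF K_mem] by blast
  qed
  have y_e: "0 \<le> y s \<bullet> e" if s: "s \<in> unit_time" for s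
  proof -
    \<comment> \<open>Below the wall the velocity has no e-component, and above it the derivative of
      \<open>?m\<close> is 0; hence \<open>?m (y s \<bullet> e)\<close> keeps its initial value
      0.\<close>
    let ?m = "\<lambda>x::real. (min x 0)\<^sup>2"
    have "norm (?m (y s \<bullet> e) - ?m (y 0 \<bullet> e)) \<le> 0 * \<bar>s - 0\<bar>"
    proof (rule vector_derivative_bound[where f'="\<lambda>s. 0"])
      fix s assume s: "s \<in> unit_time"
      have "((\<lambda>s. y s \<bullet> e) has_vector_derivative (t *\<^sub>R G (closest_point K (y s))) \<bullet> e) (at s within unit_time)"
        by (rule bounded_linear.has_vector_derivative[OF bounded_linear_inner_left y(3)[OF s]])
      from field_vector_diff_chain_within[OF this has_field_derivative_at_within[OF DERIV_min_0_square]]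
      show "((\<lambda>s. ?m (y s \<bullet> e)) has_vector_derivative 0) (at s within unit_time)"
        using wall[OF s] by (cases "y s \<bullet> e < 0") (auto simp: o_def)
    qed (use s in auto)
    moreover have "0 \<le> y 0 \<bullet> e" using u(1) by (simp add: y(1) half_space_def)
    ultimately show ?thesis by (simp add: min_def split: if_splits)
  qed
  have y_K: "y s \<in> K" if "s \<in> unit_time" for s
    using y_V[OF that] y_e[OF that] y_ball[OF that] by (simp add: K half_space_def)
  show ?thesis
    by (rule that[of y]) (use y(1,3) y_K closest_point_self[OF y_K] in auto)
qed


section \<open>Germs of smooth maps\<close>

definition smooth_germ :: "'a::euclidean_space set \<Rightarrow> 'a \<Rightarrow> ('a \<Rightarrow> 'b::real_normed_vector) \<Rightarrow> bool" where
  "smooth_germ S u f \<longleftrightarrow>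
     (\<exists>W g. open W \<and> u \<in> W \<and> (\<forall>k. C_k_on k W g) \<and> (\<forall>v\<in>S \<inter> W. g v = f v))"

lemma smooth_on_iff_germ: "smooth_on S f \<longleftrightarrow> (\<forall>u\<in>S. smooth_germ S u f)"
  by (simp add: smooth_on_def smooth_germ_def)

text \<open>The domain may change along with the function. This is what passes between a whole chart
  image and the part of it over an open set of the manifold.\<close>

lemma smooth_germ_cong:
  assumes "smooth_germ S u f" "\<forall>\<^sub>F v in nhds u. v \<in> S' \<longrightarrow> v \<in> S \<and> f v = f' v"
  shows "smooth_germ S' u f'"
proof -
  obtain W g where W: "open W" "u \<in> W" "\<And>k. C_k_on k W g" "\<And>v. v \<in> S \<inter> W \<Longrightarrow> g v = f v"
    using assms(1) by (auto simp: smooth_germ_def)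
  obtain N where N: "open N" "u \<in> N" "\<And>v. v \<in> N \<Longrightarrow> v \<in> S' \<Longrightarrow> v \<in> S \<and> f v = f' v"
    using assms(2) by (auto simp: eventually_nhds)
  have "C_k_on k (W \<inter> N) g" for k using C_k_on_subset[OF W(3)] by blast
  then show ?thesis unfolding smooth_germ_def
    using W N by (intro exI[of _ "W \<inter> N"] exI[of _ g]) auto
qed

lemma smooth_germ_open:
  assumes "open W" "u \<in> W" "\<And>k. C_k_on k W f"
  shows "smooth_germ S u f"
  using assms by (auto simp: smooth_germ_def)

lemma smooth_germ_const: "smooth_germ S u (\<lambda>v. c)"
  by (rule smooth_germ_open[of UNIV]) (auto simp: C_k_on_iff_param C_k_param_const)

lemma smooth_germ_bounded_linear:
  assumes "bounded_linear h" "smooth_germ S u f"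
  shows "smooth_germ S u (\<lambda>v. h (f v))"
proof -
  obtain W g where W: "open W" "u \<in> W" "\<And>k. C_k_on k W g" "\<And>v. v \<in> S \<inter> W \<Longrightarrow> g v = f v"
    using assms(2) by (auto simp: smooth_germ_def)
  have "C_k_on k W (\<lambda>v. h (g v))" for k
    using C_k_param_bounded_linear[OF assms(1) W(1)] W(3) by (simp add: C_k_on_iff_param)
  then show ?thesis unfolding smooth_germ_def
    using W by (intro exI[of _ W] exI[of _ "\<lambda>v. h (g v)"]) auto
qed

lemma smooth_germ_common:
  assumes "smooth_germ S u f" "smooth_germ S u f'"
  obtains W g g' where "open W" "u \<in> W" "\<And>k. C_k_on k W g" "\<And>k. C_k_on k W g'"
    "\<And>v. v \<in> S \<inter> W \<Longrightarrow> g v = f v" "\<And>v. v \<in> S \<inter> W \<Longrightarrow> g' v = f' v"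
proof -
  obtain W g where W: "open W" "u \<in> W" "\<And>k. C_k_on k W g" "\<And>v. v \<in> S \<inter> W \<Longrightarrow> g v = f v"
    using assms(1) by (auto simp: smooth_germ_def)
  obtain W' g' where W': "open W'" "u \<in> W'" "\<And>k. C_k_on k W' g'" "\<And>v. v \<in> S \<inter> W' \<Longrightarrow> g' v = f' v"
    using assms(2) by (auto simp: smooth_germ_def)
  show ?thesis
    by (rule that[of "W \<inter> W'" g g'])
      (use W W' C_k_on_subset[OF W(3), of "W \<inter> W'"] C_k_on_subset[OF W'(3), of "W \<inter> W'"] in auto)
qed

lemma smooth_germ_add:
  assumes "smooth_germ S u f" "smooth_germ S u f'"
  shows "smooth_germ S u (\<lambda>v. f v + f' v)"
proof -
  obtain W g g' where W: "open W" "u \<in> W" "\<And>k. C_k_on k W g" "\<And>k. C_k_on k W g'"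
    "\<And>v. v \<in> S \<inter> W \<Longrightarrow> g v = f v" "\<And>v. v \<in> S \<inter> W \<Longrightarrow> g' v = f' v"
    using smooth_germ_common[OF assms] by metis
  have "C_k_on k W (\<lambda>v. g v + g' v)" for k
    using C_k_param_add[OF W(1) W(3)[unfolded C_k_on_iff_param] W(4)[unfolded C_k_on_iff_param]]
    unfolding C_k_on_iff_param .
  then show ?thesis unfolding smooth_germ_def
    using W by (intro exI[of _ W] exI[of _ "\<lambda>v. g v + g' v"]) auto
qed

lemma smooth_germ_Pair:
  assumes "smooth_germ S u f" "smooth_germ S u f'"
  shows "smooth_germ S u (\<lambda>v. (f v, f' v))"
proof -
  obtain W g g' where W: "open W" "u \<in> W" "\<And>k. C_k_on k W g" "\<And>k. C_k_on k W g'"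
    "\<And>v. v \<in> S \<inter> W \<Longrightarrow> g v = f v" "\<And>v. v \<in> S \<inter> W \<Longrightarrow> g' v = f' v"
    using smooth_germ_common[OF assms] by metis
  have "C_k_on k W (\<lambda>v. (g v, g' v))" for k
    using C_k_param_Pair[OF W(1) W(3)[unfolded C_k_on_iff_param] W(4)[unfolded C_k_on_iff_param]]
    unfolding C_k_on_iff_param .
  then show ?thesis unfolding smooth_germ_def
    using W by (intro exI[of _ W] exI[of _ "\<lambda>v. (g v, g' v)"]) auto
qed

text \<open>The composite of the two extensions agrees with the given composite only where f lands
  in T. That set contains S near u, so the restriction is removed by
  \<open>smooth_germ_cong\<close>.\<close>

lemma smooth_germ_compose:
  fixes f :: "'a::euclidean_space \<Rightarrow> 'c::euclidean_space"
  assumes h: "smooth_germ T (f u) h" and f: "smooth_germ S u f" and u: "u \<in> S"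
    and T: "\<forall>\<^sub>F v in nhds u. v \<in> S \<longrightarrow> f v \<in> T"
  shows "smooth_germ S u (\<lambda>v. h (f v))"
proof -
  obtain W g where W: "open W" "u \<in> W" "\<And>k. C_k_on k W g" "\<And>v. v \<in> S \<inter> W \<Longrightarrow> g v = f v"
    using f by (auto simp: smooth_germ_def)
  obtain Q k where Q: "open Q" "f u \<in> Q" "\<And>n. C_k_on n Q k" "\<And>v. v \<in> T \<inter> Q \<Longrightarrow> k v = h v"
    using h by (auto simp: smooth_germ_def)
  have gu: "g u = f u" using W(2,4) u by blast
  have "continuous_on W g" using W(3)[of 0] by simp
  then have O: "open (W \<inter> g -` Q)"
    using W(1) Q(1) by (metis Int_commute continuous_on_open_vimage)
  let ?O = "W \<inter> g -` Q"
  have "C_k_on n ?O (\<lambda>v. k (g v))" for n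
    using C_k_param_compose[OF O, of n Q "\<lambda>q s. k q" "\<lambda>p s. g p"] Q(3) C_k_on_subset[OF W(3), of ?O]
    by (simp add: C_k_on_iff_param)
  then have "smooth_germ (S \<inter> {v. f v \<in> T}) u (\<lambda>v. h (f v))" unfolding smooth_germ_def
    using O W gu Q(2,4) by (intro exI[of _ ?O] exI[of _ "\<lambda>v. k (g v)"]) auto
  then show ?thesis by (rule smooth_germ_cong) (use T in \<open>auto elim: eventually_mono\<close>)
qed

text \<open>Several linear maps may be derivatives within S, for instance when S lies in a proper
  subspace. \<open>frechet_derivative\<close> is one of them as soon as any exists, and restricting
  the derivative of an extension supplies one.\<close>

lemma smooth_germ_has_derivative:
  assumes "smooth_germ S u f" "u \<in> S"
  shows "(f has_derivative frechet_derivative f (at u within S)) (at u within S)"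
proof -
  obtain W g where W: "open W" "u \<in> W" "\<And>k. C_k_on k W g" "\<And>v. v \<in> S \<inter> W \<Longrightarrow> g v = f v"
    using assms(1) by (auto simp: smooth_germ_def)
  have "g differentiable (at u)" using W(2) W(3)[of 1] by simp
  then obtain D where "(g has_derivative D) (at u within S)"
    by (auto simp: differentiable_def intro: has_derivative_at_withinI)
  then have "(f has_derivative D) (at u within S)"
    by (rule has_derivative_transform_eventually)
      (use W assms(2) in \<open>auto simp: eventually_at_filter eventually_nhds\<close>)
  then show ?thesis by (metis differentiableI frechet_derivative_works)
qed

subsection \<open>Germs on a manifold\<close>

locale manifold =
  fixes V :: "'e::euclidean_space set" and e :: 'e
    and A :: "('a::{t2_space, second_countable_topology}, 'e) chart set"
  assumes smooth_manifold: "smooth_manifold V e A"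
begin

lemma subspace_V: "subspace V" and e_V: "e \<in> V"
  using smooth_manifold by (auto simp: smooth_manifold_def)

lemma is_chart: "c \<in> A \<Longrightarrow> is_chart V e c"
  using smooth_manifold by (auto simp: smooth_manifold_def)

lemma chart_open: "c \<in> A \<Longrightarrow> open (fst c)"
  using is_chart by (auto simp: is_chart_def)

lemma chart_image_openin: "c \<in> A \<Longrightarrow> openin (top_of_set (half_space V e)) (chart_image c)"
  using is_chart by (auto simp: is_chart_def)

lemma chart_homeomorphism: "c \<in> A \<Longrightarrow> homeomorphism (fst c) (chart_image c) (snd c) (chart_inv c)"
  using is_chart by (auto simp: is_chart_def)

lemma chart_inv_left [simp]: "c \<in> A \<Longrightarrow> p \<in> fst c \<Longrightarrow> chart_inv c (snd c p) = p"
  using chart_homeomorphism by (rule homeomorphism_apply1)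

lemma chart_inv_right [simp]: "u \<in> chart_image c \<Longrightarrow> snd c (chart_inv c u) = u"
  by (rule f_inv_into_f)

lemma chart_inv_mem [simp]: "u \<in> chart_image c \<Longrightarrow> chart_inv c u \<in> fst c"
  by (rule inv_into_into)

lemma chart_image_restrict:
  "v \<in> chart_image c \<Longrightarrow> chart_inv c v \<in> S \<Longrightarrow> v \<in> snd c ` (fst c \<inter> S)"
  by (rule image_eqI[of _ _ "chart_inv c v"]) auto

lemma ex_chart: "\<exists>c. c \<in> charts_at A p"
proof -
  have "p \<in> (\<Union>c\<in>A. fst c)" using smooth_manifold by (simp add: smooth_manifold_def)
  then show ?thesis by blast
qed

lemma eventually_in_chart: "c \<in> charts_at A p \<Longrightarrow> \<forall>\<^sub>F x in nhds p. x \<in> fst c"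
  using eventually_nhds_in_open[OF chart_open] by simp

lemma chart_tendsto:
  assumes "c \<in> charts_at A p" shows "(snd c \<longlongrightarrow> snd c p) (nhds p)"
proof -
  have "continuous_on (fst c) (snd c)"
    using chart_homeomorphism assms by (auto simp: homeomorphism_def)
  then have "isCont (snd c) p"
    using assms chart_open by (simp add: continuous_on_eq_continuous_at)
  then show ?thesis by (simp add: isCont_def tendsto_at_iff_tendsto_nhds)
qed

text \<open>The chart image need not be open in the ambient space, so local statements are moved
  into coordinates relative to it, as an implication inside a full neighbourhood filter.\<close>

lemma eventually_chart:
  assumes c: "c \<in> charts_at A p"
  shows "eventually P (nhds p) \<longleftrightarrow> (\<forall>\<^sub>F v in nhds (snd c p). v \<in> chart_image c \<longrightarrow> P (chart_inv c v))"
    (is "_ \<longleftrightarrow> ?R")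
proof
  assume P: "eventually P (nhds p)"
  have "continuous_on (chart_image c) (chart_inv c)"
    using chart_homeomorphism c by (auto simp: homeomorphism_def)
  then have "(chart_inv c \<longlongrightarrow> p) (at (snd c p) within chart_image c)"
    using c by (auto simp: continuous_on_def)
  then have "\<forall>\<^sub>F v in at (snd c p) within chart_image c. P (chart_inv c v)"
    using P by (rule eventually_compose_filterlim[rotated])
  then show ?R unfolding eventually_at_filter
    by (rule eventually_mono) (use c eventually_nhds_x_imp_x[OF P] in auto)
next
  assume ?R
  from eventually_compose_filterlim[OF this chart_tendsto[OF c]] eventually_in_chart[OF c]
  show "eventually P (nhds p)" by eventually_elim (use c in auto)
qed

text \<open>Values in any normed space are allowed, so that real functions and the coordinate
  expressions of maps share one calculus.\<close>

definition germ :: "'a \<Rightarrow> ('a \<Rightarrow> 'b::real_normed_vector) \<Rightarrow> bool" where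
  "germ p h \<longleftrightarrow>
     (\<forall>c\<in>charts_at A p. smooth_germ (chart_image c) (snd c p) (\<lambda>v. h (chart_inv c v)))"

text \<open>The continuity clause keeps f x inside the domain of the target chart for x near p;
  outside that domain the values of \<open>snd d\<close> carry no meaning.\<close>

definition map_germ :: "'a \<Rightarrow> ('a \<Rightarrow> 'a) \<Rightarrow> bool" where
  "map_germ p f \<longleftrightarrow> (f \<longlongrightarrow> f p) (nhds p) \<and> (\<forall>d\<in>charts_at A (f p). germ p (\<lambda>x. snd d (f x)))"

lemma germD:
  "germ p h \<Longrightarrow> c \<in> charts_at A p \<Longrightarrow>
    smooth_germ (chart_image c) (snd c p) (\<lambda>v. h (chart_inv c v))"
  unfolding germ_def by blast

lemma germI:
  "(\<And>c. c \<in> charts_at A p \<Longrightarrow> smooth_germ (chart_image c) (snd c p) (\<lambda>v. h (chart_inv c v)))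
    \<Longrightarrow> germ p h"
  unfolding germ_def by blast

lemma map_germ_tendsto: "map_germ p f \<Longrightarrow> (f \<longlongrightarrow> f p) (nhds p)"
  unfolding map_germ_def by blast

lemma map_germ_chart: "map_germ p f \<Longrightarrow> d \<in> charts_at A (f p) \<Longrightarrow> germ p (\<lambda>x. snd d (f x))"
  unfolding map_germ_def by blast

lemma smooth_transition:
  assumes "c \<in> charts_at A p" "d \<in> charts_at A p"
  shows "smooth_germ (chart_image c) (snd c p) (\<lambda>v. snd d (chart_inv c v))"
proof -
  have "smooth_on (snd c ` (fst c \<inter> fst d)) (snd d \<circ> chart_inv c)"
    using smooth_manifold assms by (auto simp: smooth_manifold_def)
  then have "smooth_germ (snd c ` (fst c \<inter> fst d)) (snd c p) (snd d \<circ> chart_inv c)"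
    using assms by (auto simp: smooth_on_iff_germ)
  then show ?thesis
  proof (rule smooth_germ_cong)
    show "\<forall>\<^sub>F v in nhds (snd c p). v \<in> chart_image c \<longrightarrow>
        v \<in> snd c ` (fst c \<inter> fst d) \<and> (snd d \<circ> chart_inv c) v = snd d (chart_inv c v)"
      using eventually_in_chart[OF assms(2), unfolded eventually_chart[OF assms(1)]]
    proof eventually_elim
      case (elim v)
      show ?case
      proof
        assume v: "v \<in> chart_image c"
        then have "chart_inv c v \<in> fst c \<inter> fst d" "v = snd c (chart_inv c v)" using elim by auto
        then show "v \<in> snd c ` (fst c \<inter> fst d) \<and> (snd d \<circ> chart_inv c) v = snd d (chart_inv c v)"
          by auto
      qed
    qed
  qed
qed

lemma germ_cong:
  assumes "germ p h" "\<forall>\<^sub>F x in nhds p. h x = h' x"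
  shows "germ p h'"
  unfolding germ_def
proof
  fix c assume c: "c \<in> charts_at A p"
  have "smooth_germ (chart_image c) (snd c p) (\<lambda>v. h (chart_inv c v))"
    using assms(1) c unfolding germ_def by blast
  then show "smooth_germ (chart_image c) (snd c p) (\<lambda>v. h' (chart_inv c v))"
    by (rule smooth_germ_cong)
      (rule eventually_mono[OF iffD1[OF eventually_chart[OF c] assms(2)]], simp)
qed

text \<open>One chart suffices: near p the expression in another chart d is the one in c composed
  with the smooth coordinate change from d to c.\<close>

lemma germ_chartI:
  assumes c: "c \<in> charts_at A p"
    and h: "smooth_germ (chart_image c) (snd c p) (\<lambda>v. h (chart_inv c v))"
  shows "germ p h"
  unfolding germ_def
proof
  fix d assume d: "d \<in> charts_at A p"
  have ev: "\<forall>\<^sub>F v in nhds (snd d p). v \<in> chart_image d \<longrightarrow> chart_inv d v \<in> fst c"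
    using eventually_in_chart[OF c] unfolding eventually_chart[OF d] .
  have "smooth_germ (chart_image d) (snd d p) (\<lambda>v. h (chart_inv c (snd c (chart_inv d v))))"
  proof (rule smooth_germ_compose[OF _ smooth_transition[OF d c]])
    show "smooth_germ (chart_image c) (snd c (chart_inv d (snd d p))) (\<lambda>v. h (chart_inv c v))"
      using h d by simp
    show "snd d p \<in> chart_image d" using d by simp
    show "\<forall>\<^sub>F v in nhds (snd d p). v \<in> chart_image d \<longrightarrow> snd c (chart_inv d v) \<in> chart_image c"
      by (rule eventually_mono[OF ev]) simp
  qed
  then show "smooth_germ (chart_image d) (snd d p) (\<lambda>v. h (chart_inv d v))"
    by (rule smooth_germ_cong) (rule eventually_mono[OF ev], use c in simp)
qed

lemma germ_chart: "d \<in> charts_at A p \<Longrightarrow> germ p (snd d)"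
  using smooth_transition by (auto simp: germ_def)

lemma germ_tendsto:
  assumes "germ p h" shows "(h \<longlongrightarrow> h p) (nhds p)"
proof -
  obtain c where c: "c \<in> charts_at A p" using ex_chart by blast
  have "smooth_germ (chart_image c) (snd c p) (\<lambda>v. h (chart_inv c v))"
    using assms c unfolding germ_def by blast
  then obtain W g where W: "open W" "snd c p \<in> W" "\<forall>k. C_k_on k W g"
    "\<forall>v\<in>chart_image c \<inter> W. g v = h (chart_inv c v)"
    unfolding smooth_germ_def by blast
  have "isCont g (snd c p)"
    using W(1,2) spec[OF W(3), of 0] by (simp add: continuous_on_eq_continuous_at)
  then have lim: "((\<lambda>x. g (snd c x)) \<longlongrightarrow> g (snd c p)) (nhds p)"
    using chart_tendsto[OF c] by (rule isCont_tendsto_compose)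
  have eq: "g (snd c x) = h x" if "x \<in> fst c" "snd c x \<in> W" for x
    using bspec[OF W(4), of "snd c x"] that c by simp
  have "\<forall>\<^sub>F x in nhds p. g (snd c x) = h x"
    using eventually_in_chart[OF c] topological_tendstoD[OF chart_tendsto[OF c] W(1,2)]
    by eventually_elim (rule eq)
  with lim show ?thesis
    using Lim_transform_eventually[of "\<lambda>x. g (snd c x)"] eq[of p] c W(2) by simp
qed

lemma germ_const: "germ p (\<lambda>x. k)"
  by (rule germI) (rule smooth_germ_const)

lemma germ_add: "germ p h \<Longrightarrow> germ p h' \<Longrightarrow> germ p (\<lambda>x. h x + h' x)"
  by (rule germI) (rule smooth_germ_add; rule germD)

lemma germ_Pair: "germ p h \<Longrightarrow> germ p h' \<Longrightarrow> germ p (\<lambda>x. (h x, h' x))"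
  by (rule germI) (rule smooth_germ_Pair; rule germD)

lemma germ_minus: "germ p h \<Longrightarrow> germ p (\<lambda>x. - h x)"
  by (rule germI, rule smooth_germ_bounded_linear[OF bounded_linear_minus[OF bounded_linear_ident]])
    (rule germD)

lemma germ_diff: "germ p h \<Longrightarrow> germ p h' \<Longrightarrow> germ p (\<lambda>x. h x - h' x)"
  using germ_add[of p h "\<lambda>x. - h' x"] germ_minus by auto

lemma germ_compose:
  fixes h :: "'a \<Rightarrow> 'b::euclidean_space"
  assumes "germ p h" "smooth_germ T (h p) g" "\<forall>\<^sub>F x in nhds p. h x \<in> T"
  shows "germ p (\<lambda>x. g (h x))"
proof (rule germI)
  fix c assume c: "c \<in> charts_at A p"
  show "smooth_germ (chart_image c) (snd c p) (\<lambda>v. g (h (chart_inv c v)))"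
    by (rule smooth_germ_compose[OF _ germD[OF assms(1) c], of T])
      (use assms(2) c assms(3)[unfolded eventually_chart[OF c]] in simp_all)
qed

lemma map_germ_eventually_in_chart:
  assumes "map_germ p f" "d \<in> charts_at A (f p)"
  shows "\<forall>\<^sub>F x in nhds p. f x \<in> fst d"
  by (rule topological_tendstoD[OF map_germ_tendsto[OF assms(1)]]) (use assms(2) chart_open in auto)

lemma germ_map:
  assumes f: "map_germ p f" and h: "germ (f p) h"
  shows "germ p (\<lambda>x. h (f x))"
proof -
  obtain d where d: "d \<in> charts_at A (f p)" using ex_chart by blast
  have ev: "\<forall>\<^sub>F x in nhds p. f x \<in> fst d" by (rule map_germ_eventually_in_chart[OF f d])
  have "germ p (\<lambda>x. h (chart_inv d (snd d (f x))))"
    by (rule germ_compose[OF map_germ_chart[OF f d] germD[OF h d]])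
      (rule eventually_mono[OF ev], simp)
  then show ?thesis
    by (rule germ_cong) (rule eventually_mono[OF ev], use d in simp)
qed

lemma map_germ_compose:
  assumes "map_germ p f" "map_germ (f p) g"
  shows "map_germ p (\<lambda>x. g (f x))"
  unfolding map_germ_def
  using filterlim_compose[OF map_germ_tendsto[OF assms(2)] map_germ_tendsto[OF assms(1)]]
    germ_map[OF assms(1) map_germ_chart[OF assms(2)]] by blast

text \<open>Continuity at p need not be supplied: the coordinates of f in d are continuous as a
  smooth germ, and the chart inverse carries this back because f stays in the domain of d.\<close>

lemma map_germ_chartI:
  assumes d: "d \<in> charts_at A (f p)" and f: "germ p (\<lambda>x. snd d (f x))"
    and ev: "\<forall>\<^sub>F x in nhds p. f x \<in> fst d"
  shows "map_germ p f"
  unfolding map_germ_def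
proof
  show "(f \<longlongrightarrow> f p) (nhds p)"
  proof (rule topological_tendstoI)
    fix S assume S: "open S" "f p \<in> S"
    have "\<forall>\<^sub>F y in nhds (f p). y \<in> S" using S by (auto simp: eventually_nhds)
    then have "\<forall>\<^sub>F v in nhds (snd d (f p)). v \<in> chart_image d \<longrightarrow> chart_inv d v \<in> S"
      unfolding eventually_chart[OF d] .
    from eventually_compose_filterlim[OF this germ_tendsto[OF f]] ev
    show "\<forall>\<^sub>F x in nhds p. f x \<in> S" by eventually_elim (use d in auto)
  qed
  show "\<forall>d'\<in>charts_at A (f p). germ p (\<lambda>x. snd d' (f x))"
  proof
    fix d' assume d': "d' \<in> charts_at A (f p)"
    have "germ p (\<lambda>x. snd d' (chart_inv d (snd d (f x))))"
      by (rule germ_compose[OF f smooth_transition[OF d d']]) (rule eventually_mono[OF ev], simp)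
    then show "germ p (\<lambda>x. snd d' (f x))"
      by (rule germ_cong) (rule eventually_mono[OF ev], use d in simp)
  qed
qed

lemma map_germ_cong:
  assumes "map_germ p f" "\<forall>\<^sub>F x in nhds p. f x = f' x"
  shows "map_germ p f'"
proof -
  have eq: "f p = f' p" using eventually_nhds_x_imp_x[OF assms(2)] .
  obtain d where d: "d \<in> charts_at A (f p)" using ex_chart by blast
  show ?thesis
  proof (rule map_germ_chartI)
    show "d \<in> charts_at A (f' p)" using d eq by simp
    show "germ p (\<lambda>x. snd d (f' x))"
      by (rule germ_cong[OF map_germ_chart[OF assms(1) d]]) (rule eventually_mono[OF assms(2)], simp)
    show "\<forall>\<^sub>F x in nhds p. f' x \<in> fst d"
      using map_germ_eventually_in_chart[OF assms(1) d] assms(2) by eventually_elim simp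
  qed
qed

lemma map_germ_id: "map_germ p (\<lambda>x. x)"
  unfolding map_germ_def using germ_chart filterlim_ident by blast

section \<open>Smoothness on open sets in terms of germs\<close>

lemma smooth_function_on_iff_germ:
  assumes "open W"
  shows "smooth_function_on A W \<alpha> \<longleftrightarrow> (\<forall>p\<in>W. germ p \<alpha>)"
proof
  assume \<alpha>: "smooth_function_on A W \<alpha>"
  show "\<forall>p\<in>W. germ p \<alpha>"
  proof (intro ballI germI)
    fix p c assume p: "p \<in> W" and c: "c \<in> charts_at A p"
    have "smooth_germ (snd c ` (fst c \<inter> W)) (snd c p) (\<alpha> \<circ> chart_inv c)"
      using \<alpha> c p unfolding smooth_function_on_def smooth_on_iff_germ by blast
    then show "smooth_germ (chart_image c) (snd c p) (\<lambda>v. \<alpha> (chart_inv c v))"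
    proof (rule smooth_germ_cong)
      have "\<forall>\<^sub>F x in nhds p. x \<in> W" using assms p by (rule eventually_nhds_in_open)
      then show "\<forall>\<^sub>F v in nhds (snd c p). v \<in> chart_image c \<longrightarrow>
          v \<in> snd c ` (fst c \<inter> W) \<and> (\<alpha> \<circ> chart_inv c) v = \<alpha> (chart_inv c v)"
        unfolding eventually_chart[OF c]
        by (rule eventually_mono) (simp add: chart_image_restrict)
    qed
  qed
next
  assume \<alpha>: "\<forall>p\<in>W. germ p \<alpha>"
  show "smooth_function_on A W \<alpha>"
    unfolding smooth_function_on_def smooth_on_iff_germ
  proof (intro ballI)
    fix c u assume c: "c \<in> A" and u: "u \<in> snd c ` (fst c \<inter> W)"
    then obtain p where p: "p \<in> fst c" "p \<in> W" "u = snd c p" by auto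
    then have "smooth_germ (chart_image c) u (\<lambda>v. \<alpha> (chart_inv c v))"
      using \<alpha> c germD[of p \<alpha> c] by simp
    then show "smooth_germ (snd c ` (fst c \<inter> W)) u (\<alpha> \<circ> chart_inv c)"
      by (rule smooth_germ_cong) (auto intro: always_eventually)
  qed
qed

lemma smooth_map_on_iff_germ:
  assumes "open W"
  shows "smooth_map_on A W f \<longleftrightarrow> (\<forall>p\<in>W. map_germ p f)"
proof
  assume f: "smooth_map_on A W f"
  show "\<forall>p\<in>W. map_germ p f"
  proof
    fix p assume p: "p \<in> W"
    have "isCont f p" using f p assms by (simp add: smooth_map_on_def continuous_on_eq_continuous_at)
    then have cont: "(f \<longlongrightarrow> f p) (nhds p)" by (simp add: isCont_def tendsto_at_iff_tendsto_nhds)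
    have "smooth_germ (chart_image c) (snd c p) (\<lambda>v. snd d (f (chart_inv c v)))"
      if c: "c \<in> charts_at A p" and d: "d \<in> charts_at A (f p)" for c d
    proof -
      let ?S = "snd c ` (fst c \<inter> W \<inter> f -` fst d)"
      have "smooth_germ ?S (snd c p) (snd d \<circ> f \<circ> chart_inv c)"
        using f c d p unfolding smooth_map_on_def smooth_on_iff_germ by blast
      then show ?thesis
      proof (rule smooth_germ_cong)
        have "\<forall>\<^sub>F x in nhds p. x \<in> W" using assms p by (rule eventually_nhds_in_open)
        moreover have "\<forall>\<^sub>F x in nhds p. f x \<in> fst d"
          by (rule topological_tendstoD[OF cont]) (use d chart_open in auto)
        ultimately have "\<forall>\<^sub>F x in nhds p. x \<in> W \<and> f x \<in> fst d" by eventually_elim simp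
        then show "\<forall>\<^sub>F v in nhds (snd c p). v \<in> chart_image c \<longrightarrow>
            v \<in> ?S \<and> (snd d \<circ> f \<circ> chart_inv c) v = snd d (f (chart_inv c v))"
          unfolding eventually_chart[OF c]
          by (rule eventually_mono) (simp add: chart_image_restrict Int_assoc)
      qed
    qed
    then show "map_germ p f" unfolding map_germ_def by (intro conjI ballI cont germI)
  qed
next
  assume f: "\<forall>p\<in>W. map_germ p f"
  show "smooth_map_on A W f"
    unfolding smooth_map_on_def smooth_on_iff_germ
  proof (intro conjI ballI)
    show "continuous_on W f"
      using f by (auto simp: map_germ_def continuous_on_eq_continuous_at[OF assms] isCont_def
          tendsto_at_iff_tendsto_nhds)
    fix c d u assume cd: "c \<in> A" "d \<in> A" and "u \<in> snd c ` (fst c \<inter> W \<inter> f -` fst d)"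
    then obtain p where p: "p \<in> fst c" "p \<in> W" "f p \<in> fst d" "u = snd c p" by auto
    then have "smooth_germ (chart_image c) u (\<lambda>v. snd d (f (chart_inv c v)))"
      using germD[OF map_germ_chart[of p f d], of c] f cd by simp
    then show "smooth_germ (snd c ` (fst c \<inter> W \<inter> f -` fst d)) u (snd d \<circ> f \<circ> chart_inv c)"
      by (rule smooth_germ_cong) (auto intro: always_eventually)
  qed
qed

subsection \<open>Derivatives along curves\<close>

text \<open>The curve stays in the chart near t, so any derivative of h within the chart image may
  be composed with its velocity. The left-hand side is an ordinary derivative in one real variable
  and hence unique; this is what makes values computed in different charts comparable.\<close>

lemma curve_chain:
  assumes c: "c \<in> charts_at A (\<gamma> t)" and h: "germ (\<gamma> t) h" and \<gamma>: "isCont \<gamma> t"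
    and w: "((\<lambda>s. snd c (\<gamma> s)) has_vector_derivative w) (at t)"
  shows "((\<lambda>s. h (\<gamma> s)) has_vector_derivative
    frechet_derivative (\<lambda>v. h (chart_inv c v)) (at (snd c (\<gamma> t)) within chart_image c) w) (at t)"
proof -
  let ?D = "frechet_derivative (\<lambda>v. h (chart_inv c v)) (at (snd c (\<gamma> t)) within chart_image c)"
  have "\<forall>\<^sub>F s in at t. \<gamma> s \<in> fst c"
    by (rule topological_tendstoD[OF \<gamma>[unfolded isCont_def]]) (use c chart_open in auto)
  then have "\<forall>\<^sub>F s in nhds t. \<gamma> s \<in> fst c"
    unfolding eventually_at_filter by (rule eventually_mono) (use c in auto)
  then obtain S where S: "open S" "t \<in> S" "\<And>s. s \<in> S \<Longrightarrow> \<gamma> s \<in> fst c"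
    by (auto simp: eventually_nhds)
  have D: "((\<lambda>v. h (chart_inv c v)) has_derivative ?D) (at (snd c (\<gamma> t)) within chart_image c)"
    by (rule smooth_germ_has_derivative[OF germD[OF h c]]) (use c in auto)
  have w': "((\<lambda>s. snd c (\<gamma> s)) has_derivative (\<lambda>r. r *\<^sub>R w)) (at t within S)"
    using w unfolding has_vector_derivative_def by (rule has_derivative_at_withinI)
  have "((\<lambda>s. h (chart_inv c (snd c (\<gamma> s)))) has_derivative (\<lambda>r. ?D (r *\<^sub>R w))) (at t within S)"
    by (rule has_derivative_in_compose[OF w' has_derivative_subset[OF D]]) (use S in auto)
  then have "((\<lambda>s. h (chart_inv c (snd c (\<gamma> s)))) has_derivative (\<lambda>r. r *\<^sub>R ?D w)) (at t)"
    by (simp add: at_within_open[OF S(2,1)] linear_cmul[OF has_derivative_linear[OF D]])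
  then show ?thesis
    unfolding has_vector_derivative_def
    by (rule has_derivative_transform_within_open[OF _ S(1,2)]) (use S(3) c in auto)
qed

end


section \<open>Flows of vector fields\<close>

locale flow_field = manifold V e A
  for V :: "'e::euclidean_space set" and e :: 'e
    and A :: "('a::{t2_space, second_countable_topology}, 'e) chart set" +
  fixes F :: "('a, 'e) vector_field"
  assumes smooth_F: "smooth_vector_field V A F"
    and tangent_F: "tangent_to_boundary e A F"
begin

section \<open>The field in a single chart\<close>

lemma chart_half_space: "c \<in> A \<Longrightarrow> p \<in> fst c \<Longrightarrow> snd c p \<in> half_space V e"
  using openin_imp_subset[OF chart_image_openin] by blast

lemma F_mem: "c \<in> charts_at A p \<Longrightarrow> F p c \<in> V"
  using smooth_F unfolding smooth_vector_field_def tangent_space_def by blast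

lemma F_transform:
  assumes "c \<in> charts_at A p" "d \<in> charts_at A p"
  shows "frechet_derivative (\<lambda>v. snd d (chart_inv c v)) (at (snd c p) within chart_image c) (F p c) = F p d"
proof -
  have "F p \<in> tangent_space V A p" using smooth_F by (simp add: smooth_vector_field_def)
  then have "F p d = frechet_derivative (snd d \<circ> chart_inv c) (at (snd c p) within chart_image c) (F p c)"
    using assms unfolding tangent_space_def by blast
  then show ?thesis by (simp add: comp_def)
qed

lemma F_wall:
  assumes "c \<in> A" "v \<in> chart_image c" "e \<noteq> 0" "v \<bullet> e = 0"
  shows "F (chart_inv c v) c \<bullet> e = 0"
proof -
  have "chart_inv c v \<in> manifold_boundary e A"
    unfolding manifold_boundary_def using assms chart_inv_right[of v c] chart_inv_mem[of v c] by auto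
  moreover have "c \<in> charts_at A (chart_inv c v)" using assms by simp
  ultimately show ?thesis using tangent_F unfolding tangent_to_boundary_def by blast
qed

text \<open>\<open>G\<close> is a smooth extension of the coordinate field to an ambient ball, small
  enough for its part in the half-space to lie in the chart image. Away from the half-space
  \<open>G\<close> has no relation to the field.\<close>

lemma chart_model:
  assumes c: "c \<in> charts_at A p"
  obtains G R L B where "0 < R" "0 < L" "0 < B" "\<And>k. C_k_on k (ball (snd c p) R) G"
    and "half_space V e \<inter> cball (snd c p) R \<subseteq> chart_image c"
    and "\<And>v. v \<in> half_space V e \<inter> cball (snd c p) R \<Longrightarrow> G v = F (chart_inv c v) c"
    and "\<And>x y. x \<in> cball (snd c p) R \<Longrightarrow> y \<in> cball (snd c p) R \<Longrightarrow> norm (G x - G y) \<le> L * norm (x - y)"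
    and "\<And>x. x \<in> cball (snd c p) R \<Longrightarrow> norm (G x) \<le> B"
proof -
  let ?u = "snd c p"
  have "smooth_on (chart_image c) (\<lambda>u. F (chart_inv c u) c)"
    using smooth_F c by (simp add: smooth_vector_field_def)
  then have "smooth_germ (chart_image c) ?u (\<lambda>u. F (chart_inv c u) c)"
    using c by (simp add: smooth_on_iff_germ)
  then obtain W G where W: "open W" "?u \<in> W" "\<forall>k. C_k_on k W G"
    "\<forall>v\<in>chart_image c \<inter> W. G v = F (chart_inv c v) c"
    unfolding smooth_germ_def by blast
  obtain O' where O': "open O'" "chart_image c = half_space V e \<inter> O'"
    using chart_image_openin c unfolding openin_open by blast
  have u: "?u \<in> chart_image c" using c by simp
  have WO: "open (W \<inter> O')" "?u \<in> W \<inter> O'" using W(1,2) O' u by auto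
  have "C_k_on 1 (W \<inter> O') G" using C_k_on_subset[OF spec[OF W(3)]] by blast
  then obtain R L B where R: "0 < R" "0 < L" "0 < B" "cball ?u R \<subseteq> W \<inter> O'"
    "\<And>x y. x \<in> cball ?u R \<Longrightarrow> y \<in> cball ?u R \<Longrightarrow> norm (G x - G y) \<le> L * norm (x - y)"
    "\<And>x. x \<in> cball ?u R \<Longrightarrow> norm (G x) \<le> B"
    using C1_Lipschitz_bounded[OF WO] by metis
  show ?thesis
  proof (rule that[OF R(1-3) _ _ _ R(5,6)])
    show "C_k_on k (ball ?u R) G" for k
      by (rule C_k_on_subset[OF spec[OF W(3)]]) (use R(4) ball_subset_cball in blast)
    show "half_space V e \<inter> cball ?u R \<subseteq> chart_image c" using R(4) O'(2) by blast
    show "G v = F (chart_inv c v) c" if "v \<in> half_space V e \<inter> cball ?u R" for v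
      using that R(4) O'(2) W(4) by blast
  qed
qed

text \<open>Unlike \<open>integral_trajectory\<close> this fixes no base point, so that the notion
  survives a translation of time.\<close>

definition trajectory :: "real set \<Rightarrow> (real \<Rightarrow> 'a) \<Rightarrow> bool" where
  "trajectory I \<gamma> \<longleftrightarrow> open I \<and> is_interval I \<and> continuous_on I \<gamma> \<and>
     (\<forall>t\<in>I. \<forall>c\<in>charts_at A (\<gamma> t). ((\<lambda>s. snd c (\<gamma> s)) has_vector_derivative F (\<gamma> t) c) (at t))"

lemma integral_trajectory_iff:
  "integral_trajectory A F x I \<gamma> \<longleftrightarrow> trajectory I \<gamma> \<and> 0 \<in> I \<and> \<gamma> 0 = x"
  unfolding integral_trajectory_def trajectory_def by (auto simp: comp_def)

lemma trajectory_isCont: "trajectory I \<gamma> \<Longrightarrow> t \<in> I \<Longrightarrow> isCont \<gamma> t"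
  unfolding trajectory_def using continuous_on_eq_continuous_at by blast

lemma trajectory_derivative:
  "trajectory I \<gamma> \<Longrightarrow> t \<in> I \<Longrightarrow> c \<in> charts_at A (\<gamma> t) \<Longrightarrow>
    ((\<lambda>s. snd c (\<gamma> s)) has_vector_derivative F (\<gamma> t) c) (at t)"
  unfolding trajectory_def by blast

lemma trajectory_shift:
  assumes "trajectory I \<gamma>"
  shows "trajectory {s. s + a \<in> I} (\<lambda>s. \<gamma> (s + a))"
  unfolding trajectory_def
proof (intro conjI ballI)
  have I: "{s. s + a \<in> I} = (\<lambda>s. s + a) -` I" by auto
  show "open {s. s + a \<in> I}" unfolding I
    using assms by (intro open_vimage continuous_intros) (simp add: trajectory_def)
  have iv: "is_interval I" using assms by (simp add: trajectory_def)
  show "is_interval {s. s + a \<in> I}"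
    unfolding is_interval_1
  proof (intro ballI allI impI)
    fix x y z assume "x \<in> {s. s + a \<in> I}" "y \<in> {s. s + a \<in> I}" "x \<le> z \<and> z \<le> y"
    then show "z \<in> {s. s + a \<in> I}"
      using mem_is_interval_1_I[OF iv, of "x + a" "y + a" "z + a"] by simp
  qed
  show "continuous_on {s. s + a \<in> I} (\<lambda>s. \<gamma> (s + a))"
    by (rule continuous_on_compose2[of I]) (use assms in \<open>auto simp: trajectory_def intro!: continuous_intros\<close>)
  fix t c assume t: "t \<in> {s. s + a \<in> I}" and c: "c \<in> charts_at A (\<gamma> (t + a))"
  have "((\<lambda>s. s + a) has_vector_derivative 1) (at t)" by (auto intro!: derivative_eq_intros)
  from vector_diff_chain_at[OF this trajectory_derivative[OF assms _ c]] t
  show "((\<lambda>s. snd c (\<gamma> (s + a))) has_vector_derivative F (\<gamma> (t + a)) c) (at t)"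
    by (simp add: comp_def)
qed

lemma trajectory_coordinates:
  assumes \<gamma>: "trajectory I \<gamma>" and I: "a + t * s \<in> I" and c: "c \<in> charts_at A (\<gamma> (a + t * s))"
  shows "((\<lambda>s. snd c (\<gamma> (a + t * s))) has_vector_derivative t *\<^sub>R F (\<gamma> (a + t * s)) c) (at s within S)"
proof -
  have "((\<lambda>s. a + t * s) has_vector_derivative t) (at s)"
    by (auto intro!: derivative_eq_intros simp: has_real_derivative_iff_has_vector_derivative[symmetric])
  from vector_diff_chain_at[OF this trajectory_derivative[OF \<gamma> I c]]
  show ?thesis by (simp add: comp_def has_vector_derivative_at_within)
qed

text \<open>Near t both curves stay in one chart and in the ball where the extended field is
  Lipschitz. The substitution s \<mapsto> t + \<epsilon> s brings them to \<open>unit_time\<close>,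
  where \<open>ode_unique\<close> compares their coordinates.\<close>

lemma trajectory_eventually_eq:
  assumes \<gamma>: "trajectory I \<gamma>" and \<delta>: "trajectory J \<delta>" and t: "t \<in> I" "t \<in> J" "\<gamma> t = \<delta> t"
  shows "\<forall>\<^sub>F s in nhds t. \<gamma> s = \<delta> s"
proof -
  obtain c where c: "c \<in> charts_at A (\<gamma> t)" using ex_chart by blast
  let ?u = "snd c (\<gamma> t)"
  obtain G R L B where G: "0 < R" "0 < L" "0 < B" "\<And>k. C_k_on k (ball ?u R) G"
    "half_space V e \<inter> cball ?u R \<subseteq> chart_image c"
    "\<And>v. v \<in> half_space V e \<inter> cball ?u R \<Longrightarrow> G v = F (chart_inv c v) c"
    "\<And>x y. x \<in> cball ?u R \<Longrightarrow> y \<in> cball ?u R \<Longrightarrow> norm (G x - G y) \<le> L * norm (x - y)"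
    "\<And>x. x \<in> cball ?u R \<Longrightarrow> norm (G x) \<le> B"
    by (rule chart_model[OF c]) blast
  have ev: "\<forall>\<^sub>F s in nhds t. s \<in> K \<and> \<eta> s \<in> fst c \<and> snd c (\<eta> s) \<in> cball ?u R"
    if \<eta>: "trajectory K \<eta>" "t \<in> K" "\<eta> t = \<gamma> t" for K \<eta>
  proof -
    have "(\<eta> \<longlongrightarrow> \<eta> t) (nhds t)"
      using trajectory_isCont[OF \<eta>(1,2)] by (simp add: isCont_def tendsto_at_iff_tendsto_nhds)
    then have lim: "(\<eta> \<longlongrightarrow> \<gamma> t) (nhds t)" by (simp only: \<eta>(3))
    have "\<forall>\<^sub>F s in nhds t. s \<in> K"
      using \<eta>(1,2) by (intro eventually_nhds_in_open) (auto simp: trajectory_def)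
    moreover have "\<forall>\<^sub>F s in nhds t. \<eta> s \<in> fst c"
      by (rule topological_tendstoD[OF lim]) (use c chart_open in auto)
    moreover have "\<forall>\<^sub>F s in nhds t. snd c (\<eta> s) \<in> ball ?u R"
      by (rule topological_tendstoD[OF filterlim_compose[OF chart_tendsto[OF c] lim]]) (use G(1) in auto)
    ultimately show ?thesis by eventually_elim auto
  qed
  have "\<forall>\<^sub>F s in nhds t. (s \<in> I \<and> \<gamma> s \<in> fst c \<and> snd c (\<gamma> s) \<in> cball ?u R) \<and>
      (s \<in> J \<and> \<delta> s \<in> fst c \<and> snd c (\<delta> s) \<in> cball ?u R)"
    using ev[OF \<gamma> t(1) refl] ev[OF \<delta> t(2) t(3)[symmetric]] by (rule eventually_conj)
  then obtain \<rho> where \<rho>: "0 < \<rho>" "\<And>s. dist s t < \<rho> \<Longrightarrow>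
      (s \<in> I \<and> \<gamma> s \<in> fst c \<and> snd c (\<gamma> s) \<in> cball ?u R) \<and>
      (s \<in> J \<and> \<delta> s \<in> fst c \<and> snd c (\<delta> s) \<in> cball ?u R)"
    unfolding eventually_nhds_metric by blast
  \<comment> \<open>The first bound keeps t + \<epsilon> s inside the common neighbourhood; the
    second reduces the Lipschitz constant to 1/2.\<close>
  define \<epsilon> where "\<epsilon> = min (\<rho> / 2) (1 / (2 * L))"
  have "\<epsilon> \<le> 1 / (2 * L)" by (simp add: \<epsilon>_def)
  then have "\<epsilon> * L \<le> 1/2" using G(2) by (simp add: field_simps)
  moreover have "0 < \<epsilon>" "\<epsilon> < \<rho>" using \<rho>(1) G(2) by (simp_all add: \<epsilon>_def min_def)
  ultimately have \<epsilon>: "0 < \<epsilon>" "\<epsilon> < \<rho>" "\<epsilon> * L \<le> 1/2" by blast+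
  have near: "dist (t + \<epsilon> * s) t < \<rho>" if "s \<in> unit_time" for s
  proof -
    have "\<epsilon> * \<bar>s\<bar> \<le> \<epsilon> * 1" using that \<epsilon>(1) by (intro mult_left_mono) (auto simp: abs_unit_time)
    then have "\<epsilon> * \<bar>s\<bar> < \<rho>" using \<epsilon>(2) by linarith
    then show ?thesis using \<epsilon>(1) by (simp add: dist_norm abs_mult)
  qed
  have F_G: "F q c = G (snd c q)" if "q \<in> fst c" "snd c q \<in> cball ?u R" for q
  proof -
    have "snd c q \<in> half_space V e" using chart_half_space[of c q] c that(1) by simp
    then show ?thesis using G(6)[of "snd c q"] that c by simp
  qed
  have "snd c (\<gamma> (t + \<epsilon> * s)) = snd c (\<delta> (t + \<epsilon> * s))" if s: "s \<in> unit_time" for s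
  proof (rule ode_unique[OF _ _ _ _ s])
    fix s assume s: "s \<in> unit_time"
    note n = \<rho>(2)[OF near[OF s]]
    show "((\<lambda>s. snd c (\<gamma> (t + \<epsilon> * s))) has_vector_derivative \<epsilon> *\<^sub>R F (\<gamma> (t + \<epsilon> * s)) c) (at s within unit_time)"
      by (rule trajectory_coordinates[OF \<gamma>]) (use n c in auto)
    show "((\<lambda>s. snd c (\<delta> (t + \<epsilon> * s))) has_vector_derivative \<epsilon> *\<^sub>R F (\<delta> (t + \<epsilon> * s)) c) (at s within unit_time)"
      by (rule trajectory_coordinates[OF \<delta>]) (use n c in auto)
    let ?y = "snd c (\<gamma> (t + \<epsilon> * s))" and ?z = "snd c (\<delta> (t + \<epsilon> * s))"
    have "norm (\<epsilon> *\<^sub>R F (\<gamma> (t + \<epsilon> * s)) c - \<epsilon> *\<^sub>R F (\<delta> (t + \<epsilon> * s)) c) = \<epsilon> * norm (G ?y - G ?z)"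
      using n F_G \<epsilon>(1) by (simp flip: scaleR_diff_right)
    also have "\<dots> \<le> \<epsilon> * (L * norm (?y - ?z))"
      using n \<epsilon>(1) by (intro mult_left_mono G(7)) auto
    also have "\<dots> \<le> 1/2 * norm (?y - ?z)"
      using mult_right_mono[OF \<epsilon>(3), of "norm (?y - ?z)"] by (simp add: mult.assoc)
    finally show "norm (\<epsilon> *\<^sub>R F (\<gamma> (t + \<epsilon> * s)) c - \<epsilon> *\<^sub>R F (\<delta> (t + \<epsilon> * s)) c) \<le> 1/2 * norm (?y - ?z)" .
  qed (use t(3) in simp)
  note coord = this
  have eq: "\<gamma> (t + \<epsilon> * s) = \<delta> (t + \<epsilon> * s)" if s: "s \<in> unit_time" for s
  proof -
    have "chart_inv c (snd c (\<gamma> (t + \<epsilon> * s))) = chart_inv c (snd c (\<delta> (t + \<epsilon> * s)))"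
      by (simp only: coord[OF s])
    then show ?thesis using \<rho>(2)[OF near[OF s]] c by simp
  qed
  show ?thesis
    unfolding eventually_nhds_metric
  proof (intro exI[of _ \<epsilon>] conjI allI impI)
    fix s assume "dist s t < \<epsilon>"
    then have "(s - t) / \<epsilon> \<in> unit_time" using \<epsilon>(1) by (simp add: abs_unit_time dist_norm)
    then show "\<gamma> s = \<delta> s" using eq[of "(s - t) / \<epsilon>"] \<epsilon>(1) by simp
  qed (use \<epsilon> in auto)
qed

text \<open>The truth value of \<gamma> s = \<delta> s is locally constant on the connected set I
  \<inter> J: agreement spreads by local uniqueness, and disagreement by the Hausdorff
  property.\<close>

lemma trajectory_unique:
  assumes \<gamma>: "trajectory I \<gamma>" and \<delta>: "trajectory J \<delta>"
    and a: "a \<in> I" "a \<in> J" "\<gamma> a = \<delta> a" and t: "t \<in> I" "t \<in> J"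
  shows "\<gamma> t = \<delta> t"
proof -
  have K: "open (I \<inter> J)" "connected (I \<inter> J)"
    using \<gamma> \<delta> by (auto simp: trajectory_def is_interval_connected is_interval_Int)
  have "(\<gamma> a = \<delta> a) = (\<gamma> t = \<delta> t)"
  proof (rule connected_local_const[where f="\<lambda>s. \<gamma> s = \<delta> s", OF K(2)])
    show "\<forall>s\<in>I \<inter> J. \<forall>\<^sub>F r in at s within I \<inter> J. (\<gamma> s = \<delta> s) = (\<gamma> r = \<delta> r)"
    proof
      fix s assume s: "s \<in> I \<inter> J"
      have "\<forall>\<^sub>F r in nhds s. (\<gamma> s = \<delta> s) = (\<gamma> r = \<delta> r)"
      proof (cases "\<gamma> s = \<delta> s")
        case True
        then show ?thesis using trajectory_eventually_eq[OF \<gamma> \<delta>, of s] s by (auto elim: eventually_mono)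
      next
        case False
        obtain X Y where X: "open X" "open Y" "\<gamma> s \<in> X" "\<delta> s \<in> Y" "X \<inter> Y = {}"
          using hausdorff[OF False] by blast
        have "(\<gamma> \<longlongrightarrow> \<gamma> s) (nhds s)" "(\<delta> \<longlongrightarrow> \<delta> s) (nhds s)"
          using trajectory_isCont[OF \<gamma>, of s] trajectory_isCont[OF \<delta>, of s] s
          by (simp_all add: isCont_def tendsto_at_iff_tendsto_nhds)
        then have "\<forall>\<^sub>F r in nhds s. \<gamma> r \<in> X" "\<forall>\<^sub>F r in nhds s. \<delta> r \<in> Y"
          using X by (auto intro: topological_tendstoD)
        then show ?thesis by eventually_elim (use X(5) False in auto)
      qed
      then show "\<forall>\<^sub>F r in at s within I \<inter> J. (\<gamma> s = \<delta> s) = (\<gamma> r = \<delta> r)"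
        by (auto simp: eventually_at_filter elim: eventually_mono)
    qed
  qed (use a t in auto)
  then show ?thesis using a(3) by simp
qed

text \<open>One \<epsilon> serves all starting points in N, and their trajectories stay in the chart
  up to that time. \<open>\<Phi>\<close> lives on an open set Q of the ambient space, so that it is
  smooth in the ordinary sense also at coordinates of boundary points.\<close>

definition flow_box :: "('a, 'e) chart \<Rightarrow> real \<Rightarrow> 'a set \<Rightarrow> ('e \<times> real) set \<Rightarrow> ('e \<times> real \<Rightarrow> 'e) \<Rightarrow> bool" where
  "flow_box c \<epsilon> N Q \<Phi> \<longleftrightarrow> c \<in> A \<and> 0 < \<epsilon> \<and> open N \<and> N \<subseteq> fst c \<and> open Q \<and> (\<forall>k. C_k_on k Q \<Phi>) \<and>
     (\<forall>x\<in>N. \<exists>\<gamma>. trajectory (ball 0 \<epsilon>) \<gamma> \<and> \<gamma> 0 = x \<and>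
       (\<forall>t\<in>ball 0 \<epsilon>. (snd c x, t) \<in> Q \<and> \<gamma> t \<in> fst c \<and> snd c (\<gamma> t) = \<Phi> (snd c x, t)))"

text \<open>Two solutions are matched: \<open>smooth_local_flow\<close> gives a smooth
  \<open>\<Phi>\<close> for the extended field, blind to the half-space, and
  \<open>half_space_solution\<close> gives a solution inside it, which is a genuine trajectory. The
  former theorem identifies their values.\<close>

lemma ex_flow_box: "\<exists>c \<epsilon> N Q \<Phi>. p \<in> N \<and> flow_box c \<epsilon> N Q \<Phi>"
proof -
  obtain c where c: "c \<in> charts_at A p" using ex_chart by blast
  let ?u0 = "snd c p"
  obtain G R L B where G: "0 < R" "0 < L" "0 < B" "\<And>k. C_k_on k (ball ?u0 R) G"
    "half_space V e \<inter> cball ?u0 R \<subseteq> chart_image c"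
    "\<And>v. v \<in> half_space V e \<inter> cball ?u0 R \<Longrightarrow> G v = F (chart_inv c v) c"
    "\<And>x y. x \<in> cball ?u0 R \<Longrightarrow> y \<in> cball ?u0 R \<Longrightarrow> norm (G x - G y) \<le> L * norm (x - y)"
    "\<And>x. x \<in> cball ?u0 R \<Longrightarrow> norm (G x) \<le> B"
    by (rule chart_model[OF c]) blast
  \<comment> \<open>The first bound gives the Lipschitz constant 1/2; the second limits the
    displacement to R/2, so that points starting in the ball of radius R/2 stay in the ball of
    radius R.\<close>
  define \<epsilon> where "\<epsilon> = min (1 / (2 * L)) (R / (2 * B))"
  have "\<epsilon> \<le> 1 / (2 * L)" "\<epsilon> \<le> R / (2 * B)" by (simp_all add: \<epsilon>_def)
  moreover have "0 < \<epsilon>" using G(1-3) by (simp add: \<epsilon>_def)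
  ultimately have \<epsilon>: "0 < \<epsilon>" "\<epsilon> * L \<le> 1/2" "\<epsilon> * B \<le> R/2"
    using G(1-3) by (simp_all add: field_simps)
  let ?Q = "ball ?u0 (R/2) \<times> ball (0::real) \<epsilon>"
  obtain \<Phi> where \<Phi>: "\<And>k. C_k_on k ?Q \<Phi>"
    "\<And>u t y. u \<in> ball ?u0 (R/2) \<Longrightarrow> t \<in> ball 0 \<epsilon> \<Longrightarrow> y 0 = u \<Longrightarrow>
      (\<And>s. s \<in> unit_time \<Longrightarrow> y s \<in> cball ?u0 R) \<Longrightarrow>
      (\<And>s. s \<in> unit_time \<Longrightarrow> (y has_vector_derivative t *\<^sub>R G (y s)) (at s within unit_time)) \<Longrightarrow>
      \<Phi> (u, t) = y 1"
    by (rule smooth_local_flow[OF G(4,1,7,8) \<epsilon>(2,3)]) (use G(2,3) in auto)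
  define N where "N = fst c \<inter> snd c -` ball ?u0 (R/2)"
  have cont_c: "continuous_on (fst c) (snd c)" "continuous_on (chart_image c) (chart_inv c)"
    using chart_homeomorphism c by (auto simp: homeomorphism_def)
  have N: "open N" "p \<in> N" "N \<subseteq> fst c"
    unfolding N_def using continuous_open_preimage[OF cont_c(1) chart_open] c G(1) by auto
  have hs: "snd c x \<in> half_space V e" if "x \<in> fst c" for x
    using chart_half_space[of c x] c that by simp
  have box: "\<exists>\<gamma>. trajectory (ball 0 \<epsilon>) \<gamma> \<and> \<gamma> 0 = x \<and>
       (\<forall>t\<in>ball 0 \<epsilon>. (snd c x, t) \<in> ?Q \<and> \<gamma> t \<in> fst c \<and> snd c (\<gamma> t) = \<Phi> (snd c x, t))"
    if x: "x \<in> N" for x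
  proof -
    let ?K = "half_space V e \<inter> cball ?u0 R"
    have x': "x \<in> fst c" "snd c x \<in> ball ?u0 (R/2)" using x by (auto simp: N_def)
    obtain y where y: "y 0 = snd c x" "\<And>s. s \<in> unit_time \<Longrightarrow> y s \<in> ?K"
      "\<And>s. s \<in> unit_time \<Longrightarrow> (y has_vector_derivative \<epsilon> *\<^sub>R G (y s)) (at s within unit_time)"
    proof (rule half_space_solution[OF subspace_V e_V hs hs[OF x'(1)] x'(2) refl, where G=G and t=\<epsilon>])
      show "p \<in> fst c" using c by simp
      fix v assume v: "v \<in> ?K"
      then have v': "v \<in> chart_image c" using G(5) by blast
      show "G v \<in> V" using G(6)[OF v] F_mem[of c "chart_inv c v"] c v' by simp
      show "G v \<bullet> e = 0" if "e \<noteq> 0" "v \<bullet> e = 0"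
        using G(6)[OF v] F_wall[OF _ v' that] c by simp
    qed (use G(2,7,8) \<epsilon> in auto)
    have y_ci: "y s \<in> chart_image c" if "s \<in> unit_time" for s using y(2)[OF that] G(5) by blast
    have scale: "t / \<epsilon> \<in> unit_time" "t / \<epsilon> \<in> {-1<..<1}" if "t \<in> ball 0 \<epsilon>" for t
      using that \<epsilon>(1) by (auto simp: unit_time_def field_simps)
    define \<gamma> where "\<gamma> t = chart_inv c (y (t / \<epsilon>))" for t
    have \<gamma>: "\<gamma> t \<in> fst c" "snd c (\<gamma> t) = y (t / \<epsilon>)" if "t \<in> ball 0 \<epsilon>" for t
      using y_ci[OF scale(1)[OF that]] by (simp_all add: \<gamma>_def)
    have "continuous_on unit_time y" using y(3) by (rule continuous_on_vector_derivative)
    then have "continuous_on (ball 0 \<epsilon>) (\<lambda>t. y (t / \<epsilon>))"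
      by (rule continuous_on_compose2) (use \<epsilon>(1) scale in \<open>auto intro!: continuous_intros\<close>)
    then have cont: "continuous_on (ball 0 \<epsilon>) \<gamma>" unfolding \<gamma>_def
      by (rule continuous_on_compose2[OF cont_c(2)]) (use y_ci scale in auto)
    have "trajectory (ball 0 \<epsilon>) \<gamma>"
      unfolding trajectory_def
    proof (intro conjI ballI cont)
      fix t d assume t: "t \<in> ball 0 \<epsilon>" and d: "d \<in> charts_at A (\<gamma> t)"
      have c': "c \<in> charts_at A (\<gamma> t)" using c \<gamma>(1)[OF t] by simp
      have "((\<lambda>t. t / \<epsilon>) has_vector_derivative 1 / \<epsilon>) (at t)"
        unfolding has_real_derivative_iff_has_vector_derivative[symmetric]
        using \<epsilon>(1) by (auto intro!: derivative_eq_intros)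
      \<comment> \<open>The derivative of y is known only within the closed interval; since t /
        \<epsilon> lies strictly between -1 and 1, it is two-sided there.\<close>
      moreover have "(y has_vector_derivative \<epsilon> *\<^sub>R G (y (t / \<epsilon>))) (at (t / \<epsilon>))"
        using has_vector_derivative_within_subset[OF y(3)[OF scale(1)[OF t]], of "{-1<..<1}"]
          at_within_open[OF scale(2)[OF t]] by (simp add: unit_time_def subset_iff)
      ultimately have "((\<lambda>t. y (t / \<epsilon>)) has_vector_derivative (1 / \<epsilon>) *\<^sub>R \<epsilon> *\<^sub>R G (y (t / \<epsilon>))) (at t)"
        using vector_diff_chain_at by (fastforce simp: comp_def)
      also have "(1 / \<epsilon>) *\<^sub>R \<epsilon> *\<^sub>R G (y (t / \<epsilon>)) = F (\<gamma> t) c"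
        using \<epsilon>(1) G(6)[OF y(2)[OF scale(1)[OF t]]] by (simp add: \<gamma>_def)
      finally have "((\<lambda>s. snd c (\<gamma> s)) has_vector_derivative F (\<gamma> t) c) (at t)"
        by (rule has_vector_derivative_transform_within_open[OF _ open_ball t]) (simp add: \<gamma>(2))
      moreover have "isCont \<gamma> t" using cont t by (simp add: continuous_on_eq_continuous_at)
      ultimately have "((\<lambda>s. snd d (\<gamma> s)) has_vector_derivative
          frechet_derivative (\<lambda>v. snd d (chart_inv c v)) (at (snd c (\<gamma> t)) within chart_image c) (F (\<gamma> t) c)) (at t)"
        using curve_chain[where \<gamma>=\<gamma> and h="snd d", OF c' germ_chart[OF d]] by blast
      then show "((\<lambda>s. snd d (\<gamma> s)) has_vector_derivative F (\<gamma> t) d) (at t)"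
        by (simp only: F_transform[OF c' d])
    qed (simp_all add: is_interval_connected_1 connected_ball)
    moreover have "\<gamma> 0 = x" using x' c by (simp add: \<gamma>_def y(1))
    moreover have "snd c (\<gamma> t) = \<Phi> (snd c x, t)" if t: "t \<in> ball 0 \<epsilon>" for t
    proof -
      have st: "s * (t / \<epsilon>) \<in> unit_time" if "s \<in> unit_time" for s
        using that scale(1)[OF t] mult_mono[of "\<bar>s\<bar>" 1 "\<bar>t / \<epsilon>\<bar>" 1] by (simp add: abs_unit_time abs_mult)
      have "\<Phi> (snd c x, t) = y (1 * (t / \<epsilon>))"
      \<comment> \<open>The solution y runs with speed factor \<epsilon>; slowed down by t /
        \<epsilon> it solves the equation with factor t and reaches the required point at time
        1.\<close>
      proof (rule \<Phi>(2)[OF x'(2) t, of "\<lambda>s. y (s * (t / \<epsilon>))"])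
        fix s assume s: "s \<in> unit_time"
        show "y (s * (t / \<epsilon>)) \<in> cball ?u0 R" using y(2)[OF st[OF s]] by blast
        have "((\<lambda>s. s * (t / \<epsilon>)) has_vector_derivative t / \<epsilon>) (at s within unit_time)"
          unfolding has_real_derivative_iff_has_vector_derivative[symmetric]
          using \<epsilon>(1) by (auto intro!: derivative_eq_intros)
        moreover have "(y has_vector_derivative \<epsilon> *\<^sub>R G (y (s * (t / \<epsilon>))))
            (at (s * (t / \<epsilon>)) within (\<lambda>s. s * (t / \<epsilon>)) ` unit_time)"
          by (rule has_vector_derivative_within_subset[OF y(3)[OF st[OF s]]]) (use st in auto)
        ultimately have "((\<lambda>s. y (s * (t / \<epsilon>))) has_vector_derivative (t / \<epsilon>) *\<^sub>R \<epsilon> *\<^sub>R G (y (s * (t / \<epsilon>))))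
            (at s within unit_time)"
          using vector_diff_chain_within by (fastforce simp: comp_def)
        then show "((\<lambda>s. y (s * (t / \<epsilon>))) has_vector_derivative t *\<^sub>R G (y (s * (t / \<epsilon>)))) (at s within unit_time)"
          using \<epsilon>(1) by simp
      qed (simp add: y(1))
      then show ?thesis using \<gamma>(2)[OF t] by simp
    qed
    ultimately show ?thesis using \<gamma>(1) x'(2) by blast
  qed
  have "flow_box c \<epsilon> N ?Q \<Phi>"
    unfolding flow_box_def using c \<epsilon>(1) N \<Phi>(1) box by (auto intro: open_Times)
  then show ?thesis using N(2) by blast
qed

subsection \<open>Maximal trajectories\<close>

abbreviation D where "D \<equiv> trajectory_interval A F"
abbreviation flow where "flow \<equiv> local_flow A F"

text \<open>All trajectories through x are glued: by uniqueness they agree wherever two are defined,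
  so the choice in \<open>\<gamma>\<close> is immaterial. Their domains are intervals containing 0,
  which makes the union an interval, and a flow box shows that there is at least one.\<close>

lemma ex_union_trajectory:
  obtains \<gamma> where "integral_trajectory A F x (\<Union>{J. \<exists>\<delta>. integral_trajectory A F x J \<delta>}) \<gamma>"
    and "\<And>J \<delta> t. integral_trajectory A F x J \<delta> \<Longrightarrow> t \<in> J \<Longrightarrow> \<gamma> t = \<delta> t"
proof -
  define \<gamma> where "\<gamma> t = (SOME v. \<exists>J \<delta>. integral_trajectory A F x J \<delta> \<and> t \<in> J \<and> \<delta> t = v)" for t
  have \<gamma>: "\<gamma> t = \<delta> t" if \<delta>: "integral_trajectory A F x J \<delta>" "t \<in> J" for J \<delta> t
  proof -
    have "\<exists>v J \<delta>. integral_trajectory A F x J \<delta> \<and> t \<in> J \<and> \<delta> t = v" using \<delta> by blast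
    from someI_ex[OF this] obtain J' \<delta>' where "integral_trajectory A F x J' \<delta>'" "t \<in> J'" "\<delta>' t = \<gamma> t"
      unfolding \<gamma>_def by blast
    then show ?thesis
      using trajectory_unique[of J' \<delta>' J \<delta> 0 t] \<delta> by (simp add: integral_trajectory_iff)
  qed
  obtain c \<epsilon> N Q \<Phi> where "x \<in> N" "flow_box c \<epsilon> N Q \<Phi>" using ex_flow_box by blast
  then obtain \<eta> where \<eta>0: "trajectory (ball 0 \<epsilon>) \<eta>" "\<eta> 0 = x" "0 < \<epsilon>"
    unfolding flow_box_def by blast
  let ?U = "\<Union>{J. \<exists>\<delta>. integral_trajectory A F x J \<delta>}"
  from \<eta>0 have \<eta>: "integral_trajectory A F x (ball 0 \<epsilon>) \<eta>" by (simp add: integral_trajectory_iff)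
  then have U0: "0 \<in> ?U" using \<open>0 < \<epsilon>\<close> centre_in_ball by blast
  have tr_U: "trajectory ?U \<gamma>"
    unfolding trajectory_def
  proof (intro conjI ballI)
    show "open ?U" by (rule open_Union) (auto simp: integral_trajectory_iff trajectory_def)
    have "connected ?U"
      by (rule connected_Union) (auto simp: integral_trajectory_iff trajectory_def is_interval_connected)
    then show "is_interval ?U" by (simp add: is_interval_connected_1)
    have local: "isCont \<gamma> t \<and> (\<forall>c\<in>charts_at A (\<gamma> t).
        ((\<lambda>s. snd c (\<gamma> s)) has_vector_derivative F (\<gamma> t) c) (at t))" if "t \<in> ?U" for t
    proof -
      obtain J \<delta> where \<delta>: "integral_trajectory A F x J \<delta>" "t \<in> J" using \<open>t \<in> ?U\<close> by blast
      then have tr: "trajectory J \<delta>" "open J" by (auto simp: integral_trajectory_iff trajectory_def)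
      have "\<forall>\<^sub>F s in nhds t. \<delta> s = \<gamma> s"
        using eventually_nhds_in_open[OF tr(2) \<delta>(2)] by eventually_elim (simp add: \<gamma>[OF \<delta>(1)])
      then have "isCont \<gamma> t" using trajectory_isCont[OF tr(1) \<delta>(2)] isCont_cong by blast
      moreover have "((\<lambda>s. snd c (\<gamma> s)) has_vector_derivative F (\<gamma> t) c) (at t)"
        if c: "c \<in> charts_at A (\<gamma> t)" for c
        using trajectory_derivative[OF tr(1) \<delta>(2), of c] c \<gamma>[OF \<delta>]
        by (auto intro!: has_vector_derivative_transform_within_open[OF _ tr(2) \<delta>(2), of "\<lambda>s. snd c (\<delta> s)"]
            simp: \<gamma>[OF \<delta>(1)])
      ultimately show ?thesis by blast
    qed
    show "continuous_on ?U \<gamma>" using local by (simp add: continuous_at_imp_continuous_on)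
    show "((\<lambda>s. snd c (\<gamma> s)) has_vector_derivative F (\<gamma> t) c) (at t)"
      if "t \<in> ?U" "c \<in> charts_at A (\<gamma> t)" for t c
      using local that by blast
  qed
  have "\<gamma> 0 = x" using \<gamma>[OF \<eta>, of 0] \<eta>0 by simp
  with tr_U U0 have U: "integral_trajectory A F x ?U \<gamma>"
    using integral_trajectory_iff[of x ?U \<gamma>] by blast
  show ?thesis by (rule that[of \<gamma>]) (use U \<gamma> in blast)+
qed

text \<open>A maximal trajectory extends to the glued one and so already has its domain. This makes
  the definite description in \<open>trajectory_interval\<close> well defined.\<close>

lemma maximal_trajectory_iff:
  "maximal_trajectory A F x I \<gamma> \<longleftrightarrow> integral_trajectory A F x I \<gamma> \<and>
     I = \<Union>{J. \<exists>\<delta>. integral_trajectory A F x J \<delta>}" (is "_ \<longleftrightarrow> _ \<and> I = ?U")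
proof
  obtain \<eta> where \<eta>: "integral_trajectory A F x ?U \<eta>"
    "\<And>J \<delta> t. integral_trajectory A F x J \<delta> \<Longrightarrow> t \<in> J \<Longrightarrow> \<eta> t = \<delta> t"
    using ex_union_trajectory by blast
  assume I: "maximal_trajectory A F x I \<gamma>"
  then have \<gamma>: "integral_trajectory A F x I \<gamma>" by (simp add: maximal_trajectory_def)
  then have "I \<subseteq> ?U" "\<forall>t\<in>I. \<eta> t = \<gamma> t" using \<eta>(2) by blast+
  then have "?U = I" using I \<eta>(1) unfolding maximal_trajectory_def by blast
  then show "integral_trajectory A F x I \<gamma> \<and> I = ?U" using \<gamma> by simp
next
  assume "integral_trajectory A F x I \<gamma> \<and> I = ?U"
  then show "maximal_trajectory A F x I \<gamma>" unfolding maximal_trajectory_def by blast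
qed

lemma ex_maximal_trajectory:
  "\<exists>\<gamma>. maximal_trajectory A F x (\<Union>{J. \<exists>\<delta>. integral_trajectory A F x J \<delta>}) \<gamma>"
proof (rule ex_union_trajectory[of x])
  fix \<gamma> assume "integral_trajectory A F x (\<Union>{J. \<exists>\<delta>. integral_trajectory A F x J \<delta>}) \<gamma>"
  then show ?thesis
    by (intro exI[of _ \<gamma>] maximal_trajectory_iff[THEN iffD2] conjI refl)
qed

lemma trajectory_interval_eq: "D x = \<Union>{J. \<exists>\<delta>. integral_trajectory A F x J \<delta>}"
  unfolding trajectory_interval_def
proof (rule the_equality[where P="\<lambda>I. \<exists>\<gamma>. maximal_trajectory A F x I \<gamma>", OF ex_maximal_trajectory])
  fix I assume "\<exists>\<gamma>. maximal_trajectory A F x I \<gamma>"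
  then obtain \<gamma> where "maximal_trajectory A F x I \<gamma>" ..
  then show "I = \<Union>{J. \<exists>\<delta>. integral_trajectory A F x J \<delta>}"
    by (rule maximal_trajectory_iff[THEN iffD1, THEN conjunct2])
qed

lemma flow_trajectory: "integral_trajectory A F x (D x) (flow x)"
proof -
  have "\<exists>\<gamma>. maximal_trajectory A F x (D x) \<gamma>"
    unfolding trajectory_interval_eq by (rule ex_maximal_trajectory)
  then have "maximal_trajectory A F x (D x) (flow x)"
    unfolding local_flow_def by (rule someI_ex)
  then show ?thesis by (rule maximal_trajectory_iff[THEN iffD1, THEN conjunct1])
qed

lemma trajectory_flow: "trajectory (D x) (flow x)"
  and zero_D [simp]: "0 \<in> D x" and flow_0 [simp]: "flow x 0 = x"
  using flow_trajectory[of x] unfolding integral_trajectory_iff by simp_all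

lemma open_D: "open (D x)"
  using trajectory_flow[of x] unfolding trajectory_def by simp

lemma flow_eqI:
  assumes "trajectory I \<gamma>" "0 \<in> I" "\<gamma> 0 = x" "t \<in> I"
  shows "t \<in> D x" "flow x t = \<gamma> t"
proof -
  have "integral_trajectory A F x I \<gamma>" using assms by (simp add: integral_trajectory_iff)
  then show D: "t \<in> D x" unfolding trajectory_interval_eq using assms(4) by blast
  show "flow x t = \<gamma> t"
    by (rule trajectory_unique[OF trajectory_flow assms(1) _ assms(2) _ D assms(4)]) (use assms in auto)
qed

lemma flow_add_D: "t \<in> D x \<Longrightarrow> t + s \<in> D x \<Longrightarrow> s \<in> D (flow x t)"
  and flow_add: "t \<in> D x \<Longrightarrow> t + s \<in> D x \<Longrightarrow> flow (flow x t) s = flow x (t + s)"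
  using flow_eqI[OF trajectory_shift[OF trajectory_flow[of x], of t], of "flow x t" s]
  by (simp_all add: add.commute)

text \<open>For the direction from left to right one returns from \<open>flow x t\<close> to x by
  the time -t and applies \<open>flow_add_D\<close> from \<open>flow x t\<close> with total time
  s.\<close>

lemma D_flow_iff:
  assumes t: "t \<in> D x" shows "s \<in> D (flow x t) \<longleftrightarrow> t + s \<in> D x"
proof
  assume s: "s \<in> D (flow x t)"
  have m: "- t \<in> D (flow x t)" "flow (flow x t) (- t) = x"
    using flow_add_D[OF t, of "- t"] flow_add[OF t, of "- t"] by simp_all
  show "t + s \<in> D x" using flow_add_D[OF m(1), of "t + s"] s m(2) by simp
qed (rule flow_add_D[OF t])

lemma flow_minus:
  assumes "t \<in> D x" shows "- t \<in> D (flow x t)" "flow (flow x t) (- t) = x"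
  using flow_add_D[OF assms, of "- t"] flow_add[OF assms, of "- t"] by simp_all

subsection \<open>Smoothness of the flow\<close>

lemma flow_box_D:
  assumes "flow_box c \<epsilon> N Q \<Phi>" "x \<in> N" "\<bar>t\<bar> < \<epsilon>"
  shows "t \<in> D x" "(snd c x, t) \<in> Q" "flow x t \<in> fst c" "snd c (flow x t) = \<Phi> (snd c x, t)"
proof -
  obtain \<gamma> where \<gamma>: "trajectory (ball 0 \<epsilon>) \<gamma>" "\<gamma> 0 = x"
    "\<forall>t\<in>ball 0 \<epsilon>. (snd c x, t) \<in> Q \<and> \<gamma> t \<in> fst c \<and> snd c (\<gamma> t) = \<Phi> (snd c x, t)"
    using assms(1,2) unfolding flow_box_def by blast
  have t: "t \<in> ball 0 \<epsilon>" "0 \<in> ball 0 \<epsilon>" using assms(1,3) by (auto simp: flow_box_def)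
  note f = flow_eqI[OF \<gamma>(1) t(2) \<gamma>(2) t(1)]
  show "t \<in> D x" "(snd c x, t) \<in> Q" "flow x t \<in> fst c" "snd c (flow x t) = \<Phi> (snd c x, t)"
    using f \<gamma>(3) t(1) by auto
qed

text \<open>Starting point and time both vary with x, which covers two later uses: advancing a
  smooth time-s map by a fixed short time, and adding a small variable time. In the chart the map is
  \<open>\<Phi>\<close> after a smooth pair.\<close>

lemma map_germ_flow_box:
  assumes box: "flow_box c \<epsilon> N Q \<Phi>" and h: "map_germ p h" and b: "germ p b"
    and hp: "h p \<in> N" and bp: "\<bar>b p\<bar> < \<epsilon>"
  shows "\<forall>\<^sub>F x in nhds p. b x \<in> D (h x)" "map_germ p (\<lambda>x. flow (h x) (b x))"
proof -
  have c: "c \<in> A" "N \<subseteq> fst c" "open N" "open Q" and \<Phi>: "\<And>k. C_k_on k Q \<Phi>"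
    using box by (auto simp: flow_box_def)
  have ev1: "\<forall>\<^sub>F x in nhds p. h x \<in> N"
    by (rule topological_tendstoD[OF map_germ_tendsto[OF h] c(3) hp])
  have "\<forall>\<^sub>F x in nhds p. b x \<in> ball 0 \<epsilon>"
    by (rule topological_tendstoD[OF germ_tendsto[OF b]]) (use bp in auto)
  with ev1 have ev: "\<forall>\<^sub>F x in nhds p. h x \<in> N \<and> \<bar>b x\<bar> < \<epsilon>" by eventually_elim simp
  show "\<forall>\<^sub>F x in nhds p. b x \<in> D (h x)"
    by (rule eventually_mono[OF ev]) (use flow_box_D[OF box] in blast)
  show "map_germ p (\<lambda>x. flow (h x) (b x))"
  proof (rule map_germ_chartI[where d=c])
    show "c \<in> charts_at A (flow (h p) (b p))" using flow_box_D(3)[OF box hp bp] c(1) by simp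
    show "\<forall>\<^sub>F x in nhds p. flow (h x) (b x) \<in> fst c"
      by (rule eventually_mono[OF ev]) (use flow_box_D[OF box] in blast)
    have "germ p (\<lambda>x. snd c (h x))" by (rule map_germ_chart[OF h]) (use c hp in auto)
    then have pair: "germ p (\<lambda>x. (snd c (h x), b x))" using b by (rule germ_Pair)
    have "smooth_germ UNIV (snd c (h p), b p) \<Phi>"
      by (rule smooth_germ_open[OF c(4) flow_box_D(2)[OF box hp bp] \<Phi>])
    from germ_compose[OF pair this] have "germ p (\<lambda>x. \<Phi> (snd c (h x), b x))" by simp
    then show "germ p (\<lambda>x. snd c (flow (h x) (b x)))"
      by (rule germ_cong) (rule eventually_mono[OF ev], use flow_box_D(4)[OF box] in simp)
  qed
qed

text \<open>P t holds at t = 0 and is locally constant along the trajectory of p: a flow box around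
  \<open>flow p s\<close> turns the time-s map into the time-r map for r near s, by the group law.
  Connectedness of \<open>D p\<close> then reaches every time.\<close>

lemma map_germ_flow_time:
  assumes t: "t \<in> D p"
  shows "(\<forall>\<^sub>F x in nhds p. t \<in> D x) \<and> map_germ p (\<lambda>x. flow x t)"
proof -
  define P where "P t \<longleftrightarrow> (\<forall>\<^sub>F x in nhds p. t \<in> D x) \<and> map_germ p (\<lambda>x. flow x t)" for t
  have step: "P r" if box: "flow_box c \<epsilon> N Q \<Phi>" and s: "P s" "flow p s \<in> N" and r: "\<bar>r - s\<bar> < \<epsilon>"
    for c \<epsilon> N Q \<Phi> r s
  proof -
    have h: "map_germ p (\<lambda>x. flow x s)" using s(1) by (simp add: P_def)
    note m = map_germ_flow_box[OF box h germ_const s(2) r]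
    have "\<forall>\<^sub>F x in nhds p. s \<in> D x" using s(1) by (simp add: P_def)
    with m(1) have ev: "\<forall>\<^sub>F x in nhds p. r \<in> D x \<and> flow (flow x s) (r - s) = flow x r"
    proof eventually_elim
      case (elim x)
      then have "r \<in> D x" using D_flow_iff[of s x "r - s"] by simp
      then show ?case using flow_add[of s x "r - s"] elim by simp
    qed
    have "map_germ p (\<lambda>x. flow x r)"
      by (rule map_germ_cong[OF m(2)]) (rule eventually_mono[OF ev], simp)
    moreover have "\<forall>\<^sub>F x in nhds p. r \<in> D x" using ev by (rule eventually_mono) simp
    ultimately show ?thesis by (simp add: P_def)
  qed
  have "P 0 = P t"
  proof (rule connected_local_const[where f=P])
    show "connected (D p)"
      using trajectory_flow[of p] by (simp add: trajectory_def is_interval_connected)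
    show "\<forall>s\<in>D p. \<forall>\<^sub>F r in at s within D p. P s = P r"
    proof
      fix s assume s: "s \<in> D p"
      obtain c \<epsilon> N Q \<Phi> where box: "flow p s \<in> N" "flow_box c \<epsilon> N Q \<Phi>" using ex_flow_box by blast
      have \<epsilon>: "0 < \<epsilon>" "open N" using box(2) by (auto simp: flow_box_def)
      have "isCont (flow p) s" by (rule trajectory_isCont[OF trajectory_flow s])
      then have "\<forall>\<^sub>F r in at s within D p. flow p r \<in> N"
        using \<epsilon>(2) box(1) at_within_open[OF s open_D] by (simp add: isCont_def topological_tendstoD)
      moreover have "\<forall>\<^sub>F r in at s within D p. dist r s < \<epsilon>"
        using \<epsilon>(1) eventually_at by blast
      \<comment> \<open>Both \<open>flow p s\<close> and \<open>flow p r\<close> lie in N, so the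
        step can be made from s to r and from r to s, which gives the equivalence of P s and P
        r.\<close>
      ultimately show "\<forall>\<^sub>F r in at s within D p. P s = P r"
      proof eventually_elim
        case (elim r)
        then show ?case
          using step[OF box(2), of s r] step[OF box(2), of r s] box(1)
          by (auto simp: dist_norm abs_minus_commute)
      qed
    qed
  qed (use t in auto)
  moreover have "P 0" by (simp add: P_def map_germ_id)
  ultimately show ?thesis by (simp add: P_def)
qed

text \<open>The time is split as \<beta> p plus \<beta> x - \<beta> p. The fixed part is smooth by
  \<open>map_germ_flow_time\<close>; the variable part vanishes at p, so a single flow box around
  the image of p handles it.\<close>

lemma map_germ_shift:
  assumes b: "germ p \<beta>" and p: "\<beta> p \<in> D p"
  shows "map_germ p (\<lambda>x. flow x (\<beta> x))"
proof -
  let ?T = "\<beta> p"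
  have T: "\<forall>\<^sub>F x in nhds p. ?T \<in> D x" "map_germ p (\<lambda>x. flow x ?T)"
    using map_germ_flow_time[OF p] by auto
  obtain c \<epsilon> N Q \<Phi> where box: "flow p ?T \<in> N" "flow_box c \<epsilon> N Q \<Phi>" using ex_flow_box by blast
  have \<epsilon>: "0 < \<epsilon>" using box(2) by (auto simp: flow_box_def)
  have g: "germ p (\<lambda>x. \<beta> x - ?T)" by (intro germ_diff b germ_const)
  have "\<bar>\<beta> p - ?T\<bar> < \<epsilon>" using \<epsilon> by simp
  note m = map_germ_flow_box[OF box(2) T(2) g box(1) this]
  have "\<forall>\<^sub>F x in nhds p. flow (flow x ?T) (\<beta> x - ?T) = flow x (\<beta> x)"
    using T(1) m(1)
  proof eventually_elim
    case (elim x)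
    then have "\<beta> x \<in> D x" using D_flow_iff[of ?T x "\<beta> x - ?T"] by simp
    then show ?case using flow_add[of ?T x "\<beta> x - ?T"] elim by simp
  qed
  then show ?thesis by (rule map_germ_cong[OF m(2)])
qed

end


section \<open>Push-forwards along shift maps\<close>

context flow_field
begin

lemma some_chart: "(SOME c. c \<in> charts_at A p) \<in> charts_at A p"
  using someI_ex[OF ex_chart] .

lemma flow_tendsto_0: "(flow p \<longlongrightarrow> p) (nhds 0)"
  using trajectory_isCont[OF trajectory_flow[of p] zero_D] tendsto_at_iff_tendsto_nhds[of "flow p" 0]
  by (simp add: isCont_def)

lemma derivative_along_trajectory:
  assumes \<gamma>: "trajectory I \<gamma>" "t \<in> I" and \<alpha>: "germ (\<gamma> t) \<alpha>"
  shows "((\<lambda>s. \<alpha> (\<gamma> s)) has_vector_derivative derivative_along A F \<alpha> (\<gamma> t)) (at t)"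
  unfolding derivative_along_def Let_def comp_def
  using curve_chain[where h=\<alpha>, OF some_chart \<alpha> trajectory_isCont[OF \<gamma>]
      trajectory_derivative[OF \<gamma> some_chart]] .

lemma tangent_map_curve:
  assumes f: "map_germ (\<gamma> t) f" and \<gamma>: "trajectory I \<gamma>" "t \<in> I" and d: "d \<in> charts_at A (f (\<gamma> t))"
  shows "((\<lambda>s. snd d (f (\<gamma> s))) has_vector_derivative tangent_map A f (\<gamma> t) (F (\<gamma> t)) d) (at t)"
proof -
  let ?c = "SOME c. c \<in> charts_at A (\<gamma> t)"
  have "tangent_map A f (\<gamma> t) (F (\<gamma> t)) d = frechet_derivative (\<lambda>v. snd d (f (chart_inv ?c v)))
      (at (snd ?c (\<gamma> t)) within chart_image ?c) (F (\<gamma> t) ?c)"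
    unfolding tangent_map_def Let_def comp_def using d by (simp only: if_True)
  then show ?thesis
    using curve_chain[where h="\<lambda>x. snd d (f x)", OF some_chart map_germ_chart[OF f d]
        trajectory_isCont[OF \<gamma>] trajectory_derivative[OF \<gamma> some_chart]] by (simp only:)
qed

lemma tangent_map_shift:
  assumes ev: "\<forall>\<^sub>F x in nhds p. \<alpha> x \<in> D x \<and> f x = flow x (\<alpha> x)"
    and \<alpha>: "germ p \<alpha>" and f: "map_germ p f"
  shows "tangent_map A f p (F p) d = (1 + derivative_along A F \<alpha> p) *\<^sub>R F (f p) d"
proof (cases "d \<in> charts_at A (f p)")
  case False
  \<comment> \<open>On charts that do not contain f p both sides are 0 by the convention for tangent
    vectors.\<close>
  have "F (f p) \<in> tangent_space V A (f p)" using smooth_F by (simp add: smooth_vector_field_def)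
  then have "F (f p) d = 0" using False unfolding tangent_space_def by blast
  then show ?thesis using False unfolding tangent_map_def Let_def by (simp only: if_False scaleR_zero_right)
next
  case True
  have p: "\<alpha> p \<in> D p" "f p = flow p (\<alpha> p)" using eventually_nhds_x_imp_x[OF ev] by auto
  note lim = flow_tendsto_0[of p]
  have "\<forall>\<^sub>F s in nhds 0. s \<in> D p" by (rule eventually_nhds_in_open[OF open_D zero_D])
  with eventually_compose_filterlim[OF ev lim]
  \<comment> \<open>Shifting the point \<open>flow p s\<close> by its own time amounts to moving p
    by the sum of both times; the domain condition at \<open>flow p s\<close> translates into one at
    p by \<open>D_flow_iff\<close>.\<close>
  have ev0: "\<forall>\<^sub>F s in nhds 0. f (flow p s) = flow p (s + \<alpha> (flow p s))"
  proof eventually_elim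
    case (elim s)
    then have "s + \<alpha> (flow p s) \<in> D p" using D_flow_iff by blast
    then show ?case using elim flow_add by simp
  qed
  have "((\<lambda>s. \<alpha> (flow p s)) has_vector_derivative derivative_along A F \<alpha> p) (at 0)"
    using derivative_along_trajectory[OF trajectory_flow zero_D, of p \<alpha>] \<alpha> by simp
  then have "((\<lambda>s. s + \<alpha> (flow p s)) has_vector_derivative 1 + derivative_along A F \<alpha> p) (at 0)"
    by (intro has_vector_derivative_add has_vector_derivative_id)
  moreover have "((\<lambda>r. snd d (flow p r)) has_vector_derivative F (f p) d) (at (0 + \<alpha> (flow p 0)))"
    using trajectory_derivative[OF trajectory_flow p(1), of d] True p(2) by simp
  ultimately have shifted: "(((\<lambda>r. snd d (flow p r)) \<circ> (\<lambda>s. s + \<alpha> (flow p s))) has_vector_derivative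
      (1 + derivative_along A F \<alpha> p) *\<^sub>R F (f p) d) (at 0)"
    by (rule vector_diff_chain_at)
  obtain S where S: "open S" "0 \<in> S" "\<forall>s\<in>S. f (flow p s) = flow p (s + \<alpha> (flow p s))"
    using ev0 unfolding eventually_nhds by blast
  have "((\<lambda>s. snd d (f (flow p s))) has_vector_derivative
      (1 + derivative_along A F \<alpha> p) *\<^sub>R F (f p) d) (at 0)"
    by (rule has_vector_derivative_transform_within_open[OF shifted S(1,2)]) (simp add: S(3))
  moreover have "((\<lambda>s. snd d (f (flow p s))) has_vector_derivative tangent_map A f p (F p) d) (at 0)"
    using tangent_map_curve[where \<gamma>="flow p" and t=0, OF _ trajectory_flow zero_D, of f d] f True by simp
  ultimately show ?thesis using vector_derivative_unique_at by blast
qed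

text \<open>\<open>derivative_along\<close> picks a chart anew at each point, so its smoothness is
  not visible from the definition. In one fixed chart it equals the derivative of an extension a of
  \<alpha> in the direction G, a sum of products of smooth functions.\<close>

lemma germ_derivative_along:
  assumes ev: "\<forall>\<^sub>F x in nhds p. germ x \<alpha>"
  shows "germ p (derivative_along A F \<alpha>)"
proof -
  obtain c where c: "c \<in> charts_at A p" using ex_chart by blast
  have "smooth_germ (chart_image c) (snd c p) (\<lambda>v. \<alpha> (chart_inv c v))"
    using germD[OF eventually_nhds_x_imp_x[OF ev] c] .
  moreover have "smooth_on (chart_image c) (\<lambda>u. F (chart_inv c u) c)"
    using smooth_F c by (simp add: smooth_vector_field_def)
  then have "smooth_germ (chart_image c) (snd c p) (\<lambda>u. F (chart_inv c u) c)"
    using c by (simp add: smooth_on_iff_germ)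
  ultimately obtain W a G where W: "open W" "snd c p \<in> W" "\<And>k. C_k_on k W a" "\<And>k. C_k_on k W G"
    "\<And>v. v \<in> chart_image c \<inter> W \<Longrightarrow> a v = \<alpha> (chart_inv c v)"
    "\<And>v. v \<in> chart_image c \<inter> W \<Longrightarrow> G v = F (chart_inv c v) c"
    by (rule smooth_germ_common) blast
  define a' where "a' v = frechet_derivative a (at v)" for v
  have a': "(a has_derivative a' v) (at v)" if "v \<in> W" for v
    using W(3)[of 1] that by (simp add: a'_def frechet_derivative_works)
  have smooth: "C_k_on k W (\<lambda>v. \<Sum>b\<in>Basis. (G v \<bullet> b) *\<^sub>R a' v b)" for k
    unfolding C_k_on_iff_param
  proof (intro C_k_param_sum C_k_param_scaleR W(1))
    fix b
    show "C_k_param k W (\<lambda>v s. G v \<bullet> b)"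
      by (intro C_k_param_bounded_linear[OF bounded_linear_inner_left W(1)] C_k_param_passive W(4))
    show "C_k_param k W (\<lambda>v s. a' v b)"
      by (rule C_k_param_passive) (use W(3)[of "Suc k"] in \<open>simp add: a'_def\<close>)
  qed
  \<comment> \<open>Both sides are the derivative at time 0 of \<alpha> along the trajectory of q,
    whichever chart was picked at q.\<close>
  have eq: "derivative_along A F \<alpha> q = a' (snd c q) (F q c)"
    if q: "q \<in> fst c" "snd c q \<in> W" "germ q \<alpha>" for q
  proof -
    have cq: "c \<in> charts_at A q" using c q(1) by simp
    note lim = flow_tendsto_0[of q]
    have "\<forall>\<^sub>F s in nhds 0. flow q s \<in> fst c"
      using eventually_compose_filterlim[OF eventually_in_chart[OF cq] lim] .
    moreover have "\<forall>\<^sub>F s in nhds 0. snd c (flow q s) \<in> W"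
      by (rule topological_tendstoD[OF filterlim_compose[OF chart_tendsto[OF cq] lim] W(1) q(2)])
    ultimately have "\<forall>\<^sub>F s in nhds 0. a (snd c (flow q s)) = \<alpha> (flow q s)"
      by eventually_elim (use W(5) c in simp)
    then obtain S where S: "open S" "0 \<in> S" "\<forall>s\<in>S. a (snd c (flow q s)) = \<alpha> (flow q s)"
      unfolding eventually_nhds by blast
    have "((\<lambda>s. snd c (flow q s)) has_derivative (\<lambda>h. h *\<^sub>R F q c)) (at 0)"
      using trajectory_derivative[OF trajectory_flow zero_D, of c q] cq
      by (simp add: has_vector_derivative_def)
    moreover have "(a has_derivative a' (snd c q)) (at (snd c (flow q 0)))" using a' q(2) by simp
    ultimately have "((\<lambda>s. a (snd c (flow q s))) has_derivative (\<lambda>h. a' (snd c q) (h *\<^sub>R F q c))) (at 0)"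
      by (rule has_derivative_compose)
    then have "((\<lambda>s. a (snd c (flow q s))) has_vector_derivative a' (snd c q) (F q c)) (at 0)"
      unfolding has_vector_derivative_def
      by (simp add: linear_cmul[OF has_derivative_linear[OF a'[OF q(2)]]])
    then have "((\<lambda>s. \<alpha> (flow q s)) has_vector_derivative a' (snd c q) (F q c)) (at 0)"
      by (rule has_vector_derivative_transform_within_open[OF _ S(1,2)]) (use S(3) in simp)
    moreover have "((\<lambda>s. \<alpha> (flow q s)) has_vector_derivative derivative_along A F \<alpha> q) (at 0)"
      using derivative_along_trajectory[OF trajectory_flow zero_D, of q \<alpha>] q(3) by simp
    ultimately show ?thesis using vector_derivative_unique_at by blast
  qed
  have "smooth_germ (chart_image c) (snd c p) (\<lambda>v. \<Sum>b\<in>Basis. (G v \<bullet> b) *\<^sub>R a' v b)"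
    by (rule smooth_germ_open[OF W(1,2) smooth])
  then show ?thesis
  proof (intro germ_chartI[OF c], elim smooth_germ_cong)
    have "\<forall>\<^sub>F v in nhds (snd c p). v \<in> W" by (rule eventually_nhds_in_open[OF W(1,2)])
    with iffD1[OF eventually_chart[OF c] ev]
    show "\<forall>\<^sub>F v in nhds (snd c p). v \<in> chart_image c \<longrightarrow> v \<in> chart_image c \<and>
        (\<Sum>b\<in>Basis. (G v \<bullet> b) *\<^sub>R a' v b) = derivative_along A F \<alpha> (chart_inv c v)"
    proof eventually_elim
      case (elim v)
      show ?case
      proof (intro impI conjI)
        assume v: "v \<in> chart_image c"
        have "(\<Sum>b\<in>Basis. (G v \<bullet> b) *\<^sub>R a' v b) = a' v (G v)"
          by (rule has_derivative_Basis_sum[OF a', symmetric]) (use elim in simp)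
        then show "(\<Sum>b\<in>Basis. (G v \<bullet> b) *\<^sub>R a' v b) = derivative_along A F \<alpha> (chart_inv c v)"
          using eq[of "chart_inv c v"] W(6)[of v] elim v by simp
      qed
    qed
  qed
qed

text \<open>\<open>tangent_map_shift\<close> works at the source point g y. Continuity of g keeps g
  y in the common domain N for y near f z, and f (g y) = y brings the field back to y. Smoothness of
  \<mu> comes from composing that of F(\<alpha>) with g.\<close>

lemma pushforward_shift_germ:
  assumes \<alpha>: "smooth_function_germ A z \<alpha>"
    and f: "\<forall>\<^sub>F x in nhds z. (x, \<alpha> x) \<in> flow_domain A F \<and> f x = flow x (\<alpha> x)"
    and g: "diffeomorphism_germ A z f g"
  defines "\<mu> \<equiv> \<lambda>y. 1 + derivative_along A F \<alpha> (g y)"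
  shows "\<forall>\<^sub>F y in nhds (f z). pushforward A f g F y = scale_field \<mu> F y"
    and "smooth_function_germ A (f z) \<mu>"
proof -
  obtain W where W: "open W" "z \<in> W" "open (f ` W)" "\<forall>x\<in>W. g (f x) = x"
    "smooth_map_on A W f" "smooth_map_on A (f ` W) g"
    using g unfolding diffeomorphism_germ_def by blast
  obtain W' where W': "open W'" "z \<in> W'" "smooth_function_on A W' \<alpha>"
    using \<alpha> unfolding smooth_function_germ_def by blast
  obtain S where S: "open S" "z \<in> S" "\<forall>x\<in>S. (x, \<alpha> x) \<in> flow_domain A F \<and> f x = flow x (\<alpha> x)"
    using f unfolding eventually_nhds by blast
  define N where "N = W \<inter> W' \<inter> S"
  have N: "open N" "z \<in> N" using W W' S by (auto simp: N_def)
  have f_germ: "map_germ x f" if "x \<in> N" for x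
    using W(5) smooth_map_on_iff_germ[OF W(1)] that by (simp add: N_def)
  have \<alpha>_germ: "germ x \<alpha>" if "x \<in> N" for x
    using W'(3) smooth_function_on_iff_germ[OF W'(1)] that by (simp add: N_def)
  have g_germ: "map_germ y g" if "y \<in> f ` W" for y
    using iffD1[OF smooth_map_on_iff_germ[OF W(3)] W(6)] that by (rule bspec)
  have fz: "f z \<in> f ` W" "g (f z) = z" using W by auto
  have "\<forall>\<^sub>F y in nhds (f z). g y \<in> N"
    by (rule topological_tendstoD[OF map_germ_tendsto[OF g_germ[OF fz(1)]] N(1)]) (simp add: fz N)
  moreover have "\<forall>\<^sub>F y in nhds (f z). y \<in> f ` W" by (rule eventually_nhds_in_open[OF W(3) fz(1)])
  ultimately have ev: "\<forall>\<^sub>F y in nhds (f z). g y \<in> N \<and> y \<in> f ` W" by (rule eventually_conj)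
  have N_ev: "\<forall>\<^sub>F x in nhds p. x \<in> N" if "p \<in> N" for p
    by (rule eventually_nhds_in_open[OF N(1) that])
  show "\<forall>\<^sub>F y in nhds (f z). pushforward A f g F y = scale_field \<mu> F y"
  proof (rule eventually_mono[OF ev])
    fix y assume y: "g y \<in> N \<and> y \<in> f ` W"
    then have fg: "f (g y) = y" using W(4) by auto
    have "\<forall>\<^sub>F x in nhds (g y). \<alpha> x \<in> D x \<and> f x = flow x (\<alpha> x)"
      by (rule eventually_mono[OF N_ev]) (use y S(3) in \<open>auto simp: N_def flow_domain_def\<close>)
    then have "tangent_map A f (g y) (F (g y)) d = \<mu> y *\<^sub>R F y d" for d
      using tangent_map_shift[where p="g y" and \<alpha>=\<alpha> and f=f and d=d] \<alpha>_germ f_germ y fg by (simp add: \<mu>_def)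
    then show "pushforward A f g F y = scale_field \<mu> F y"
      by (auto simp: pushforward_def scale_field_def)
  qed
  obtain T where T: "open T" "f z \<in> T" "\<forall>y\<in>T. g y \<in> N \<and> y \<in> f ` W"
    using ev unfolding eventually_nhds by blast
  have "germ y \<mu>" if y: "y \<in> T" for y
  proof -
    have gy: "g y \<in> N" "y \<in> f ` W" using T(3) y by auto
    have "germ (g y) (derivative_along A F \<alpha>)"
      by (rule germ_derivative_along, rule eventually_mono[OF N_ev[OF gy(1)]]) (rule \<alpha>_germ)
    from germ_add[OF germ_const germ_map[OF g_germ[OF gy(2)] this]]
    show ?thesis by (simp only: \<mu>_def)
  qed
  then show "smooth_function_germ A (f z) \<mu>"
    unfolding smooth_function_germ_def using T(1,2) smooth_function_on_iff_germ[OF T(1)] by blast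
qed

lemma reparametrization_germ_shift:
  assumes "smooth_function_germ A z \<alpha>"
    and "\<forall>\<^sub>F x in nhds z. (x, \<alpha> x) \<in> flow_domain A F \<and> f x = flow x (\<alpha> x)"
    and "diffeomorphism_germ A z f g"
  shows "reparametrization_germ A (f z) F (pushforward A f g F)"
  unfolding reparametrization_germ_def using pushforward_shift_germ[OF assms] by blast

end

subsection \<open>Conjugate flows\<close>

text \<open>The diffeomorphism is arbitrary here; that it is a shift matters only in
  \<open>Sh_pushforward\<close>. What is known about trajectories of \<open>G\<close> is transported
  from \<open>F\<close>.\<close>

locale conjugate_flow = flow_field V e A F
  for V :: "'e::euclidean_space set" and e :: 'e
    and A :: "('a::{t2_space, second_countable_topology}, 'e) chart set" and F +
  fixes f :: "'a \<Rightarrow> 'a"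
  assumes diffeomorphism_f: "diffeomorphism A f"
begin

abbreviation g where "g \<equiv> inv f"
abbreviation G where "G \<equiv> pushforward A f g F"

lemma g_f [simp]: "g (f x) = x" and f_g [simp]: "f (g x) = x"
  using diffeomorphism_f by (auto simp: diffeomorphism_def bij_is_inj bij_is_surj surj_f_inv_f)

lemma f_germ: "map_germ p f" and g_germ: "map_germ p g"
  using diffeomorphism_f smooth_map_on_iff_germ[of UNIV] by (auto simp: diffeomorphism_def)

lemma isCont_f: "isCont f p" and isCont_g: "isCont g p"
  using map_germ_tendsto[OF f_germ] map_germ_tendsto[OF g_germ]
  by (simp_all add: isCont_def tendsto_at_iff_tendsto_nhds)

lemma G_derivative:
  assumes "trajectory I \<gamma>" "t \<in> I" "d \<in> charts_at A (f (\<gamma> t))"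
  shows "((\<lambda>s. snd d (f (\<gamma> s))) has_vector_derivative G (f (\<gamma> t)) d) (at t)"
  using tangent_map_curve[where \<gamma>=\<gamma>, OF f_germ assms] by (simp add: pushforward_def)

lemma conjugate_trajectory:
  assumes "integral_trajectory A F x I \<gamma>"
  shows "integral_trajectory A G (f x) I (\<lambda>s. f (\<gamma> s))"
proof -
  have \<gamma>: "trajectory I \<gamma>" "0 \<in> I" "\<gamma> 0 = x" using assms unfolding integral_trajectory_iff by auto
  then have I: "open I" "is_interval I" "continuous_on I \<gamma>" unfolding trajectory_def by auto
  have "continuous_on UNIV f" using isCont_f by (simp add: continuous_at_imp_continuous_on)
  from continuous_on_compose2[OF this I(3)] have "continuous_on I (\<lambda>s. f (\<gamma> s))" by simp
  then show ?thesis
    unfolding integral_trajectory_def comp_def using I \<gamma>(2,3) G_derivative[OF \<gamma>(1)] by blast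
qed

text \<open>The velocity of g \<circ> \<delta> is a linear map \<open>?D\<close> evaluated at
  \<open>G (\<delta> t) d\<close>. It depends on the curve only through its velocity, so another
  curve through the same point with that velocity can be used to compute it.\<close>

lemma conjugate_trajectory_inv:
  assumes "integral_trajectory A G y I \<delta>"
  shows "integral_trajectory A F (g y) I (\<lambda>s. g (\<delta> s))"
proof -
  have \<delta>: "open I" "is_interval I" "0 \<in> I" "\<delta> 0 = y" "continuous_on I \<delta>"
    "\<And>t c. t \<in> I \<Longrightarrow> c \<in> charts_at A (\<delta> t) \<Longrightarrow> ((\<lambda>s. snd c (\<delta> s)) has_vector_derivative G (\<delta> t) c) (at t)"
    using assms unfolding integral_trajectory_def comp_def by blast+
  have "continuous_on UNIV g" using isCont_g by (simp add: continuous_at_imp_continuous_on)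
  from continuous_on_compose2[OF this \<delta>(5)] have cont: "continuous_on I (\<lambda>s. g (\<delta> s))" by simp
  have "((\<lambda>s. snd c (g (\<delta> s))) has_vector_derivative F (g (\<delta> t)) c) (at t)"
    if t: "t \<in> I" and c: "c \<in> charts_at A (g (\<delta> t))" for t c
  proof -
    let ?p = "g (\<delta> t)"
    obtain d where d: "d \<in> charts_at A (\<delta> t)" using ex_chart by blast
    have h: "germ (\<delta> t) (\<lambda>x. snd c (g x))" by (rule map_germ_chart[OF g_germ c])
    let ?D = "frechet_derivative (\<lambda>v. snd c (g (chart_inv d v))) (at (snd d (\<delta> t)) within chart_image d) (G (\<delta> t) d)"
    have "isCont \<delta> t" using \<delta>(1,5) t continuous_on_eq_continuous_at by blast
    from curve_chain[where \<gamma>=\<delta>, OF d h this \<delta>(6)[OF t d]]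
    have 1: "((\<lambda>s. snd c (g (\<delta> s))) has_vector_derivative ?D) (at t)" .
    \<comment> \<open>The test curve: f applied to a trajectory of F has velocity G, and g takes it
      back to that trajectory, whose velocity is F.\<close>
    let ?\<sigma> = "\<lambda>s. f (flow ?p s)"
    have \<sigma>: "isCont ?\<sigma> 0"
      by (rule isCont_o2[OF trajectory_isCont[OF trajectory_flow zero_D] isCont_f])
    have "((\<lambda>s. snd d (?\<sigma> s)) has_vector_derivative G (?\<sigma> 0) d) (at 0)"
      by (rule G_derivative[OF trajectory_flow zero_D]) (use d in simp)
    from curve_chain[where \<gamma>="?\<sigma>" and t=0 and h="\<lambda>x. snd c (g x)", OF _ _ \<sigma> this] d h
    have "((\<lambda>s. snd c (g (?\<sigma> s))) has_vector_derivative ?D) (at 0)" by simp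
    moreover have "((\<lambda>s. snd c (flow ?p s)) has_vector_derivative F ?p c) (at 0)"
      using trajectory_derivative[OF trajectory_flow zero_D, of c ?p] c by simp
    ultimately have "?D = F ?p c" using vector_derivative_unique_at by simp
    with 1 show ?thesis by simp
  qed
  then show ?thesis
    unfolding integral_trajectory_def comp_def using \<delta>(1-4) cont by blast
qed

lemma conjugate_trajectory_iff:
  "integral_trajectory A G y I \<delta> \<longleftrightarrow> integral_trajectory A F (g y) I (\<lambda>s. g (\<delta> s))"
  using conjugate_trajectory_inv conjugate_trajectory[of "g y" I "\<lambda>s. g (\<delta> s)"] by auto

lemma conjugate_maximal_trajectory_iff:
  "maximal_trajectory A G y I \<delta> \<longleftrightarrow> maximal_trajectory A F (g y) I (\<lambda>s. g (\<delta> s))"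
proof
  assume m: "maximal_trajectory A G y I \<delta>"
  show "maximal_trajectory A F (g y) I (\<lambda>s. g (\<delta> s))"
    unfolding maximal_trajectory_def
  proof (intro conjI allI impI)
    show "integral_trajectory A F (g y) I (\<lambda>s. g (\<delta> s))"
      using m conjugate_trajectory_inv unfolding maximal_trajectory_def by blast
    fix J \<eta> assume \<eta>: "integral_trajectory A F (g y) J \<eta> \<and> I \<subseteq> J \<and> (\<forall>t\<in>I. \<eta> t = g (\<delta> t))"
    then have "integral_trajectory A G y J (\<lambda>s. f (\<eta> s))" using conjugate_trajectory[of "g y" J \<eta>] by simp
    moreover have "\<forall>t\<in>I. f (\<eta> t) = \<delta> t" using \<eta> by simp
    ultimately show "J = I" using m \<eta> unfolding maximal_trajectory_def by blast
  qed
next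
  assume m: "maximal_trajectory A F (g y) I (\<lambda>s. g (\<delta> s))"
  show "maximal_trajectory A G y I \<delta>"
    unfolding maximal_trajectory_def
  proof (intro conjI allI impI)
    show "integral_trajectory A G y I \<delta>"
      using m conjugate_trajectory_iff unfolding maximal_trajectory_def by blast
    fix J \<eta> assume \<eta>: "integral_trajectory A G y J \<eta> \<and> I \<subseteq> J \<and> (\<forall>t\<in>I. \<eta> t = \<delta> t)"
    then have "integral_trajectory A F (g y) J (\<lambda>s. g (\<eta> s))" "\<forall>t\<in>I. g (\<eta> t) = g (\<delta> t)"
      using conjugate_trajectory_inv by auto
    then show "J = I" using m \<eta> unfolding maximal_trajectory_def by blast
  qed
qed

lemma conjugate_interval: "trajectory_interval A G y = D (g y)"
proof -
  have "(\<exists>\<delta>. maximal_trajectory A G y I \<delta>) \<longleftrightarrow> (\<exists>\<gamma>. maximal_trajectory A F (g y) I \<gamma>)" for I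
  proof
    assume "\<exists>\<gamma>. maximal_trajectory A F (g y) I \<gamma>"
    then obtain \<gamma> where "maximal_trajectory A F (g y) I \<gamma>" ..
    then have "maximal_trajectory A G y I (\<lambda>s. f (\<gamma> s))"
      by (simp add: conjugate_maximal_trajectory_iff)
    then show "\<exists>\<delta>. maximal_trajectory A G y I \<delta>" by (rule exI[of _ "\<lambda>s. f (\<gamma> s)"])
  qed (use conjugate_maximal_trajectory_iff in blast)
  then show ?thesis unfolding trajectory_interval_def by simp
qed

text \<open>\<open>local_flow A G y\<close> is some maximal trajectory of \<open>G\<close>,
  otherwise unspecified. Its image under g is a trajectory of \<open>F\<close> from g y, which
  uniqueness for \<open>F\<close> identifies with the flow.\<close>

lemma local_flow_conjugate:
  assumes t: "t \<in> D (g y)"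
  shows "local_flow A G y t = f (flow (g y) t)"
proof -
  have "maximal_trajectory A F (g y) (D (g y)) (flow (g y))"
    unfolding maximal_trajectory_iff using flow_trajectory trajectory_interval_eq by blast
  then have "maximal_trajectory A G y (trajectory_interval A G y) (\<lambda>s. f (flow (g y) s))"
    by (simp add: conjugate_maximal_trajectory_iff conjugate_interval)
  then have "\<exists>\<delta>. maximal_trajectory A G y (trajectory_interval A G y) \<delta>"
    by (rule exI[of _ "\<lambda>s. f (flow (g y) s)"])
  then have "maximal_trajectory A G y (trajectory_interval A G y) (local_flow A G y)"
    unfolding local_flow_def[of A G y] by (rule someI_ex)
  then have "maximal_trajectory A F (g y) (D (g y)) (\<lambda>s. g (local_flow A G y s))"
    by (simp only: conjugate_maximal_trajectory_iff conjugate_interval)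
  then have "integral_trajectory A F (g y) (D (g y)) (\<lambda>s. g (local_flow A G y s))"
    by (rule maximal_trajectory_iff[THEN iffD1, THEN conjunct1])
  then have "flow (g y) t = g (local_flow A G y t)"
    using flow_eqI(2)[of "D (g y)" "\<lambda>s. g (local_flow A G y s)" "g y" t] t
    by (simp add: integral_trajectory_iff)
  then show ?thesis by simp
qed

end

section \<open>Equality of the images of the two shift maps\<close>

lemma (in flow_field) func_iff: "\<beta> \<in> func A H \<longleftrightarrow> (\<forall>p. germ p \<beta>) \<and> (\<forall>x. \<beta> x \<in> trajectory_interval A H x)"
  by (simp add: func_def flow_domain_def smooth_function_on_iff_germ[OF open_UNIV])

lemma (in flow_field) Sh_pushforward:
  assumes \<alpha>: "\<alpha> \<in> func A F" and diff: "diffeomorphism A (shift_map A F \<alpha>)"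
  shows "Sh A (pushforward A (shift_map A F \<alpha>) (inv (shift_map A F \<alpha>)) F) = Sh A F"
proof -
  define f where "f = shift_map A F \<alpha>"
  interpret conjugate_flow V e A F f by unfold_locales (use diff in \<open>simp add: f_def\<close>)
  have f: "f x = flow x (\<alpha> x)" for x by (simp add: f_def shift_map_def)
  have \<alpha>_D: "\<alpha> x \<in> D x" and \<alpha>_germ: "germ p \<alpha>" for x p using \<alpha> by (auto simp: func_iff)
  have "Sh A G \<subseteq> Sh A F"
  proof
    fix h assume "h \<in> Sh A G"
    then obtain \<beta> where \<beta>: "\<beta> \<in> func A G" "h = shift_map A G \<beta>" by (auto simp: Sh_def)
    have \<beta>_D: "\<beta> x \<in> D (g x)" and \<beta>_germ: "germ p \<beta>" for x p
      using \<beta>(1) by (auto simp: func_iff conjugate_interval)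
    define w where "w x = flow (g x) (\<beta> x)" for x
    \<comment> \<open>From x one goes back to g x in time -\<alpha> (g x), on to w x in time \<beta>
      x, and to f (w x) = h x in time \<alpha> (w x).\<close>
    define \<tau> where "\<tau> x = \<beta> x + \<alpha> (w x) - \<alpha> (g x)" for x
    \<comment> \<open>This exhibits w as a shift along F, with shift function \<beta> \<circ> f,
      composed with g; at y = g x the time \<beta> (f y) is \<beta> x.\<close>
    have "map_germ (g p) (\<lambda>y. flow y (\<beta> (f y)))" for p
      by (rule map_germ_shift) (use germ_map[OF f_germ \<beta>_germ] \<beta>_D[of p] in simp_all)
    from map_germ_compose[OF g_germ this] have w_germ: "map_germ p w" for p
      by (simp add: w_def[abs_def])
    have \<tau>_germ: "germ p \<tau>" for p
      unfolding \<tau>_def[abs_def]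
      by (intro germ_add germ_diff \<beta>_germ germ_map[OF w_germ \<alpha>_germ] germ_map[OF g_germ \<alpha>_germ])
    have \<tau>: "\<tau> x \<in> D x \<and> flow x (\<tau> x) = h x" for x
    proof -
      let ?y = "g x"
      have x: "flow ?y (\<alpha> ?y) = x" using f[of ?y] by simp
      have sum: "\<alpha> ?y + \<tau> x = \<beta> x + \<alpha> (w x)" by (simp add: \<tau>_def)
      have D: "\<beta> x + \<alpha> (w x) \<in> D ?y"
        using D_flow_iff[OF \<beta>_D[of x], of "\<alpha> (w x)"] \<alpha>_D[of "w x"] by (simp add: w_def)
      have "\<tau> x \<in> D x" using D_flow_iff[OF \<alpha>_D[of ?y], of "\<tau> x"] D x sum by simp
      moreover have "flow x (\<tau> x) = flow ?y (\<beta> x + \<alpha> (w x))"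
        using flow_add[OF \<alpha>_D[of ?y], of "\<tau> x"] D x sum by simp
      moreover have "flow ?y (\<beta> x + \<alpha> (w x)) = f (w x)"
        using flow_add[OF \<beta>_D[of x] D] f[of "w x"] by (simp add: w_def)
      moreover have "h x = f (w x)" by (simp add: \<beta>(2) shift_map_def local_flow_conjugate[OF \<beta>_D] w_def)
      ultimately show ?thesis by simp
    qed
    then have "\<tau> \<in> func A F" "shift_map A F \<tau> = h" using \<tau>_germ by (auto simp: func_iff shift_map_def)
    then show "h \<in> Sh A F" unfolding Sh_def by blast
  qed
  moreover have "Sh A F \<subseteq> Sh A G"
  proof
    fix h assume "h \<in> Sh A F"
    then obtain \<beta> where \<beta>: "\<beta> \<in> func A F" "h = shift_map A F \<beta>" by (auto simp: Sh_def)
    have \<beta>_D: "\<beta> x \<in> D x" and \<beta>_germ: "germ p \<beta>" for x p using \<beta>(1) by (auto simp: func_iff)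
    have h: "h x = flow x (\<beta> x)" for x by (simp add: \<beta>(2) shift_map_def)
    define w where "w x = g (h x)" for x
    \<comment> \<open>From g x one reaches x in time \<alpha> (g x), then h x in time \<beta> x, and
      goes back to w x = g (h x) in time -\<alpha> (w x). Applying f gives h x, as the conjugate
      flow requires.\<close>
    define \<tau> where "\<tau> x = \<alpha> (g x) + \<beta> x - \<alpha> (w x)" for x
    have "map_germ p h" for p
      unfolding \<beta>(2) shift_map_def by (rule map_germ_shift[OF \<beta>_germ \<beta>_D])
    from map_germ_compose[OF this g_germ] have w_germ: "map_germ p w" for p
      by (simp add: w_def[abs_def])
    have \<tau>_germ: "germ p \<tau>" for p
      unfolding \<tau>_def[abs_def]
      by (intro germ_add germ_diff \<beta>_germ germ_map[OF w_germ \<alpha>_germ] germ_map[OF g_germ \<alpha>_germ])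
    have \<tau>: "\<tau> x \<in> D (g x) \<and> local_flow A G x (\<tau> x) = h x" for x
    proof -
      let ?y = "g x" and ?r = "\<alpha> (g x) + \<beta> x"
      have x: "flow ?y (\<alpha> ?y) = x" using f[of ?y] by simp
      have r: "?r \<in> D ?y" using D_flow_iff[OF \<alpha>_D[of ?y], of "\<beta> x"] \<beta>_D[of x] x by simp
      have hx: "flow ?y ?r = h x" using flow_add[OF \<alpha>_D[of ?y] r] x h by simp
      have wx: "flow (w x) (\<alpha> (w x)) = h x" using f[of "w x"] by (simp add: w_def)
      have m: "- \<alpha> (w x) \<in> D (h x)" "flow (h x) (- \<alpha> (w x)) = w x"
        using flow_minus[OF \<alpha>_D[of "w x"]] wx by simp_all
      have D: "\<tau> x \<in> D ?y" using D_flow_iff[OF r, of "- \<alpha> (w x)"] m(1) hx by (simp add: \<tau>_def)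
      moreover have "flow ?y (\<tau> x) = w x"
        using flow_add[OF r, of "- \<alpha> (w x)"] D m(2) hx by (simp add: \<tau>_def)
      ultimately show ?thesis by (simp add: local_flow_conjugate w_def)
    qed
    then have "\<tau> \<in> func A G" "shift_map A G \<tau> = h"
      using \<tau>_germ by (auto simp: func_iff shift_map_def conjugate_interval)
    then show "h \<in> Sh A G" unfolding Sh_def by blast
  qed
  ultimately show ?thesis by (simp add: f_def)
qed

theorem theorem1p0p2:
  fixes V :: "'e::euclidean_space set"
    and e :: 'e
    and A :: "('a::{t2_space, second_countable_topology}, 'e) chart set"
    and F :: "('a, 'e) vector_field"
  assumes "smooth_manifold V e A"
    and "smooth_vector_field V A F"
    and "tangent_to_boundary e A F"
  shows "(\<forall>z \<alpha> f g.
            smooth_function_germ A z \<alpha> \<and>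
            (\<forall>\<^sub>F x in nhds z. (x, \<alpha> x) \<in> flow_domain A F \<and> f x = local_flow A F x (\<alpha> x)) \<and>
            diffeomorphism_germ A z f g \<longrightarrow>
              (\<forall>\<^sub>F y in nhds (f z).
                 pushforward A f g F y
                 = scale_field (\<lambda>y. 1 + derivative_along A F \<alpha> (g y)) F y) \<and>
              reparametrization_germ A (f z) F (pushforward A f g F)) \<and>
         (\<forall>\<alpha>. \<alpha> \<in> func A F \<and> diffeomorphism A (shift_map A F \<alpha>) \<longrightarrow>
              Sh A (pushforward A (shift_map A F \<alpha>) (inv (shift_map A F \<alpha>)) F) = Sh A F)"
proof -
  interpret flow_field V e A F
    using assms by unfold_locales
  show ?thesis
    by (intro conjI allI impI; elim conjE)
      (rule pushforward_shift_germ reparametrization_germ_shift Sh_pushforward; assumption)+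
qed

end
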